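(* Let $T_n=\ln n$. Assume that for each $a\in\{0,1\}$ there exist $\eta>\zeta>0$ (so $T_n=O(n^\zeta)$), $\alpha>\frac1{\eta-\zeta}$, a number $r$ with $\alpha(\eta-\zeta)>1+r$, and $\delta_0<1/\alpha$ such that $$\int_{0\le |t|\le T_n}\frac{|\varphi_n(t)-e^{-t^2}|}{|t|^a}\,dt=O(n^{-\eta}),\qquad \int_{0\le |t|\le T_n}\frac{|\phi_n(t)-e^{-t^2/2}|}{|t|^a}\,dt=O(n^{-\eta}),$$ and for $\mu$-a.a. $\omega$, $\|S_n^\omega A-S_k^\omega A\|_{L^1(\widehat\mu_\omega)}=O(n^{\delta_0/2}(n-k)^{1/2})$ for all $k<n$. Assume also that there exist constants $\delta\in(0,1)$, $C,c>0$ and $b>2$ such that for all $\theta\in[-\delta,\delta]$ and all $n\in\mathbb N$, $$\left|\int e^{i\theta S_n\widehat A}\,d\widehat\mu^{(2)}\right|\le Ce^{-c\theta^2n},$$ and for every $N\in\mathbb N$, $$\int_{\delta\le|\theta|\le N}\left|\int e^{i\theta S_n\widehat A}\,d\widehat\mu^{(2)}\right|d\theta=O(n^{-b}).$$ Then for every function $G:\mathbb R\to\mathbb R$ that is continuous with compact support or the indicator of a bounded interval, $$\lim_{n\to\infty}\sup_{u\in\mathbb R}\left|\sqrt{2\pi n}\int G(S_n^\omega A-u)\,d\widehat\mu_\omega-e^{-\frac{u^2}{2n}}\int G(x)\,dx\right|=0$$ for $\mu$-almost every $\omega$.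
   Context: Let $(\Sigma,\mathcal F,\mu)$ be a probability space and $T:\Sigma\to\Sigma$ a measurable $\mu$-preserving map. Let $X$ be a measurable space and $X_\omega\subset X$, $\omega\in\Sigma$, subsets such that $\mathcal E=\{(\omega,x):\omega\in\Sigma,\ x\in X_\omega\}$ is a measurable subset of $\Sigma\times X$. Let $f_\omega:X_\omega\to X_{T\omega}$ be maps such that $F_1:\mathcal E\to\mathcal E$, $F_1(\omega,x)=(T\omega,f_\omega x)$, is measurable. Let $\mathcal E_2=\{(\omega,x,y):\omega\in\Sigma,\ x,y\in X_\omega\}$ and $F_2(\omega,x,y)=(T\omega,f_\omega x,f_\omega y)$. Write $f_\omega^0=\mathrm{id}$, $f_\omega^j=f_{T^{j-1}\omega}\circ\cdots\circ f_\omega$. Fix a probability measure $\widehat\mu=\int\widehat\mu_\omega\,d\mu(\omega)$ on $\mathcal E$, where $\widehat\mu_\omega$ is a probability measure on $X_\omega$; it is not assumed $F_1$-invariant. Put $\widehat\mu^{(2)}=\int\widehat\mu_\omega\times\widehat\mu_\omega\,d\mu(\omega)$. Let $A:X\to\mathbb R$ be measurable, $S_n^\omega A=\sum_{j=0}^{n-1}A\circ f_\omega^j$, $S_nA(\omega,x)=S_n^\omega A(x)$, $\widehat A(x,y)=A(x)-A(y)$, and $S_n\widehat A(\omega,x,y)=S_n^\omega A(x)-S_n^\omega A(y)$. Put $$\varphi_n(t)=\int e^{itS_n\widehat A/\sqrt n}\,d\widehat\mu^{(2)},\qquad \phi_n(t)=\int e^{itS_nA/\sqrt n}\,d\widehat\mu.$$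 All asymptotics are as $n\to\infty$; implied constants in statements for fixed $\omega$ may depend on $\omega$, and the one in the integral over $\delta\le|\theta|\le N$ may depend on $N$. *)

theory Defs
  imports "HOL-Probability.Probability"
begin

text \<open>The fibred subset \<open>{(\<omega>, y). \<omega> \<in> \<Sigma>, y \<in> Y\<^sub>\<omega>}\<close> with the trace of the product sigma-algebra. With
  \<open>Y = X\<close> this is \<open>\<E>\<close>; with \<open>Y = X \<times> X\<close> and \<open>Y\<^sub>\<omega> = X\<^sub>\<omega> \<times> X\<^sub>\<omega>\<close> it is \<open>\<E>\<^sub>2\<close>.\<close>

definition fibre_set :: "'s measure \<Rightarrow> ('s \<Rightarrow> 'y set) \<Rightarrow> ('s \<times> 'y) set" where
  "fibre_set M Ys = {(\<omega>, y). \<omega> \<in> space M \<and> y \<in> Ys \<omega>}"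

definition fibre_space :: "'s measure \<Rightarrow> 'y measure \<Rightarrow> ('s \<Rightarrow> 'y set) \<Rightarrow> ('s \<times> 'y) measure" where
  "fibre_space M Y Ys = restrict_space (M \<Otimes>\<^sub>M Y) (fibre_set M Ys)"

text \<open>The measure \<open>\<integral>\<kappa>\<^sub>\<omega> d\<mu>(\<omega>)\<close> on the fibred set, where \<open>\<kappa>\<^sub>\<omega>\<close> lives on \<open>Y\<^sub>\<omega>\<close> and is
  transported to \<open>{\<omega>} \<times> Y\<^sub>\<omega>\<close>. Under the measurability hypothesis of the locale below it assigns
  \<open>\<integral>\<kappa>\<^sub>\<omega>(B\<^sub>\<omega>) d\<mu>(\<omega>)\<close> to \<open>B\<close>.\<close>

definition fibre_integral ::
    "'s measure \<Rightarrow> 'y measure \<Rightarrow> ('s \<Rightarrow> 'y set) \<Rightarrow> ('s \<Rightarrow> 'y measure) \<Rightarrow> ('s \<times> 'y) measure" where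
  "fibre_integral M Y Ys \<kappa> = M \<bind> (\<lambda>\<omega>. distr (\<kappa> \<omega>) (fibre_space M Y Ys) (Pair \<omega>))"

text \<open>\<open>\<nu> \<omega>\<close> is the fibre measure written \<open>\<mu>\<close> with a hat and index \<open>\<omega>\<close>. It lives on \<open>X\<^sub>\<omega>\<close> itself,
  not on \<open>X\<close>: the iterates of \<open>f\<^sub>\<omega>\<close> need not be measurable outside \<open>X\<^sub>\<omega>\<close>, and the Bochner
  integral of a non-measurable function is 0. The assumption \<open>kernel\<close> is what gives the
  integral of the fibre measures a meaning.\<close>

locale random_dynamics = prob_space M
  for M :: "'s measure" +
  fixes T :: "'s \<Rightarrow> 's"
    and X :: "'x measure"
    and Xs :: "'s \<Rightarrow> 'x set"
    and f :: "'s \<Rightarrow> 'x \<Rightarrow> 'x"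
    and \<nu> :: "'s \<Rightarrow> 'x measure"
  assumes T_measurable: "T \<in> M \<rightarrow>\<^sub>M M"
    and T_preserving: "distr M M T = M"
    and Xs_subset: "\<And>\<omega>. \<omega> \<in> space M \<Longrightarrow> Xs \<omega> \<subseteq> space X"
    and E_sets: "fibre_set M Xs \<in> sets (M \<Otimes>\<^sub>M X)"
    and f_maps: "\<And>\<omega>. \<omega> \<in> space M \<Longrightarrow> f \<omega> \<in> Xs \<omega> \<rightarrow> Xs (T \<omega>)"
    and F1_measurable:
      "(\<lambda>(\<omega>, x). (T \<omega>, f \<omega> x)) \<in> fibre_space M X Xs \<rightarrow>\<^sub>M fibre_space M X Xs"
    and \<nu>_prob: "\<And>\<omega>. \<omega> \<in> space M \<Longrightarrow> prob_space (\<nu> \<omega>)"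
    and \<nu>_sets: "\<And>\<omega>. \<omega> \<in> space M \<Longrightarrow> sets (\<nu> \<omega>) = sets (restrict_space X (Xs \<omega>))"
    and kernel: "\<And>B. B \<in> sets (fibre_space M X Xs) \<Longrightarrow>
      (\<lambda>\<omega>. emeasure (\<nu> \<omega>) {x. (\<omega>, x) \<in> B}) \<in> borel_measurable M"

definition mu_hat :: "'s measure \<Rightarrow> 'x measure \<Rightarrow> ('s \<Rightarrow> 'x set) \<Rightarrow> ('s \<Rightarrow> 'x measure) \<Rightarrow>
    ('s \<times> 'x) measure" where
  "mu_hat M X Xs \<nu> = fibre_integral M X Xs \<nu>"

definition mu_hat2 :: "'s measure \<Rightarrow> 'x measure \<Rightarrow> ('s \<Rightarrow> 'x set) \<Rightarrow> ('s \<Rightarrow> 'x measure) \<Rightarrow>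
    ('s \<times> 'x \<times> 'x) measure" where
  "mu_hat2 M X Xs \<nu> =
    fibre_integral M (X \<Otimes>\<^sub>M X) (\<lambda>\<omega>. Xs \<omega> \<times> Xs \<omega>) (\<lambda>\<omega>. \<nu> \<omega> \<Otimes>\<^sub>M \<nu> \<omega>)"

primrec fibre_iter :: "('s \<Rightarrow> 's) \<Rightarrow> ('s \<Rightarrow> 'x \<Rightarrow> 'x) \<Rightarrow> nat \<Rightarrow> 's \<Rightarrow> 'x \<Rightarrow> 'x" where
  "fibre_iter T f 0 \<omega> = id"
| "fibre_iter T f (Suc j) \<omega> = f ((T ^^ j) \<omega>) \<circ> fibre_iter T f j \<omega>"

definition birkhoff ::
    "('s \<Rightarrow> 's) \<Rightarrow> ('s \<Rightarrow> 'x \<Rightarrow> 'x) \<Rightarrow> ('x \<Rightarrow> real) \<Rightarrow> nat \<Rightarrow> 's \<Rightarrow> 'x \<Rightarrow> real" where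
  "birkhoff T f A n \<omega> x = (\<Sum>j<n. A (fibre_iter T f j \<omega> x))"

definition birkhoff2 ::
    "('s \<Rightarrow> 's) \<Rightarrow> ('s \<Rightarrow> 'x \<Rightarrow> 'x) \<Rightarrow> ('x \<Rightarrow> real) \<Rightarrow> nat \<Rightarrow> 's \<times> 'x \<times> 'x \<Rightarrow> real" where
  "birkhoff2 T f A n = (\<lambda>(\<omega>, x, y). birkhoff T f A n \<omega> x - birkhoff T f A n \<omega> y)"

definition char1 :: "'s measure \<Rightarrow> ('s \<Rightarrow> 's) \<Rightarrow> 'x measure \<Rightarrow> ('s \<Rightarrow> 'x set) \<Rightarrow> ('s \<Rightarrow> 'x \<Rightarrow> 'x) \<Rightarrow>
    ('s \<Rightarrow> 'x measure) \<Rightarrow> ('x \<Rightarrow> real) \<Rightarrow> nat \<Rightarrow> real \<Rightarrow> complex" where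
  "char1 M T X Xs f \<nu> A n t =
    (\<integral>(\<omega>, x). iexp (t * birkhoff T f A n \<omega> x / sqrt (real n)) \<partial>mu_hat M X Xs \<nu>)"

definition char2 :: "'s measure \<Rightarrow> ('s \<Rightarrow> 's) \<Rightarrow> 'x measure \<Rightarrow> ('s \<Rightarrow> 'x set) \<Rightarrow> ('s \<Rightarrow> 'x \<Rightarrow> 'x) \<Rightarrow>
    ('s \<Rightarrow> 'x measure) \<Rightarrow> ('x \<Rightarrow> real) \<Rightarrow> nat \<Rightarrow> real \<Rightarrow> complex" where
  "char2 M T X Xs f \<nu> A n t =
    (\<integral>z. iexp (t * birkhoff2 T f A n z / sqrt (real n)) \<partial>mu_hat2 M X Xs \<nu>)"

text \<open>For a sequence \<open>F\<close> with values in \<open>[0, \<infinity>]\<close>: \<open>F n = O(g n)\<close>. Integrals of nonnegative functions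
  are taken in this sense below, so that a divergent integral counts as infinite and does not
  satisfy the bound (the Bochner integral would be 0).\<close>

definition ennreal_bigo :: "(nat \<Rightarrow> ennreal) \<Rightarrow> (nat \<Rightarrow> real) \<Rightarrow> bool" where
  "ennreal_bigo F g \<longleftrightarrow> (\<exists>K::real. \<forall>\<^sub>F n in sequentially. F n \<le> ennreal (K * g n))"

end

theory Submission imports Defs "HOL-Real_Asymp.Real_Asymp"
begin

text \<open>Write \<open>\<psi>\<^sub>n(\<omega>, \<theta>)\<close> for the characteristic function of \<open>S\<^sub>n A\<close> under the fibre measure at \<open>\<omega>\<close>. The proof
  has an analytic half, for one fixed \<open>\<omega>\<close>, and a probabilistic half, which finds the good \<open>\<omega>\<close>.

  The analytic half shows that the local limit theorem holds for laws \<open>P n\<close> as soon as, for all \<open>L\<close>,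
  \<open>\<surd>n \<integral>\<^bsub>\<bar>\<theta>\<bar> \<le> L\<^esub> \<bar>char (P n) \<theta> - exp (- n \<theta>\<^sup>2 / 2)\<bar> d\<theta>\<close> tends to 0 (locale \<open>gaussian_char\<close>). The Fejer
  kernel has a compactly supported Fourier transform, so by Fourier inversion and Fubini its
  integrals against \<open>P n\<close> and against the normal law \<open>N(0, n)\<close> are uniformly \<open>o(1 / \<surd>n)\<close> apart
  (\<open>fejer_char_diff\<close>), and for \<open>N(0, n)\<close> the claim is elementary. A continuous \<open>G\<close> with compact
  support is approximated by its convolution with a narrow Fejer kernel. The error must be small
  after multiplication by \<open>\<surd>n\<close>, so it is bounded by a small multiple of a sum of two translates of a
  Fejer kernel (\<open>fejer_conv_approx\<close>), for which the local limit theorem is already known. Indicators of intervals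
  are squeezed between continuous trapezoids.

  The probabilistic half rests on the identity \<open>\<integral> \<bar>\<psi>\<^sub>n\<bar>\<^sup>2 d\<mu> = \<integral> exp (i \<theta> (S\<^sub>n A(x) - S\<^sub>n A(y))) d\<mu>'\<close>,
  where \<open>\<mu>'\<close> is \<open>mu_hat2\<close>, the measure on pairs of points in a common fibre: the hypotheses on the two averaged
  characteristic functions bound the second moment of \<open>\<psi>\<^sub>n\<close> minus its Gaussian limit
  (\<open>nn_second_moment_diff\<close>). A sequence of nonnegative functions with summable integrals tends
  to 0 almost surely, and the Cauchy-Schwarz inequality passes from square integrals in \<open>\<theta>\<close> to the
  integrals above. For \<open>\<bar>\<theta>\<bar> \<ge> ln n / (2 \<surd>n)\<close> the second moments, multiplied by \<open>n\<close>, are summable over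
  all \<open>n\<close>: this is where \<open>b > 2\<close> enters. For smaller frequencies they are only \<open>O(n\<^sup>-\<^sup>\<eta>)\<close>, which is
  summable along \<open>n\<^sub>k = \<lceil>k\<^sup>\<alpha>\<rceil>\<close>. Every \<open>n\<close> exceeds some \<open>n\<^sub>k\<close> by at most \<open>max \<alpha> 1 * n powr (1 - 1/\<alpha>)\<close>, and by the
  \<open>L\<^sup>1\<close> bound on increments replacing \<open>n\<close> by \<open>n\<^sub>k\<close> changes \<open>S\<^sub>n A / \<surd>n\<close> by
  \<open>O(n powr ((max \<delta>\<^sub>0 0 - 1/\<alpha>) / 2))\<close> in \<open>L\<^sup>1\<close>, a negative power of \<open>n\<close> that beats the factor \<open>(ln n)\<^sup>2\<close>
  from integrating over \<open>\<bar>t\<bar> \<le> ln n / 2\<close> (\<open>char_close_low_frequencies\<close>).\<close>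

section \<open>The Fejer kernel\<close>

text \<open>The kernel \<open>(1 - cos (L x)) / (\<pi> L x\<^sup>2)\<close>, written with \<open>sinc\<close> so that it is continuous at 0.\<close>

definition fejer :: "real \<Rightarrow> real \<Rightarrow> real" where
  "fejer L x = L / (2 * pi) * (sinc (L * x / 2))\<^sup>2"

text \<open>The Fourier transform of \<open>fejer L\<close>.\<close>

definition fejer_hat :: "real \<Rightarrow> real \<Rightarrow> real" where
  "fejer_hat L \<theta> = (1 - \<bar>\<theta>\<bar> / L) * indicator {-L..L} \<theta>"

lemma fejer_nonneg: "L > 0 \<Longrightarrow> 0 \<le> fejer L x"
  by (simp add: fejer_def)

lemma fejer_eq:
  assumes "L > 0" "x \<noteq> 0"
  shows "fejer L x = (1 - cos (L * x)) / (pi * L * x\<^sup>2)"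
  using assms cos_double_sin[of "L * x / 2"]
  by (simp add: fejer_def power_divide power_mult_distrib field_simps power2_eq_square)

lemma fejer_minus: "fejer L (- x) = fejer L x"
  by (simp add: fejer_def)

lemma continuous_on_fejer [continuous_intros]:
  "continuous_on S g \<Longrightarrow> continuous_on S (\<lambda>x. fejer L (g x))"
  unfolding fejer_def using continuous_on_sinc[of S "\<lambda>x. L * g x / 2"]
  by (intro continuous_intros) auto

lemma borel_measurable_fejer [measurable]: "fejer L \<in> borel_measurable borel"
  by (intro borel_measurable_continuous_onI continuous_intros)

lemma borel_measurable_fejer_hat [measurable]: "fejer_hat L \<in> borel_measurable borel"
  unfolding fejer_hat_def by measurable

lemma abs_sinc_le_1: "\<bar>sinc x\<bar> \<le> 1"
  using abs_sin_x_le_abs_x[of x] by (auto simp: divide_le_eq)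

lemma fejer_le: "L > 0 \<Longrightarrow> fejer L x \<le> L / (2 * pi)"
  unfolding fejer_def
  using abs_sinc_le_1[of "L * x / 2"] by (intro mult_left_le) (auto simp: abs_square_le_1)

lemma fejer_tail:
  assumes "L > 0" "x \<noteq> 0"
  shows "fejer L x \<le> 2 / (pi * L * x\<^sup>2)"
  using assms cos_ge_minus_one[of "L * x"] by (simp add: fejer_eq divide_right_mono)

lemma fejer_hat_bounds: "L > 0 \<Longrightarrow> 0 \<le> fejer_hat L \<theta>" "L > 0 \<Longrightarrow> fejer_hat L \<theta> \<le> indicator {-L..L} \<theta>"
  by (auto simp: fejer_hat_def indicator_def abs_le_iff)

lemma abs_fejer_hat_le_1: "L > 0 \<Longrightarrow> \<bar>fejer_hat L \<theta>\<bar> \<le> 1"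
  using fejer_hat_bounds(1)[of L \<theta>] fejer_hat_bounds(2)[of L \<theta>]
    indicator_le_1[of "{-L..L}" \<theta>, where 'a = real] by linarith

text \<open>Fourier inversion for the kernel, by an explicit antiderivative on each side of the corner of
  \<open>fejer_hat\<close> at 0.\<close>

lemma fejer_fourier:
  assumes L: "L > 0"
  shows "has_bochner_integral lborel (\<lambda>\<theta>. of_real (fejer_hat L \<theta>) * iexp (\<theta> * x))
    (complex_of_real (2 * pi * fejer L x))"
proof -
  define f where "f = (\<lambda>s \<theta>. complex_of_real (1 + s * \<theta> / L) * iexp (\<theta> * x))"
  \<comment> \<open>The sign \<open>s\<close> selects the half of the triangle; the two halves share only the point 0.\<close>
  have ae: "AE \<theta> in lborel. indicator {-L..0} \<theta> *\<^sub>R f 1 \<theta> + indicator {0..L} \<theta> *\<^sub>R f (-1) \<theta>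
      = of_real (fejer_hat L \<theta>) * iexp (\<theta> * x)"
    using AE_lborel_singleton[of 0]
    by eventually_elim (use L in \<open>auto simp: f_def fejer_hat_def indicator_def\<close>)
  have eq: "has_bochner_integral lborel (\<lambda>\<theta>. indicator {-L..0} \<theta> *\<^sub>R f 1 \<theta>) A
     \<Longrightarrow> has_bochner_integral lborel (\<lambda>\<theta>. indicator {0..L} \<theta> *\<^sub>R f (-1) \<theta>) B
     \<Longrightarrow> A + B = complex_of_real (2 * pi * fejer L x)
     \<Longrightarrow> ?thesis" for A B
    using has_bochner_integral_add[of lborel "\<lambda>\<theta>. indicator {-L..0} \<theta> *\<^sub>R f 1 \<theta>" A
        "\<lambda>\<theta>. indicator {0..L} \<theta> *\<^sub>R f (-1) \<theta>" B]
    by (subst has_bochner_integral_cong_AE[OF _ _ ae, symmetric])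
       (auto simp: f_def)
  have cont: "continuous_on S (f s)" for S s
    unfolding f_def by (intro continuous_intros) (use L in auto)
  show ?thesis
  proof (cases "x = 0")
    case True
    define F where "F = (\<lambda>s \<theta>. complex_of_real (\<theta> + s * \<theta>\<^sup>2 / (2 * L)))"
    have F: "(F s has_vector_derivative f s \<theta>) (at \<theta> within S)" for s \<theta> S
    proof -
      have "((\<lambda>\<theta>. \<theta> + s * \<theta>\<^sup>2 / (2 * L)) has_real_derivative (1 + s * \<theta> / L)) (at \<theta> within S)"
        using L by (auto intro!: derivative_eq_intros simp: field_simps)
      then show ?thesis
        using has_vector_derivative_of_real[of "\<lambda>\<theta>. \<theta> + s * \<theta>\<^sup>2 / (2 * L)"] True unfolding F_def f_def
        by (simp add: has_real_derivative_iff_has_vector_derivative del: of_real_add)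
    qed
    show ?thesis
    proof (rule eq)
      show "has_bochner_integral lborel (\<lambda>\<theta>. indicator {-L..0} \<theta> *\<^sub>R f 1 \<theta>) (F 1 0 - F 1 (-L))"
        using L by (intro has_bochner_integral_FTC_Icc F cont) auto
      show "has_bochner_integral lborel (\<lambda>\<theta>. indicator {0..L} \<theta> *\<^sub>R f (-1) \<theta>) (F (-1) L - F (-1) 0)"
        using L by (intro has_bochner_integral_FTC_Icc F cont) auto
      show "F 1 0 - F 1 (-L) + (F (-1) L - F (-1) 0) = complex_of_real (2 * pi * fejer L x)"
        using L True by (simp add: F_def fejer_def field_simps power2_eq_square flip: of_real_diff of_real_add)
    qed
  next
    case False
    define F where "F = (\<lambda>s \<theta>. (complex_of_real (1 + s * \<theta> / L) / (\<i> * x) + of_real (s / (L * x\<^sup>2))) * iexp (\<theta> * x))"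
    have F: "(F s has_vector_derivative f s \<theta>) (at \<theta> within S)" for s \<theta> S
    proof -
      define H where "H = (\<lambda>z::complex. ((1 + s * z / L) / (\<i> * x) + of_real (s / (L * x\<^sup>2))) * exp (\<i> * (z * x)))"
      have "(H has_field_derivative (1 + s * of_real \<theta> / L) * exp (\<i> * (of_real \<theta> * of_real x))) (at (complex_of_real \<theta>))"
        unfolding H_def using L False
        by (auto intro!: derivative_eq_intros simp: field_simps power2_eq_square)
      from has_vector_derivative_real_field[OF this]
      show ?thesis
        by (simp add: F_def f_def H_def)
    qed
    show ?thesis
    proof (rule eq)
      show "has_bochner_integral lborel (\<lambda>\<theta>. indicator {-L..0} \<theta> *\<^sub>R f 1 \<theta>) (F 1 0 - F 1 (-L))"
        using L by (intro has_bochner_integral_FTC_Icc F cont) auto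
      show "has_bochner_integral lborel (\<lambda>\<theta>. indicator {0..L} \<theta> *\<^sub>R f (-1) \<theta>) (F (-1) L - F (-1) 0)"
        using L by (intro has_bochner_integral_FTC_Icc F cont) auto
      have "F 1 0 - F 1 (-L) + (F (-1) L - F (-1) 0) 
         = (2 - (iexp (L * x) + iexp (- (L * x)))) / (L * x\<^sup>2)"
        using L False by (simp add: F_def field_simps)
      also have "iexp (L * x) + iexp (- (L * x)) = of_real (2 * cos (L * x))"
        by (simp add: complex_eq_iff Re_exp Im_exp)
      also have "(2 - complex_of_real (2 * cos (L * x))) / (L * x\<^sup>2) = complex_of_real (2 * pi * fejer L x)"
        using L False by (simp add: fejer_eq field_simps)
      finally show "F 1 0 - F 1 (-L) + (F (-1) L - F (-1) 0) = complex_of_real (2 * pi * fejer L x)" .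
    qed
  qed
qed

text \<open>The function \<open>sin\<^sup>2 x / x\<close>, including its removable singularity, is the boundary term when
  \<open>sinc\<^sup>2\<close> is integrated by parts.\<close>

lemma DERIV_sin_sinc:
  "((\<lambda>x. sin x * sinc x) has_real_derivative (2 * cos x * sinc x - (sinc x)\<^sup>2)) (at x)"
proof (cases "x = 0")
  case True
  have "((\<lambda>h. (sinc h)\<^sup>2) \<longlongrightarrow> (sinc 0)\<^sup>2) (at 0)"
    using isCont_sinc[of 0] by (intro tendsto_power) (simp add: isCont_def)
  moreover have "\<forall>\<^sub>F h in at 0. (sinc h)\<^sup>2 = sin h * sinc h / h"
    by (auto simp: eventually_at_filter power2_eq_square)
  ultimately have "((\<lambda>h. sin h * sinc h / h) \<longlongrightarrow> (sinc 0)\<^sup>2) (at 0)"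
    by (rule Lim_transform_eventually)
  then have "((\<lambda>h. (sin (0 + h) * sinc (0 + h) - sin 0 * sinc 0) / h) \<longlongrightarrow> 1) (at 0)"
    by (simp only: add_0 sin_zero mult_zero_left diff_zero) simp
  then show ?thesis
    unfolding DERIV_def True by (simp only: cos_zero) simp
next
  case False
  have "((\<lambda>x. sin x * (sin x / x)) has_real_derivative (2 * cos x * sinc x - (sinc x)\<^sup>2)) (at x)"
    using False by (auto intro!: derivative_eq_intros simp: field_simps power2_eq_square)
  then show ?thesis
    by (rule has_field_derivative_transform_within_open[of _ _ _ "- {0}"])
       (use False in auto)
qed

text \<open>Integration by parts reduces the total mass to Dirichlet's integral
  \<open>\<integral>\<^bsub>0\<^esub>\<^bsup>\<infinity>\<^esup> sinc x dx = \<pi> / 2\<close>.\<close>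

lemma fejer_has_integral:
  assumes L: "L > 0"
  shows "has_bochner_integral lborel (fejer L) 1"
proof -
  define F where "F = (\<lambda>x. (Si (L * x) - sin (L * x / 2) * sinc (L * x / 2)) / pi)"
  have sinc2: "sinc (2 * y) = cos y * sinc y" for y :: real
    by (auto simp: sin_double)
  have deriv: "DERIV F x :> fejer L x" for x
  proof -
    have 1: "((\<lambda>x. Si (L * x)) has_real_derivative sinc (L * x) * L) (at x)"
      by (rule DERIV_chain2[OF DERIV_Si]) (auto intro!: derivative_eq_intros)
    have 2: "((\<lambda>x. sin (L * x / 2) * sinc (L * x / 2)) has_real_derivative
        (2 * cos (L * x / 2) * sinc (L * x / 2) - (sinc (L * x / 2))\<^sup>2) * (L / 2)) (at x)"
      by (rule DERIV_chain2[OF DERIV_sin_sinc, where g = "\<lambda>x. L * x / 2"])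
         (auto intro!: derivative_eq_intros)
    have 3: "(F has_real_derivative (sinc (L * x) * L - 
        (2 * cos (L * x / 2) * sinc (L * x / 2) - (sinc (L * x / 2))\<^sup>2) * (L / 2)) / pi) (at x)"
      unfolding F_def by (rule DERIV_cdivide[OF DERIV_diff[OF 1 2]])
    have "sinc (L * x) = cos (L * x / 2) * sinc (L * x / 2)"
    proof -
      have "2 * (L * x / 2) = L * x" by simp
      with sinc2[of "L * x / 2"] show ?thesis by (simp only:)
    qed
    with 3 show ?thesis
      unfolding fejer_def
      by (simp only:) (simp add: algebra_simps add_divide_distrib diff_divide_distrib)
  qed
  have Lx: "filterlim (\<lambda>x. L * x) at_top at_top" 
    using L by (intro filterlim_tendsto_pos_mult_at_top[OF tendsto_const _ filterlim_ident])
  have "((\<lambda>x. sin (L * x / 2) * sinc (L * x / 2)) \<longlongrightarrow> 0) at_top"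
  proof (rule Lim_null_comparison)
    show "((\<lambda>x. 2 / (L * x)) \<longlongrightarrow> 0) at_top" using L by real_asymp
    show "\<forall>\<^sub>F x in at_top. norm (sin (L * x / 2) * sinc (L * x / 2)) \<le> 2 / (L * x)"
      using eventually_gt_at_top[of 0]
    proof eventually_elim
      case (elim x)
      have "\<bar>sin (L * x / 2) * sin (L * x / 2)\<bar> \<le> 1"
        unfolding abs_mult by (intro mult_le_one) auto
      then show ?case using elim L by (simp add: abs_mult field_simps)
    qed
  qed
  then have "(F \<longlongrightarrow> (pi / 2 - 0) / pi) at_top"
    unfolding F_def by (intro tendsto_intros filterlim_compose[OF Si_at_top Lx]) auto
  then have "(F \<longlongrightarrow> 1 / 2) at_top" by simp
  note nn = nn_integral_FTC_atLeast[OF _ deriv fejer_nonneg[OF L] this, of 0]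
  have "F 0 = 0"
    using Si_neg[of 0] by (simp add: F_def)
  with nn have half: "(\<integral>\<^sup>+x. ennreal (fejer L x) * indicator {0..} x \<partial>lborel) = ennreal (1/2)"
    by simp
  have "(\<integral>\<^sup>+x. ennreal (fejer L x) * indicator {..0} x \<partial>lborel)
      = (\<integral>\<^sup>+x. ennreal (fejer L x) * indicator {0..} x \<partial>lborel)"
    by (subst nn_integral_real_affine[where c = "-1" and t = 0])
       (auto simp: fejer_minus indicator_def intro!: nn_integral_cong)
  with half have "ennreal (1/2) + ennreal (1/2) = 
      (\<integral>\<^sup>+x. ennreal (fejer L x) * indicator {0..} x \<partial>lborel) +
      (\<integral>\<^sup>+x. ennreal (fejer L x) * indicator {..0} x \<partial>lborel)" by simp
  also have "\<dots> = (\<integral>\<^sup>+x. ennreal (fejer L x) * indicator {0..} x + ennreal (fejer L x) * indicator {..0} x \<partial>lborel)"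
    by (rule nn_integral_add[symmetric]) auto
  also have "\<dots> = (\<integral>\<^sup>+x. ennreal (fejer L x) \<partial>lborel)"
    by (intro nn_integral_cong_AE, use AE_lborel_singleton[of 0] in eventually_elim)
       (auto simp: indicator_def)
  also have "ennreal (1/2) + ennreal (1/2) = ennreal 1"
    by (subst ennreal_plus[symmetric]) auto
  finally show ?thesis
    by (intro has_bochner_integral_nn_integral) (auto simp: fejer_nonneg L)
qed


text \<open>Fubini moves the integral over the law inside the Fourier representation of the kernel. This is
  legitimate because \<open>fejer_hat\<close> is bounded with compact support; for the same reason only frequencies
  up to \<open>L\<close> enter.\<close>

lemma (in real_distribution) fejer_char:
  assumes L: "L > 0"
  shows "complex_of_real (2 * pi * (\<integral>x. fejer L (x - u) \<partial>M))
    = (\<integral>\<theta>. of_real (fejer_hat L \<theta>) * iexp (- (\<theta> * u)) * char M \<theta> \<partial>lborel)"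
proof -
  interpret P: pair_sigma_finite M lborel ..
  let ?f = "\<lambda>x \<theta>. complex_of_real (fejer_hat L \<theta>) * iexp (\<theta> * (x - u))"
  have int: "integrable (M \<Otimes>\<^sub>M lborel) (\<lambda>(x, \<theta>). ?f x \<theta>)"
  proof (rule integrableI_bounded_set[where A = "space M \<times> {-L..L}" and B = 1])
    show "emeasure (M \<Otimes>\<^sub>M lborel) (space M \<times> {-L..L}) < \<infinity>"
      using L emeasure_space_1
      by (subst lborel.emeasure_pair_measure_Times) (auto simp del: space_eq_univ events_eq_borel)
    show "AE x in M \<Otimes>\<^sub>M lborel. x \<in> space M \<times> {-L..L} \<longrightarrow> norm (case x of (x, \<theta>) \<Rightarrow> ?f x \<theta>) \<le> 1"
      by (intro AE_I2) (auto simp: norm_mult abs_fejer_hat_le_1[OF L] simp del: of_real_mult of_real_diff)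
    show "AE x in M \<Otimes>\<^sub>M lborel. x \<notin> space M \<times> {-L..L} \<longrightarrow> (case x of (x, \<theta>) \<Rightarrow> ?f x \<theta>) = 0"
      by (intro AE_I2) (auto simp: fejer_hat_def indicator_def)
  qed measurable
  have "complex_of_real (2 * pi * (\<integral>x. fejer L (x - u) \<partial>M)) = (\<integral>x. of_real (2 * pi * fejer L (x - u)) \<partial>M)"
    by simp
  also have "\<dots> = (\<integral>x. (\<integral>\<theta>. ?f x \<theta> \<partial>lborel) \<partial>M)"
    using has_bochner_integral_integral_eq[OF fejer_fourier[OF L]]
    by (intro Bochner_Integration.integral_cong refl) (simp only:)
  also have "\<dots> = (\<integral>\<theta>. (\<integral>x. ?f x \<theta> \<partial>M) \<partial>lborel)"
    by (rule P.Fubini_integral[OF int, symmetric])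
  also have "\<dots> = (\<integral>\<theta>. of_real (fejer_hat L \<theta>) * iexp (- (\<theta> * u)) * char M \<theta> \<partial>lborel)"
  proof (intro Bochner_Integration.integral_cong refl)
    fix \<theta>
    have "(\<integral>x. ?f x \<theta> \<partial>M) = (\<integral>x. (of_real (fejer_hat L \<theta>) * iexp (- (\<theta> * u))) * iexp (\<theta> * x) \<partial>M)"
      by (intro Bochner_Integration.integral_cong refl)
         (simp add: algebra_simps flip: exp_add)
    also have "\<dots> = of_real (fejer_hat L \<theta>) * iexp (- (\<theta> * u)) * char M \<theta>"
      unfolding char_def by (rule integral_mult_right_zero)
    finally show "(\<integral>x. ?f x \<theta> \<partial>M) = \<dots>" .
  qed
  finally show ?thesis .
qed

lemma fejer_char_diff:
  assumes "real_distribution P" "real_distribution Q" and L: "L > 0"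
  shows "2 * pi * \<bar>(\<integral>x. fejer L (x - u) \<partial>P) - (\<integral>x. fejer L (x - u) \<partial>Q)\<bar>
    \<le> (\<integral>\<theta>. indicator {-L..L} \<theta> * cmod (char P \<theta> - char Q \<theta>) \<partial>lborel)"
proof -
  interpret P: real_distribution P by fact
  interpret Q: real_distribution Q by fact
  let ?g = "\<lambda>R \<theta>. of_real (fejer_hat L \<theta>) * iexp (- (\<theta> * u)) * char R \<theta>"
  note hat1 = abs_fejer_hat_le_1[OF L]
  have hat0: "fejer_hat L \<theta> = 0" if "\<theta> \<notin> {-L..L}" for \<theta>
    using that by (auto simp: fejer_hat_def)
  have int: "integrable lborel (?g R)" if "real_distribution R" for R
  proof -
    interpret R: real_distribution R by fact
    show ?thesis
      by (rule integrableI_bounded_set[where A = "{-L..L}" and B = 1])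
         (use L in \<open>auto simp: norm_mult hat0 intro!: AE_I2 mult_le_one hat1 R.cmod_char_le_1 simp del: of_real_mult\<close>)
  qed
  have int2: "integrable lborel (\<lambda>\<theta>. indicator {-L..L} \<theta> * cmod (char P \<theta> - char Q \<theta>))"
  proof (rule integrableI_bounded_set[where A = "{-L..L}" and B = 2])
    have "cmod (char P \<theta> - char Q \<theta>) \<le> 2" for \<theta>
      using norm_triangle_ineq4[of "char P \<theta>" "char Q \<theta>"] P.cmod_char_le_1[of \<theta>] Q.cmod_char_le_1[of \<theta>] by linarith
    then show "AE \<theta> in lborel. \<theta> \<in> {-L..L} \<longrightarrow> norm (indicator {-L..L} \<theta> * cmod (char P \<theta> - char Q \<theta>)) \<le> 2"
      by auto
  qed (use L in auto)
  have "2 * pi * \<bar>(\<integral>x. fejer L (x - u) \<partial>P) - (\<integral>x. fejer L (x - u) \<partial>Q)\<bar> =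
      cmod (complex_of_real (2 * pi * (\<integral>x. fejer L (x - u) \<partial>P)) - complex_of_real (2 * pi * (\<integral>x. fejer L (x - u) \<partial>Q)))"
    by (simp flip: of_real_diff right_diff_distrib' add: norm_mult abs_mult)
  also have "\<dots> = cmod (\<integral>\<theta>. ?g P \<theta> - ?g Q \<theta> \<partial>lborel)"
    unfolding P.fejer_char[OF L] Q.fejer_char[OF L] 
    by (subst Bochner_Integration.integral_diff[OF int int]) (auto intro: assms)
  also have "\<dots> \<le> (\<integral>\<theta>. indicator {-L..L} \<theta> * cmod (char P \<theta> - char Q \<theta>) \<partial>lborel)"
  proof (rule Bochner_Integration.integral_norm_bound_integral[OF _ int2])
    show "integrable lborel (\<lambda>\<theta>. ?g P \<theta> - ?g Q \<theta>)"
      by (intro Bochner_Integration.integrable_diff int assms)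
    fix \<theta>
    have "cmod (?g P \<theta> - ?g Q \<theta>) = \<bar>fejer_hat L \<theta>\<bar> * cmod (char P \<theta> - char Q \<theta>)"
      by (simp add: norm_mult flip: right_diff_distrib' del: of_real_mult)
    also have "\<dots> \<le> indicator {-L..L} \<theta> * cmod (char P \<theta> - char Q \<theta>)"
      using fejer_hat_bounds[OF L, of \<theta>] by (intro mult_right_mono) auto
    finally show "cmod (?g P \<theta> - ?g Q \<theta>) \<le> \<dots>" .
  qed
  finally show ?thesis .
qed

section \<open>The local limit theorem for normal laws\<close>

text \<open>The conclusion of the local limit theorem for the test function \<open>G\<close>, with the supremum over \<open>u\<close>
  expressed by a uniform bound.\<close>

definition uniform_llt :: "(nat \<Rightarrow> real measure) \<Rightarrow> (real \<Rightarrow> real) \<Rightarrow> bool" where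
  "uniform_llt P G \<longleftrightarrow> (\<forall>\<epsilon>>0. \<forall>\<^sub>F n in sequentially. \<forall>u.
    \<bar>sqrt (2 * pi * real n) * (\<integral>x. G (x - u) \<partial>P n) - exp (- (u\<^sup>2) / (2 * real n)) * (\<integral>x. G x \<partial>lborel)\<bar> \<le> \<epsilon>)"

lemma gauss_lipschitz: "\<bar>exp (- (x\<^sup>2) / 2) - exp (- (y\<^sup>2) / 2)\<bar> \<le> \<bar>x - y\<bar>" for x y :: real
proof -
  have "norm (exp (- (x\<^sup>2) / 2) - exp (- (y\<^sup>2) / 2)) \<le> 1 * norm (x - y)"
  proof (rule field_differentiable_bound[where S = UNIV])
    fix z :: real
    show "((\<lambda>x. exp (- (x\<^sup>2) / 2)) has_real_derivative (- z * exp (- (z\<^sup>2) / 2))) (at z within UNIV)"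
      by (auto intro!: derivative_eq_intros simp: field_simps)
    \<comment> \<open>The derivative is bounded by 1 because \<open>\<bar>z\<bar> \<le> 1 + z\<^sup>2 / 2 \<le> exp (z\<^sup>2 / 2)\<close>.\<close>
    have "2 * \<bar>z\<bar> \<le> 1 + z\<^sup>2" using zero_le_power2[of "\<bar>z\<bar> - 1"] by (simp add: power2_diff)
    then have "\<bar>z\<bar> \<le> 1 + z\<^sup>2 / 2" by linarith
    also have "\<dots> \<le> exp (z\<^sup>2 / 2)" by (rule exp_ge_add_one_self)
    finally show "norm (- z * exp (- (z\<^sup>2) / 2)) \<le> 1"
      by (simp add: abs_mult exp_minus field_simps)
  qed auto
  then show ?thesis by simp
qed

lemma gauss_shift:
  assumes "n > 0"
  shows "\<bar>exp (- ((u + y)\<^sup>2) / (2 * real n)) - exp (- (u\<^sup>2) / (2 * real n))\<bar> \<le> \<bar>y\<bar> / sqrt (real n)"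
proof -
  have "exp (- ((v / sqrt n)\<^sup>2) / 2) = exp (- (v\<^sup>2) / (2 * real n))" for v
    by (simp add: power_divide mult.commute)
  moreover have "(u + y) / sqrt n - u / sqrt n = y / sqrt n"
    by (simp add: add_divide_distrib)
  ultimately show ?thesis
    using gauss_lipschitz[of "(u + y) / sqrt n" "u / sqrt n"] by (simp add: mult.commute)
qed

text \<open>The normal law with variance \<open>n\<close>; as an image of the standard one it also makes sense for \<open>n = 0\<close>.\<close>

definition scaled_normal :: "nat \<Rightarrow> real measure" where
  "scaled_normal n = distr std_normal_distribution borel (\<lambda>x. sqrt (real n) * x)"

lemma real_distribution_scaled_normal: "real_distribution (scaled_normal n)"
proof -
  interpret N: real_distribution std_normal_distribution by (rule real_dist_normal_dist)
  show ?thesis unfolding scaled_normal_def 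
    by (intro N.real_distribution_distr) simp
qed

lemma char_scaled_normal: "char (scaled_normal n) \<theta> = of_real (exp (- (real n * \<theta>\<^sup>2) / 2))"
proof -
  have "char (scaled_normal n) \<theta> = char std_normal_distribution (\<theta> * sqrt (real n))"
    unfolding char_def scaled_normal_def by (subst integral_distr) (auto simp: mult_ac)
  then show ?thesis
    by (simp add: char_std_normal_distribution power_mult_distrib mult_ac)
qed

lemma integral_scaled_normal:
  assumes [measurable]: "G \<in> borel_measurable borel" and n: "n > 0"
  shows "sqrt (2 * pi * real n) * (\<integral>x. G (x - u) \<partial>scaled_normal n)
    = (\<integral>y. G y * exp (- ((u + y)\<^sup>2) / (2 * real n)) \<partial>lborel)"
proof -
  have s: "sqrt (real n) > 0" "sqrt (real n) * sqrt (real n) = real n" using n by auto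
  have "(\<integral>x. G (x - u) \<partial>scaled_normal n) = (\<integral>x. std_normal_density x * G (sqrt (real n) * x - u) \<partial>lborel)"
    unfolding scaled_normal_def
    by (subst integral_distr, simp, simp, subst integral_density) auto
  also have "\<dots> = (1 / sqrt (real n)) * (\<integral>y. std_normal_density ((u + y) / sqrt (real n)) * G y \<partial>lborel)"
  proof -
    have "sqrt (real n) * (u / sqrt (real n) + 1 / sqrt (real n) * y) - u = y"
         "u / sqrt (real n) + 1 / sqrt (real n) * y = (u + y) / sqrt (real n)" for y
      using s(1) by (auto simp: distrib_left add_divide_distrib)
    then show ?thesis
      using s(1)
      by (subst lborel_integral_real_affine[where c = "1 / sqrt (real n)" and t = "u / sqrt (real n)"]) simp_all
  qed
  also have "(\<integral>y. std_normal_density ((u + y) / sqrt (real n)) * G y \<partial>lborel)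
     = (\<integral>y. (1 / sqrt (2 * pi)) * (G y * exp (- ((u + y)\<^sup>2) / (2 * real n))) \<partial>lborel)"
  proof (intro Bochner_Integration.integral_cong refl)
    fix y
    have "std_normal_density ((u + y) / sqrt (real n)) = 1 / sqrt (2 * pi) * exp (- ((u + y)\<^sup>2) / (2 * real n))"
      by (simp add: std_normal_density_def power_divide mult.commute)
    then show "std_normal_density ((u + y) / sqrt (real n)) * G y
      = (1 / sqrt (2 * pi)) * (G y * exp (- ((u + y)\<^sup>2) / (2 * real n)))"
      by (simp only: mult_ac)
  qed
  finally show ?thesis
    using s by (simp add: real_sqrt_mult)
qed

text \<open>Multiplied by \<open>\<surd>(2\<pi>n)\<close>, the integral of the translate of \<open>G\<close> by \<open>u\<close> is the Lebesgue integral of \<open>G y\<close> against the weight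
  \<open>exp (- (u + y)\<^sup>2 / 2n)\<close>, which moves by at most \<open>min 1 (\<bar>y\<bar> / \<surd>n)\<close> away from \<open>y = 0\<close>, uniformly in \<open>u\<close>.
  Dominated convergence applies for every integrable \<open>G\<close>.\<close>

lemma uniform_llt_scaled_normal:
  assumes G: "integrable lborel G"
  shows "uniform_llt scaled_normal G"
  unfolding uniform_llt_def
proof safe
  fix \<epsilon> :: real assume "\<epsilon> > 0"
  have [measurable]: "G \<in> borel_measurable borel" using G by auto
  let ?m = "\<lambda>n y. \<bar>G y\<bar> * min 1 (\<bar>y\<bar> / sqrt (real n))"
  have "(\<lambda>n. (\<integral>y. ?m n y \<partial>lborel)) \<longlonglongrightarrow> (\<integral>y. 0 \<partial>(lborel :: real measure))"
  proof (rule integral_dominated_convergence[where w = "\<lambda>y. \<bar>G y\<bar>"])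
    show "AE y in lborel. (\<lambda>n. ?m n y) \<longlonglongrightarrow> 0"
    proof (intro AE_I2 tendsto_mult_right_zero)
      fix y :: real
      have "(\<lambda>n. \<bar>y\<bar> / sqrt (real n)) \<longlonglongrightarrow> 0"
        by (intro real_tendsto_divide_at_top[OF tendsto_const] filterlim_compose[OF sqrt_at_top] filterlim_real_sequentially)
      then have "(\<lambda>n. min 1 (\<bar>y\<bar> / sqrt (real n))) \<longlonglongrightarrow> min 1 0"
        by (intro tendsto_intros)
      then show "(\<lambda>n. min 1 (\<bar>y\<bar> / sqrt (real n))) \<longlonglongrightarrow> 0" by simp
    qed
    show "AE y in lborel. norm (?m n y) \<le> \<bar>G y\<bar>" for n
      by (intro AE_I2) (auto simp: abs_mult intro!: mult_left_le)
  qed (use G in auto)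
  then have "\<forall>\<^sub>F n in sequentially. (\<integral>y. ?m n y \<partial>lborel) < \<epsilon>"
    using \<open>\<epsilon> > 0\<close> by (intro order_tendstoD(2)[where y = 0]) auto
  then show "\<forall>\<^sub>F n in sequentially. \<forall>u. \<bar>sqrt (2 * pi * real n) * (\<integral>x. G (x - u) \<partial>scaled_normal n)
      - exp (- (u\<^sup>2) / (2 * real n)) * (\<integral>x. G x \<partial>lborel)\<bar> \<le> \<epsilon>"
    using eventually_gt_at_top[of 0]
  proof (eventually_elim, intro allI)
    fix n :: nat and u
    assume n: "n > 0" and le: "(\<integral>y. ?m n y \<partial>lborel) < \<epsilon>"
    let ?e = "\<lambda>y. exp (- ((u + y)\<^sup>2) / (2 * real n))"
    have e01: "0 < ?e y" "?e y \<le> 1" for y by auto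
    have int: "integrable lborel (\<lambda>y. G y * ?e y)"
      by (rule Bochner_Integration.integrable_bound[OF G])
         (auto intro!: AE_I2 mult_left_le simp: abs_mult)
    have "\<bar>sqrt (2 * pi * real n) * (\<integral>x. G (x - u) \<partial>scaled_normal n)
      - exp (- (u\<^sup>2) / (2 * real n)) * (\<integral>x. G x \<partial>lborel)\<bar>
      = norm (\<integral>y. G y * ?e y - G y * ?e 0 \<partial>lborel)"
      using G int by (subst integral_scaled_normal[OF _ n]) (simp_all add: mult.commute)
    also have "\<dots> \<le> (\<integral>y. ?m n y \<partial>lborel)"
        proof (rule Bochner_Integration.integral_norm_bound_integral)
      show "integrable lborel (\<lambda>y. G y * ?e y - G y * ?e 0)" using G int by simp
      show "integrable lborel (?m n)"
        by (rule Bochner_Integration.integrable_bound[OF G])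
           (auto intro!: AE_I2 mult_left_le simp: abs_mult)
      fix y
      have "\<bar>?e y - ?e 0\<bar> \<le> \<bar>y\<bar> / sqrt (real n)" using gauss_shift[OF n, of u y] by simp
      moreover have "\<bar>?e y - ?e 0\<bar> \<le> 1" using e01[of y] e01[of 0] by linarith
      ultimately have "\<bar>?e y - ?e 0\<bar> \<le> min 1 (\<bar>y\<bar> / sqrt (real n))" by simp
      then have "\<bar>G y\<bar> * \<bar>?e y - ?e 0\<bar> \<le> ?m n y"
        by (intro mult_left_mono) auto
      then show "norm (G y * ?e y - G y * ?e 0) \<le> ?m n y"
        by (simp add: abs_mult flip: right_diff_distrib)
    qed
    finally show "\<bar>sqrt (2 * pi * real n) * (\<integral>x. G (x - u) \<partial>scaled_normal n)
      - exp (- (u\<^sup>2) / (2 * real n)) * (\<integral>x. G x \<partial>lborel)\<bar> \<le> \<epsilon>" using le by simp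
  qed
qed

section \<open>From characteristic functions to the local limit theorem\<close>

definition fejer_conv :: "(real \<Rightarrow> real) \<Rightarrow> real \<Rightarrow> real \<Rightarrow> real" where
  "fejer_conv G L x = (\<integral>y. G y * fejer L (x - y) \<partial>lborel)"

text \<open>A single Fejer kernel has zeros, so no multiple of it dominates \<open>(\<bar>x\<bar> + \<pi>)\<^sup>-\<^sup>2\<close>. In the translate by
  \<open>\<pi>\<close> the factor \<open>1 - cos x\<close> becomes \<open>1 + cos x\<close>, and the two factors add up to 2.\<close>

lemma fejer_sum_lower:
  "2 / (pi * (\<bar>x\<bar> + pi)\<^sup>2) \<le> fejer 1 x + fejer 1 (x + pi)"
proof -
  have lower: "(1 - cos z) / (pi * a\<^sup>2) \<le> fejer 1 z" if "\<bar>z\<bar> \<le> a" "a > 0" for a z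
  proof (cases "z = 0")
    case False
    then have "z\<^sup>2 \<le> a\<^sup>2" using that by (simp add: power2_le_iff_abs_le)
    then show ?thesis
      using False that cos_le_one[of z]
      by (auto simp: fejer_eq intro!: divide_left_mono mult_left_mono mult_pos_pos)
  qed (simp add: fejer_nonneg)
  have "2 / (pi * (\<bar>x\<bar> + pi)\<^sup>2) = (1 - cos x) / (pi * (\<bar>x\<bar> + pi)\<^sup>2) + (1 - cos (x + pi)) / (pi * (\<bar>x\<bar> + pi)\<^sup>2)"
    by (simp flip: add_divide_distrib)
  also have "\<dots> \<le> fejer 1 x + fejer 1 (x + pi)"
    using pi_gt_zero by (intro add_mono lower) linarith+
  finally show ?thesis .
qed

lemma integrable_bounded_support:
  fixes G :: "real \<Rightarrow> real"
  assumes "G \<in> borel_measurable borel" "\<And>x. \<bar>G x\<bar> \<le> B" "\<And>x. \<bar>x\<bar> > R \<Longrightarrow> G x = 0"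
  shows "integrable lborel G"
  by (rule integrableI_bounded_set[where A = "{-R..R}" and B = B])
     (use assms in \<open>auto simp: emeasure_lborel_Icc_eq abs_if split: if_splits\<close>)

text \<open>The bound on the error has to be a function whose integral against \<open>P n\<close> is known to be
  \<open>O(1 / \<surd>n)\<close>; a small constant would not do. Near the support of \<open>G\<close> uniform continuity and the small
  tail of a narrow kernel give a small constant, and far away the convolution is \<open>O(1 / (L x\<^sup>2))\<close>; both
  are below a multiple of \<open>(\<bar>x\<bar> + \<pi>)\<^sup>-\<^sup>2\<close>, hence of the sum of two Fejer kernels.\<close>

lemma fejer_conv_approx:
  assumes G: "continuous_on UNIV G" and B: "\<And>x. \<bar>G x\<bar> \<le> B" and R: "\<And>x. \<bar>x\<bar> > R \<Longrightarrow> G x = 0"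
    and R0: "R \<ge> 0" and \<epsilon>: "\<epsilon> > 0"
  shows "\<exists>L>0. \<forall>x. \<bar>fejer_conv G L x - G x\<bar> \<le> \<epsilon> * (fejer 1 x + fejer 1 (x + pi))"
proof -
  have [measurable]: "G \<in> borel_measurable borel"
    using G by (rule borel_measurable_continuous_onI)
  have B0: "B \<ge> 0" using B[of 0] by linarith
  have Gint: "integrable lborel G"
    by (rule integrable_bounded_support[OF _ B R]) auto
  \<comment> \<open>For \<open>\<bar>x\<bar> \<le> 2R + 1\<close> one has \<open>\<bar>x\<bar> + \<pi> \<le> 2R + 5\<close>, so an error of \<open>2\<omega>\<close> is admissible there.\<close>
  define \<omega> where "\<omega> = \<epsilon> / (pi * (2 * R + 5)\<^sup>2)"
  have \<omega>: "\<omega> > 0" using \<epsilon> R0 by (simp add: \<omega>_def)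
  obtain r where r: "0 < r" "\<And>x y. \<bar>x - y\<bar> < r \<Longrightarrow> \<bar>G x - G y\<bar> \<le> \<omega>"
  proof -
    have "uniformly_continuous_on {-(R+1)..R+1} G"
      by (intro compact_uniformly_continuous continuous_on_subset[OF G]) auto
    then obtain d where d: "d > 0" "\<And>x y. x \<in> {-(R+1)..R+1} \<Longrightarrow> y \<in> {-(R+1)..R+1} \<Longrightarrow> dist y x < d \<Longrightarrow> dist (G y) (G x) < \<omega>"
      using \<omega> unfolding uniformly_continuous_on_def by metis
    show ?thesis
    proof (rule that[of "min d 1"])
      fix x y :: real assume xy: "\<bar>x - y\<bar> < min d 1"
      show "\<bar>G x - G y\<bar> \<le> \<omega>"
      proof (cases "\<bar>x\<bar> \<le> R + 1 \<and> \<bar>y\<bar> \<le> R + 1")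
        case True
        then show ?thesis using d(2)[of y x] xy by (auto simp: dist_real_def abs_le_iff)
      next
        case False
        then have "\<bar>x\<bar> > R" "\<bar>y\<bar> > R" using xy by linarith+
        then show ?thesis using R \<omega> by simp
      qed
    qed (use d in auto)
  qed
  define K where "K = (\<integral>y. inverse (1 + y\<^sup>2) \<partial>(lborel :: real measure))"
  have Kint: "integrable lborel (\<lambda>y::real. inverse (1 + y\<^sup>2))"
    using integrable_inverse_1_plus_square by (simp add: set_integrable_def einterval_eq)
  have K0: "K \<ge> 0" unfolding K_def by (intro integral_nonneg_AE AE_I2) (auto simp: add_nonneg_nonneg)
  \<comment> \<open>\<open>C1 / L\<close> bounds the contribution of \<open>\<bar>y\<bar> \<ge> r\<close>, where \<open>1 / y\<^sup>2 \<le> (1 + 1 / r\<^sup>2) / (1 + y\<^sup>2)\<close>; \<open>C2 / L\<close> is the constant of the far field.\<close>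
  define C1 where "C1 = 4 * B * (1 + 1 / r\<^sup>2) * K / pi"
  define C2 where "C2 = 50 * R * B"
  have C: "C1 \<ge> 0" "C2 \<ge> 0" using B0 K0 R0 by (auto simp: C1_def C2_def)
  define L where "L = 1 + C1 / \<omega> + C2 / \<epsilon>"
  have CL: "C1 / \<omega> \<ge> 0" "C2 / \<epsilon> \<ge> 0" using C \<omega> \<epsilon> by auto
  have L: "L > 0" "C1 / \<omega> \<le> L" "C2 / \<epsilon> \<le> L" using CL unfolding L_def by linarith+
  have L1: "C1 / L \<le> \<omega>" "C2 / L \<le> \<epsilon>" 
    using L \<omega> \<epsilon> by (auto simp: field_simps)
  have fint: "has_bochner_integral lborel (fejer L) 1" by (rule fejer_has_integral[OF L(1)])
  have near: "\<bar>fejer_conv G L x - G x\<bar> \<le> 2 * \<omega>" for x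
  proof -
    let ?w = "\<lambda>y. \<omega> * fejer L y + (4 * B * (1 + 1 / r\<^sup>2) / (pi * L)) * inverse (1 + y\<^sup>2)"
    have int1: "integrable lborel (\<lambda>y. G (x - y) * fejer L y)"
      by (rule Bochner_Integration.integrable_bound[of _ "\<lambda>y. B * fejer L y"])
         (use fint B0 in \<open>auto simp: has_bochner_integral_iff abs_mult fejer_nonneg L intro!: AE_I2 mult_mono B\<close>)
    have "fejer_conv G L x = (\<integral>y. G (x - y) * fejer L y \<partial>lborel)"
      unfolding fejer_conv_def
      by (subst lborel_integral_real_affine[where c = "-1" and t = x]) simp_all
    moreover have "G x = (\<integral>y. G x * fejer L y \<partial>lborel)"
      using fint by (simp add: has_bochner_integral_iff)
    ultimately have "\<bar>fejer_conv G L x - G x\<bar> = norm (\<integral>y. G (x - y) * fejer L y - G x * fejer L y \<partial>lborel)"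
      using int1 fint by (subst Bochner_Integration.integral_diff) (auto simp: has_bochner_integral_iff)
    also have "\<dots> \<le> (\<integral>y. ?w y \<partial>lborel)"
    proof (rule Bochner_Integration.integral_norm_bound_integral)
      show "integrable lborel (\<lambda>y. G (x - y) * fejer L y - G x * fejer L y)"
        using int1 fint by (auto simp: has_bochner_integral_iff)
      show "integrable lborel ?w" using Kint fint by (auto simp: has_bochner_integral_iff)
      fix y :: real
      show "norm (G (x - y) * fejer L y - G x * fejer L y) \<le> ?w y"
      proof (cases "\<bar>y\<bar> < r")
        case True
        then have "\<bar>G (x - y) - G x\<bar> * fejer L y \<le> \<omega> * fejer L y"
          using r(2)[of "x - y" x] by (intro mult_right_mono fejer_nonneg L) auto
        moreover have "0 \<le> (4 * B * (1 + 1 / r\<^sup>2) / (pi * L)) * inverse (1 + y\<^sup>2)"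
          using B0 L by (intro mult_nonneg_nonneg divide_nonneg_nonneg) (auto simp: add_nonneg_nonneg)
        ultimately show ?thesis
          by (simp add: abs_mult fejer_nonneg L flip: left_diff_distrib)
      next
        case False
        then have y: "y \<noteq> 0" "r\<^sup>2 \<le> y\<^sup>2" using r(1) by (auto intro: power2_le_iff_abs_le[THEN iffD2] simp: abs_le_square_iff[symmetric])
        have "\<bar>G (x - y) - G x\<bar> \<le> 2 * B" using B[of "x - y"] B[of x] by linarith
        moreover have "1 / y\<^sup>2 \<le> (1 + 1 / r\<^sup>2) * inverse (1 + y\<^sup>2)"
        proof -
          have "1 + y\<^sup>2 \<le> (1 + 1 / r\<^sup>2) * y\<^sup>2" using y r by (simp add: field_simps)
          moreover have "0 < y\<^sup>2" "0 < 1 + y\<^sup>2" using y by (auto simp: add_pos_nonneg)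
          ultimately show ?thesis by (simp add: field_simps)
        qed
        ultimately have "\<bar>G (x - y) - G x\<bar> * fejer L y \<le> 2 * B * (2 / (pi * L) * ((1 + 1 / r\<^sup>2) * inverse (1 + y\<^sup>2)))"
        proof (intro mult_mono)
          assume *: "1 / y\<^sup>2 \<le> (1 + 1 / r\<^sup>2) * inverse (1 + y\<^sup>2)"
          have "fejer L y \<le> 2 / (pi * L) * (1 / y\<^sup>2)" using fejer_tail[OF L(1) y(1)] by simp
          also have "\<dots> \<le> 2 / (pi * L) * ((1 + 1 / r\<^sup>2) * inverse (1 + y\<^sup>2))"
            using L by (intro mult_left_mono *) auto
          finally show "fejer L y \<le> \<dots>" .
        qed (use B0 L in \<open>auto simp: fejer_nonneg\<close>)
        also have "\<dots> \<le> ?w y" using \<omega> L by (simp add: fejer_nonneg field_simps)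
        finally show ?thesis
          by (simp add: abs_mult fejer_nonneg L flip: left_diff_distrib)
      qed
    qed
    also have "(\<integral>y. ?w y \<partial>lborel) = \<omega> + C1 / L"
      using fint Kint by (simp add: has_bochner_integral_iff K_def[symmetric] C1_def)
    also have "\<dots> \<le> 2 * \<omega>" using L1 by simp
    finally show ?thesis .
  qed
  have far: "\<bar>fejer_conv G L x - G x\<bar> \<le> \<epsilon> * (2 / (pi * (\<bar>x\<bar> + pi)\<^sup>2))" if x: "\<bar>x\<bar> \<ge> 2 * R + 1" for x
  proof -
    define D where "D = 2 / (pi * L * ((\<bar>x\<bar> + pi) / 5)\<^sup>2)"
    have D0: "D \<ge> 0" using L by (simp add: D_def)
    have G0: "G x = 0" using x R0 by (intro R) linarith
    have le: "norm (G y * fejer L (x - y)) \<le> B * D * indicator {-R..R} y" for y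
    proof (cases "\<bar>y\<bar> \<le> R")
      case True
      then have "\<bar>x\<bar> - R \<le> \<bar>x - y\<bar>" using abs_triangle_ineq2[of x y] by linarith
      moreover have "(t + p) / 5 \<le> t - R" if "t \<ge> 2 * R + 1" "p < 4" for t p :: real
        using that R0 by (simp add: field_simps)
      ultimately have xy: "(\<bar>x\<bar> + pi) / 5 \<le> \<bar>x - y\<bar>"
        using x pi_less_4 order_trans by blast
      have pos: "0 < (\<bar>x\<bar> + pi) / 5" using pi_gt_zero by (intro divide_pos_pos add_nonneg_pos) auto
      have "fejer L (x - y) \<le> 2 / (pi * L * (x - y)\<^sup>2)"
        using xy pos L by (intro fejer_tail) auto
      also have "\<dots> \<le> D"
      proof -
        have "((\<bar>x\<bar> + pi) / 5)\<^sup>2 \<le> (x - y)\<^sup>2" using power_mono[OF xy, of 2] pos by simp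
        then show ?thesis unfolding D_def using L pos xy
          by (intro divide_left_mono mult_left_mono mult_pos_pos) (auto simp: zero_less_power2)
      qed
      finally show ?thesis using True B[of y] B0 D0 L
        by (auto simp: abs_mult fejer_nonneg abs_le_iff intro!: mult_mono)
    qed (use R[of y] B0 D0 in auto)
    have "\<bar>fejer_conv G L x - G x\<bar> = norm (\<integral>y. G y * fejer L (x - y) \<partial>lborel)"
      by (simp add: G0 fejer_conv_def)
    also have "\<dots> \<le> (\<integral>y. B * D * indicator {-R..R} y \<partial>lborel)"
      using le R0 by (intro Bochner_Integration.integral_norm_bound_integral Bochner_Integration.integrable_bound[where f="\<lambda>y. B * D * indicator {-R..R} y" and g="\<lambda>y. G y * fejer L (x - y)"])
        (auto intro!: AE_I2 order_trans[OF le[unfolded real_norm_def] abs_ge_self])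
    also have "\<dots> = B * D * (2 * R)" using R0 by simp
    also have "\<dots> = (C2 / L) * (2 / (pi * (\<bar>x\<bar> + pi)\<^sup>2))"
      by (simp add: D_def C2_def power_divide mult_ac)
    also have "\<dots> \<le> \<epsilon> * (2 / (pi * (\<bar>x\<bar> + pi)\<^sup>2))"
      by (intro mult_right_mono L1) simp
    finally show ?thesis .
  qed
  show ?thesis
  proof (intro exI[of _ L] conjI allI L(1))
    fix x
    have "\<bar>fejer_conv G L x - G x\<bar> \<le> \<epsilon> * (2 / (pi * (\<bar>x\<bar> + pi)\<^sup>2))"
    proof (cases "\<bar>x\<bar> \<ge> 2 * R + 1")
      case False
      have "(\<bar>x\<bar> + pi)\<^sup>2 \<le> (2 * R + 5)\<^sup>2" using False pi_less_4 pi_gt_zero by (intro power_mono) linarith+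
      moreover have "0 < (\<bar>x\<bar> + pi)\<^sup>2" using pi_gt_zero by (intro zero_less_power add_nonneg_pos) auto
      ultimately have "2 * \<omega> \<le> \<epsilon> * (2 / (pi * (\<bar>x\<bar> + pi)\<^sup>2))"
        using \<epsilon> R0 by (simp add: \<omega>_def frac_le)
      then show ?thesis using near[of x] by linarith
    qed (rule far)
    also have "\<dots> \<le> \<epsilon> * (fejer 1 x + fejer 1 (x + pi))"
      using \<epsilon> by (intro mult_left_mono fejer_sum_lower) auto
    finally show "\<bar>fejer_conv G L x - G x\<bar> \<le> \<dots>" .
  qed
qed


text \<open>The Fourier-analytic input of the local limit theorem. In the variable \<open>t = \<surd>n \<theta>\<close> it says that the
  characteristic functions of the normalised laws are close to \<open>exp (- t\<^sup>2 / 2)\<close> in \<open>L\<^sup>1\<close> over intervals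
  of length proportional to \<open>\<surd>n\<close>.\<close>

locale gaussian_char =
  fixes P :: "nat \<Rightarrow> real measure"
  assumes real_distribution: "\<And>n. real_distribution (P n)"
    and char_close: "\<And>L. L > 0 \<Longrightarrow>
      (\<lambda>n. sqrt (real n) * (\<integral>\<theta>. indicator {-L..L} \<theta> * cmod (char (P n) \<theta> - of_real (exp (- (real n * \<theta>\<^sup>2) / 2))) \<partial>lborel))
        \<longlonglongrightarrow> 0"
begin

lemma uniform_llt_fejer:
  assumes L: "L > 0"
  shows "uniform_llt P (fejer L)"
  unfolding uniform_llt_def
proof safe
  fix \<epsilon> :: real assume \<epsilon>: "\<epsilon> > 0"
  let ?I = "\<lambda>n. \<integral>\<theta>. indicator {-L..L} \<theta> * cmod (char (P n) \<theta> - of_real (exp (- (real n * \<theta>\<^sup>2) / 2))) \<partial>lborel"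
  have "\<forall>\<^sub>F n in sequentially. sqrt (real n) * ?I n < \<epsilon> / 2"
    using char_close[OF L] \<epsilon> by (intro order_tendstoD(2)[where y = 0]) auto
  moreover have "uniform_llt scaled_normal (fejer L)"
    using fejer_has_integral[OF L] by (intro uniform_llt_scaled_normal) (simp add: has_bochner_integral_iff)
  then have "\<forall>\<^sub>F n in sequentially. \<forall>u. \<bar>sqrt (2 * pi * real n) * (\<integral>x. fejer L (x - u) \<partial>scaled_normal n)
      - exp (- (u\<^sup>2) / (2 * real n)) * (\<integral>x. fejer L x \<partial>lborel)\<bar> \<le> \<epsilon> / 2"
    unfolding uniform_llt_def using \<epsilon> half_gt_zero by blast
  ultimately show "\<forall>\<^sub>F n in sequentially. \<forall>u. \<bar>sqrt (2 * pi * real n) * (\<integral>x. fejer L (x - u) \<partial>P n)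
      - exp (- (u\<^sup>2) / (2 * real n)) * (\<integral>x. fejer L x \<partial>lborel)\<bar> \<le> \<epsilon>"
  proof (eventually_elim, intro allI)
    fix n u
    assume 1: "sqrt (real n) * ?I n < \<epsilon> / 2"
      and 2: "\<forall>u. \<bar>sqrt (2 * pi * real n) * (\<integral>x. fejer L (x - u) \<partial>scaled_normal n)
      - exp (- (u\<^sup>2) / (2 * real n)) * (\<integral>x. fejer L x \<partial>lborel)\<bar> \<le> \<epsilon> / 2"
    define a where "a = (\<integral>x. fejer L (x - u) \<partial>P n)"
    define b where "b = (\<integral>x. fejer L (x - u) \<partial>scaled_normal n)"
    have "2 * pi * \<bar>a - b\<bar> \<le> ?I n"
      using fejer_char_diff[OF real_distribution real_distribution_scaled_normal L, of n u n]
      by (simp add: a_def b_def char_scaled_normal)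
    moreover have "sqrt (2 * pi) \<le> 2 * pi"
      using pi_ge_two by (intro real_le_lsqrt) (auto simp: power2_eq_square)
    ultimately have "sqrt (2 * pi) * \<bar>a - b\<bar> \<le> ?I n"
      by (meson abs_ge_zero mult_right_mono order_trans)
    then have "sqrt (real n) * (sqrt (2 * pi) * \<bar>a - b\<bar>) \<le> sqrt (real n) * ?I n"
      by (rule mult_left_mono) simp
    then have "\<bar>sqrt (2 * pi * real n) * a - sqrt (2 * pi * real n) * b\<bar> \<le> \<epsilon> / 2"
      using 1 unfolding right_diff_distrib[symmetric] abs_mult
      by (simp add: real_sqrt_mult mult_ac)
    then show "\<bar>sqrt (2 * pi * real n) * (\<integral>x. fejer L (x - u) \<partial>P n)
      - exp (- (u\<^sup>2) / (2 * real n)) * (\<integral>x. fejer L x \<partial>lborel)\<bar> \<le> \<epsilon>"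
      using 2[rule_format, of u] unfolding a_def[symmetric] b_def[symmetric] by linarith
  qed
qed

text \<open>Since \<open>\<integral> G * k d\<mu>\<close> is the integral over \<open>y\<close> of \<open>G y\<close> times the integral of the translate of \<open>k\<close> by \<open>y\<close>,
  uniformity in \<open>u\<close> for the kernel carries over to the convolution. The limit \<open>\<integral> G\<close> appears at once, as
  the kernel has mass 1 and the Gaussian weight hardly changes over the support of \<open>G\<close>.\<close>

lemma uniform_llt_fejer_conv:
  assumes [measurable]: "G \<in> borel_measurable borel" and B: "\<And>x. \<bar>G x\<bar> \<le> B" and R: "\<And>x. \<bar>x\<bar> > R \<Longrightarrow> G x = 0"
    and L: "L > 0" and \<epsilon>: "\<epsilon> > 0"
  shows "\<forall>\<^sub>F n in sequentially. \<forall>u. \<bar>sqrt (2 * pi * real n) * (\<integral>x. fejer_conv G L (x - u) \<partial>P n)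
      - exp (- (u\<^sup>2) / (2 * real n)) * (\<integral>x. G x \<partial>lborel)\<bar> \<le> \<epsilon>"
proof -
  have Gint: "integrable lborel G" by (rule integrable_bounded_support[OF _ B R]) auto
  have B0: "B \<ge> 0" using B[of 0] by linarith
  define J where "J = (\<integral>y. \<bar>G y\<bar> \<partial>lborel)"
  have J0: "J \<ge> 0" by (simp add: J_def)
  define R' where "R' = max R 0"
  have R': "R' \<ge> 0" "\<And>x. \<bar>x\<bar> > R' \<Longrightarrow> G x = 0" using R by (auto simp: R'_def)
  have "\<forall>\<^sub>F n in sequentially. J * R' / sqrt (real n) < \<epsilon> / 2"
  proof (rule order_tendstoD(2)[where y = 0])
    show "(\<lambda>n. J * R' / sqrt (real n)) \<longlonglongrightarrow> 0"
      by (intro real_tendsto_divide_at_top[OF tendsto_const] filterlim_compose[OF sqrt_at_top] filterlim_real_sequentially)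
  qed (use \<epsilon> in simp)
  moreover have "\<epsilon> / (2 * (J + 1)) > 0" using \<epsilon> J0 by simp
  with uniform_llt_fejer[OF L] have "\<forall>\<^sub>F n in sequentially. \<forall>u. \<bar>sqrt (2 * pi * real n) * (\<integral>x. fejer L (x - u) \<partial>P n)
      - exp (- (u\<^sup>2) / (2 * real n)) * (\<integral>x. fejer L x \<partial>lborel)\<bar> \<le> \<epsilon> / (2 * (J + 1))"
    unfolding uniform_llt_def by blast
  ultimately show ?thesis
    using eventually_gt_at_top[of 0]
  proof (eventually_elim, intro allI)
    fix n :: nat and u :: real
    assume 1: "J * R' / sqrt (real n) < \<epsilon> / 2" and n: "n > 0"
      and 2: "\<forall>u. \<bar>sqrt (2 * pi * real n) * (\<integral>x. fejer L (x - u) \<partial>P n)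
      - exp (- (u\<^sup>2) / (2 * real n)) * (\<integral>x. fejer L x \<partial>lborel)\<bar> \<le> \<epsilon> / (2 * (J + 1))"
    interpret P: real_distribution "P n" by (rule real_distribution)
    interpret PL: pair_sigma_finite "P n" lborel ..
    let ?k = "\<lambda>y. sqrt (2 * pi * real n) * (\<integral>x. fejer L (x - (u + y)) \<partial>P n)"
    let ?e = "\<lambda>y. exp (- ((u + y)\<^sup>2) / (2 * real n))"
    have int: "integrable (P n \<Otimes>\<^sub>M lborel) (\<lambda>(x, y). G y * fejer L (x - u - y))"
    proof (rule integrableI_bounded_set[where A = "space (P n) \<times> {-R'..R'}" and B = "B * (L / (2 * pi))"])
      show "emeasure (P n \<Otimes>\<^sub>M lborel) (space (P n) \<times> {-R'..R'}) < \<infinity>"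
        using R' P.emeasure_space_1
        by (subst lborel.emeasure_pair_measure_Times) (auto simp del: P.space_eq_univ P.events_eq_borel)
      show "AE z in P n \<Otimes>\<^sub>M lborel. z \<in> space (P n) \<times> {-R'..R'} \<longrightarrow> norm (case z of (x, y) \<Rightarrow> G y * fejer L (x - u - y)) \<le> B * (L / (2 * pi))"
      proof -
        have "\<bar>G y * fejer L z\<bar> \<le> B * (L / (2 * pi))" for y z
          unfolding abs_mult using B0 L by (intro mult_mono B) (auto simp: fejer_nonneg fejer_le)
        then show ?thesis by (intro AE_I2) auto
      qed
      show "AE z in P n \<Otimes>\<^sub>M lborel. z \<notin> space (P n) \<times> {-R'..R'} \<longrightarrow> (case z of (x, y) \<Rightarrow> G y * fejer L (x - u - y)) = 0"
      proof -
        have "y \<in> {-R'..R'}" if "G y \<noteq> 0" for y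
          using that R'(2)[of y] by (cases "\<bar>y\<bar> > R'") auto
        then show ?thesis
          by (intro AE_I2) (auto simp: space_pair_measure simp del: atLeastAtMost_iff)
      qed
    qed measurable
    have "sqrt (2 * pi * real n) * (\<integral>x. fejer_conv G L (x - u) \<partial>P n)
       = sqrt (2 * pi * real n) * (\<integral>y. (\<integral>x. G y * fejer L (x - u - y) \<partial>P n) \<partial>lborel)"
      unfolding fejer_conv_def using PL.Fubini_integral[OF int] by simp
    also have "\<dots> = (\<integral>y. G y * ?k y \<partial>lborel)"
      by (simp add: mult.left_commute diff_diff_eq flip: integral_mult_right_zero)
    finally have eq: "sqrt (2 * pi * real n) * (\<integral>x. fejer_conv G L (x - u) \<partial>P n) = (\<integral>y. G y * ?k y \<partial>lborel)" .
    have kbound: "\<bar>?k y - ?e y\<bar> \<le> \<epsilon> / (2 * (J + 1))" for y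
      using 2[rule_format, of "u + y"] fejer_has_integral[OF L] by (simp add: has_bochner_integral_iff)
    have [measurable]: "(\<lambda>y. \<integral>x. fejer L (x - (u + y)) \<partial>P n) \<in> borel_measurable borel"
      by measurable
    have intk: "integrable lborel (\<lambda>y. G y * ?k y)"
    proof (rule Bochner_Integration.integrable_bound)
      show "integrable lborel (\<lambda>y. (1 + \<epsilon> / (2 * (J + 1))) * G y)" using Gint by simp
      show "AE y in lborel. norm (G y * ?k y) \<le> norm ((1 + \<epsilon> / (2 * (J + 1))) * G y)"
      proof (intro AE_I2)
        fix y
        have "?e y \<le> 1" "?e y \<ge> 0" by simp_all
        with kbound[of y] have "\<bar>?k y\<bar> \<le> 1 + \<epsilon> / (2 * (J + 1))" by linarith
        then show "norm (G y * ?k y) \<le> norm ((1 + \<epsilon> / (2 * (J + 1))) * G y)"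
          unfolding real_norm_def abs_mult
          by (subst mult.commute) (auto intro!: mult_right_mono)
      qed
    qed measurable
    have "\<bar>(\<integral>y. G y * ?k y \<partial>lborel) - ?e 0 * (\<integral>x. G x \<partial>lborel)\<bar>
        = norm (\<integral>y. G y * ?k y - G y * ?e 0 \<partial>lborel)"
      using intk Gint by (subst Bochner_Integration.integral_diff) (simp_all add: mult.commute)
    also have "\<dots> \<le> (\<integral>y. \<bar>G y\<bar> * (\<epsilon> / (2 * (J + 1)) + R' / sqrt (real n)) \<partial>lborel)"
    proof (rule Bochner_Integration.integral_norm_bound_integral)
      fix y
      have "\<bar>?e y - ?e 0\<bar> \<le> R' / sqrt (real n)" if "\<bar>y\<bar> \<le> R'"
      proof -
        have "\<bar>?e y - ?e 0\<bar> \<le> \<bar>y\<bar> / sqrt (real n)" using gauss_shift[OF n, of u y] by simp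
        also have "\<dots> \<le> R' / sqrt (real n)" using that by (intro divide_right_mono) auto
        finally show ?thesis .
      qed
      then have "\<bar>?k y - ?e 0\<bar> \<le> \<epsilon> / (2 * (J + 1)) + R' / sqrt (real n)" if "\<bar>y\<bar> \<le> R'"
        using kbound[of y] that by linarith
      then have "\<bar>G y\<bar> * \<bar>?k y - ?e 0\<bar> \<le> \<bar>G y\<bar> * (\<epsilon> / (2 * (J + 1)) + R' / sqrt (real n))"
        using R'(2)[of y] by (cases "\<bar>y\<bar> \<le> R'") (auto intro!: mult_left_mono)
      then show "norm (G y * ?k y - G y * ?e 0) \<le> \<bar>G y\<bar> * (\<epsilon> / (2 * (J + 1)) + R' / sqrt (real n))"
        by (simp add: abs_mult flip: right_diff_distrib)
    qed (use intk Gint in auto)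
    also have "\<dots> = J * (\<epsilon> / (2 * (J + 1))) + J * R' / sqrt (real n)"
      using Gint by (simp add: J_def distrib_left)
    also have "J * (\<epsilon> / (2 * (J + 1))) \<le> \<epsilon> / 2"
      using J0 \<epsilon> by (simp add: field_simps)
    finally have "\<bar>(\<integral>y. G y * ?k y \<partial>lborel) - ?e 0 * (\<integral>x. G x \<partial>lborel)\<bar> \<le> \<epsilon> / 2 + J * R' / sqrt (real n)"
      by simp
    then show "\<bar>sqrt (2 * pi * real n) * (\<integral>x. fejer_conv G L (x - u) \<partial>P n)
      - exp (- (u\<^sup>2) / (2 * real n)) * (\<integral>x. G x \<partial>lborel)\<bar> \<le> \<epsilon>"
      using 1 unfolding eq add_0_right by linarith
  qed
qed

text \<open>The approximation error costs at most \<open>\<epsilon> / 8\<close> times \<open>\<surd>(2\<pi>n)\<close> times the mass that \<open>P n\<close> gives to two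
  Fejer kernels, and each of these masses is eventually at most 2 by the theorem for Fejer kernels.\<close>

lemma uniform_llt_continuous:
  assumes G: "continuous_on UNIV G" and B: "\<And>x. \<bar>G x\<bar> \<le> B" and R: "\<And>x. \<bar>x\<bar> > R \<Longrightarrow> G x = 0"
    and R0: "R \<ge> 0"
  shows "uniform_llt P G"
  unfolding uniform_llt_def
proof safe
  fix \<epsilon> :: real assume \<epsilon>: "\<epsilon> > 0"
  have Gm [measurable]: "G \<in> borel_measurable borel"
    using G by (rule borel_measurable_continuous_onI)
  have e8: "\<epsilon> / 8 > 0" using \<epsilon> by simp
  have "\<exists>L>0. \<forall>x. \<bar>fejer_conv G L x - G x\<bar> \<le> \<epsilon> / 8 * (fejer 1 x + fejer 1 (x + pi))"
    using R by (rule fejer_conv_approx[OF G B _ R0 e8])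
  then obtain L where L: "L > 0"
    and approx: "\<And>x. \<bar>fejer_conv G L x - G x\<bar> \<le> \<epsilon> / 8 * (fejer 1 x + fejer 1 (x + pi))"
    by (elim exE conjE) (rule that, assumption, erule spec)
  have "\<forall>\<^sub>F n in sequentially. \<forall>u. \<bar>sqrt (2 * pi * real n) * (\<integral>x. fejer 1 (x - u) \<partial>P n)
      - exp (- (u\<^sup>2) / (2 * real n)) * (\<integral>x. fejer 1 x \<partial>lborel)\<bar> \<le> 1"
    using uniform_llt_fejer[OF zero_less_one] zero_less_one[where 'a = real]
    unfolding uniform_llt_def by blast
  moreover have "\<forall>\<^sub>F n in sequentially. \<forall>u. \<bar>sqrt (2 * pi * real n) * (\<integral>x. fejer_conv G L (x - u) \<partial>P n)
      - exp (- (u\<^sup>2) / (2 * real n)) * (\<integral>x. G x \<partial>lborel)\<bar> \<le> \<epsilon> / 2"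
  proof (rule uniform_llt_fejer_conv[OF Gm B _ L])
    show "G x = 0" if "\<bar>x\<bar> > R" for x using that by (rule R)
    show "\<epsilon> / 2 > 0" using \<epsilon> by simp
  qed
  ultimately show "\<forall>\<^sub>F n in sequentially. \<forall>u. \<bar>sqrt (2 * pi * real n) * (\<integral>x. G (x - u) \<partial>P n)
      - exp (- (u\<^sup>2) / (2 * real n)) * (\<integral>x. G x \<partial>lborel)\<bar> \<le> \<epsilon>"
  proof (eventually_elim, intro allI)
    fix n :: nat and u :: real
    assume 1: "\<forall>u. \<bar>sqrt (2 * pi * real n) * (\<integral>x. fejer 1 (x - u) \<partial>P n)
      - exp (- (u\<^sup>2) / (2 * real n)) * (\<integral>x. fejer 1 x \<partial>lborel)\<bar> \<le> 1"
      and 2: "\<forall>u. \<bar>sqrt (2 * pi * real n) * (\<integral>x. fejer_conv G L (x - u) \<partial>P n)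
      - exp (- (u\<^sup>2) / (2 * real n)) * (\<integral>x. G x \<partial>lborel)\<bar> \<le> \<epsilon> / 2"
    interpret P: real_distribution "P n" by (rule real_distribution)
    let ?s = "sqrt (2 * pi * real n)"
    have f1: "(\<integral>x. fejer 1 x \<partial>lborel) = 1"
      using fejer_has_integral[of 1] by (simp add: has_bochner_integral_iff)
    have mass: "?s * (\<integral>x. fejer 1 (x - v) \<partial>P n) \<le> 2" for v
    proof -
      have "exp (- (v\<^sup>2) / (2 * real n)) \<le> 1" by simp
      then show ?thesis using 1[rule_format, of v] unfolding f1 by linarith
    qed
    have [measurable]: "fejer_conv G L \<in> borel_measurable borel"
      unfolding fejer_conv_def by measurable
    have int_fejer: "integrable (P n) (\<lambda>x. fejer 1 (x - v))" for v
      by (rule P.integrable_const_bound[of _ "1 / (2 * pi)"])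
         (simp_all add: fejer_nonneg fejer_le[of 1, simplified])
    have int_G: "integrable (P n) (\<lambda>x. G (x - u))"
      by (rule P.integrable_const_bound[of _ B]) (auto intro!: AE_I2 B)
    have approx': "norm (fejer_conv G L (x - u) - G (x - u)) \<le> \<epsilon> / 8 * (fejer 1 (x - u) + fejer 1 (x - (u - pi)))" for x
    proof -
      have "x - u + pi = x - (u - pi)" by simp
      with approx[of "x - u"] show ?thesis unfolding real_norm_def by (simp only:)
    qed
    have int_d: "integrable (P n) (\<lambda>x. fejer_conv G L (x - u) - G (x - u))"
    proof (rule Bochner_Integration.integrable_bound)
      show "integrable (P n) (\<lambda>x. \<epsilon> / 8 * (fejer 1 (x - u) + fejer 1 (x - (u - pi))))"
        by (intro integrable_mult_right Bochner_Integration.integrable_add int_fejer)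
      show "AE x in P n. norm (fejer_conv G L (x - u) - G (x - u)) \<le> norm (\<epsilon> / 8 * (fejer 1 (x - u) + fejer 1 (x - (u - pi))))"
        by (intro AE_I2 order_trans[OF approx']) simp
    qed measurable
    have int_conv: "integrable (P n) (\<lambda>x. fejer_conv G L (x - u))"
      using Bochner_Integration.integrable_add[OF int_d int_G] by simp
    have "\<bar>(\<integral>x. fejer_conv G L (x - u) \<partial>P n) - (\<integral>x. G (x - u) \<partial>P n)\<bar>
       = norm (\<integral>x. fejer_conv G L (x - u) - G (x - u) \<partial>P n)"
      using int_conv int_G by simp
    also have "\<dots> \<le> (\<integral>x. \<epsilon> / 8 * (fejer 1 (x - u) + fejer 1 (x - (u - pi))) \<partial>P n)"
      by (intro Bochner_Integration.integral_norm_bound_integral[OF int_d _ approx']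
          integrable_mult_right Bochner_Integration.integrable_add int_fejer)
    also have "\<dots> = \<epsilon> / 8 * ((\<integral>x. fejer 1 (x - u) \<partial>P n) + (\<integral>x. fejer 1 (x - (u - pi)) \<partial>P n))"
      using int_fejer by simp
    finally have "?s * \<bar>(\<integral>x. fejer_conv G L (x - u) \<partial>P n) - (\<integral>x. G (x - u) \<partial>P n)\<bar>
      \<le> ?s * (\<epsilon> / 8 * ((\<integral>x. fejer 1 (x - u) \<partial>P n) + (\<integral>x. fejer 1 (x - (u - pi)) \<partial>P n)))"
      by (rule mult_left_mono) simp
    also have "\<dots> = \<epsilon> / 8 * (?s * (\<integral>x. fejer 1 (x - u) \<partial>P n) + ?s * (\<integral>x. fejer 1 (x - (u - pi)) \<partial>P n))"
    proof -
      have "s * (e * (a + b)) = e * (s * a + s * b)" for s e a b :: real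
        by (simp add: algebra_simps)
      then show ?thesis .
    qed
    also have "\<dots> \<le> \<epsilon> / 8 * (2 + 2)"
      using \<epsilon> by (intro mult_left_mono add_mono mass) auto
    finally have "\<bar>?s * (\<integral>x. fejer_conv G L (x - u) \<partial>P n) - ?s * (\<integral>x. G (x - u) \<partial>P n)\<bar> \<le> \<epsilon> / 2"
      unfolding right_diff_distrib[symmetric] abs_mult by simp
    then show "\<bar>?s * (\<integral>x. G (x - u) \<partial>P n) - exp (- (u\<^sup>2) / (2 * real n)) * (\<integral>x. G x \<partial>lborel)\<bar> \<le> \<epsilon>"
      using 2[rule_format, of u] by linarith
  qed
qed

end

text \<open>Equal to 1 on \<open>[a + h, b - h]\<close>, to 0 outside \<open>(a, b)\<close> and piecewise affine in between; identically 0 if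
  \<open>b \<le> a\<close>.\<close>

definition trapezoid :: "real \<Rightarrow> real \<Rightarrow> real \<Rightarrow> real \<Rightarrow> real" where
  "trapezoid h a b x = max 0 (min 1 (min (x - a) (b - x) / h))"

lemma trapezoid:
  assumes "h > 0"
  shows "indicator {a + h..b - h} x \<le> trapezoid h a b x" "trapezoid h a b x \<le> indicator {a<..<b} x"
    "0 \<le> trapezoid h a b x"
  using assms by (auto simp: trapezoid_def indicator_def divide_le_0_iff le_divide_eq min_def max_def)

lemma abs_trapezoid_le_1: "\<bar>trapezoid h a b x\<bar> \<le> 1"
  by (simp add: trapezoid_def)

lemma trapezoid_eq_0:
  assumes h: "h > 0" and "max \<bar>a\<bar> \<bar>b\<bar> < \<bar>x\<bar>"
  shows "trapezoid h a b x = 0"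
proof -
  have "\<not> (a < x \<and> x < b)" using assms(2) by linarith
  then have "indicator {a<..<b} x = (0 :: real)" by (simp add: indicator_def)
  then show ?thesis
    using trapezoid(2,3)[OF h, of a b x] by linarith
qed

lemma continuous_on_trapezoid: "h > 0 \<Longrightarrow> continuous_on UNIV (trapezoid h a b)"
  unfolding trapezoid_def by (intro continuous_intros) auto

context gaussian_char
begin

lemma uniform_llt_trapezoid:
  assumes h: "h > 0"
  shows "uniform_llt P (trapezoid h a b)"
  by (rule uniform_llt_continuous[where B = 1 and R = "max \<bar>a\<bar> \<bar>b\<bar>"])
     (simp_all add: continuous_on_trapezoid abs_trapezoid_le_1 trapezoid_eq_0 h le_max_iff_disj)

text \<open>The interval lies between trapezoids whose integrals differ by at most \<open>4h\<close>. The two inclusions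
  leave open which end points belong to \<open>I\<close>, so all kinds of bounded intervals are covered.\<close>

lemma uniform_llt_interval:
  assumes ab: "a \<le> b" and I: "{a<..<b} \<subseteq> I" "I \<subseteq> {a..b}" and [measurable]: "I \<in> sets borel"
  shows "uniform_llt P (indicator I)"
  unfolding uniform_llt_def
proof safe
  fix \<epsilon> :: real assume \<epsilon>: "\<epsilon> > 0"
  define h where "h = \<epsilon> / 16"
  have h: "h > 0" using \<epsilon> by (simp add: h_def)
  let ?lo = "trapezoid h a b" and ?hi = "trapezoid h (a - h) (b + h)"
  have [measurable]: "trapezoid h a' b' \<in> borel_measurable borel" for a' b'
    by (intro borel_measurable_continuous_onI continuous_on_trapezoid h)
  have lo: "?lo x \<le> indicator I x" for x
  proof -
    have "indicator {a<..<b} x \<le> (indicator I x :: real)"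
      using I(1) by (intro indicator_leI) auto
    then show ?thesis using trapezoid(2)[OF h, of a b x] by linarith
  qed
  have hi: "indicator I x \<le> ?hi x" for x
  proof -
    have "indicator I x \<le> (indicator {a - h + h..b + h - h} x :: real)"
      using I(2) by (intro indicator_leI) auto
    then show ?thesis using trapezoid(1)[OF h, of "a - h" "b + h" x] by linarith
  qed
  have le1: "trapezoid h a' b' x \<le> 1" for a' b' x by (simp add: trapezoid_def)
  have int_trap: "integrable lborel (trapezoid h a' b')" for a' b'
    by (rule integrable_bounded_support[where B = 1 and R = "max \<bar>a'\<bar> \<bar>b'\<bar>"])
       (simp_all only: abs_trapezoid_le_1 trapezoid_eq_0[OF h], measurable)
  have int_I: "integrable lborel (indicator I :: real \<Rightarrow> real)"
  proof (rule Bochner_Integration.integrable_bound)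
    show "integrable lborel (indicator {a..b} :: real \<Rightarrow> real)"
      by (simp add: emeasure_lborel_Icc_eq)
    show "AE x in lborel. norm (indicator I x :: real) \<le> norm (indicator {a..b} x :: real)"
      using I(2) by (intro AE_I2) (auto intro!: indicator_leI)
  qed measurable
  have lo_int: "b - a - 2 * h \<le> (\<integral>x. ?lo x \<partial>lborel)"
  proof -
    have "b - a - 2 * h \<le> (\<integral>x. indicator {a + h..b - h} x \<partial>lborel)"
      by (cases "a + h \<le> b - h") auto
    also have "\<dots> \<le> (\<integral>x. ?lo x \<partial>lborel)"
      by (intro integral_mono int_trap trapezoid(1) h) (auto simp: emeasure_lborel_Icc_eq)
    finally show ?thesis .
  qed
  have hi_int: "(\<integral>x. ?hi x \<partial>lborel) \<le> b - a + 2 * h"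
  proof -
    have "(\<integral>x. ?hi x \<partial>lborel) \<le> (\<integral>x. indicator {a - h<..<b + h} x \<partial>lborel)"
      by (intro integral_mono int_trap trapezoid(2) h) (use ab h in auto)
    then show ?thesis using ab h by simp
  qed
  have I_lo: "(\<integral>x. ?lo x \<partial>lborel) \<le> (\<integral>x. indicator I x \<partial>lborel)"
    and I_hi: "(\<integral>x. indicator I x \<partial>lborel) \<le> (\<integral>x. ?hi x \<partial>lborel)"
    by (intro integral_mono int_trap int_I lo hi)+
  have "\<epsilon> / 4 > 0" using \<epsilon> by simp
  then have "\<forall>\<^sub>F n in sequentially. \<forall>u. \<bar>sqrt (2 * pi * real n) * (\<integral>x. ?lo (x - u) \<partial>P n)
      - exp (- (u\<^sup>2) / (2 * real n)) * (\<integral>x. ?lo x \<partial>lborel)\<bar> \<le> \<epsilon> / 4"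
    "\<forall>\<^sub>F n in sequentially. \<forall>u. \<bar>sqrt (2 * pi * real n) * (\<integral>x. ?hi (x - u) \<partial>P n)
      - exp (- (u\<^sup>2) / (2 * real n)) * (\<integral>x. ?hi x \<partial>lborel)\<bar> \<le> \<epsilon> / 4"
    using uniform_llt_trapezoid[OF h] unfolding uniform_llt_def by blast+
  then show "\<forall>\<^sub>F n in sequentially. \<forall>u. \<bar>sqrt (2 * pi * real n) * (\<integral>x. indicator I (x - u) \<partial>P n)
      - exp (- (u\<^sup>2) / (2 * real n)) * (\<integral>x. indicator I x \<partial>lborel)\<bar> \<le> \<epsilon>"
  proof (eventually_elim, intro allI)
    fix n :: nat and u :: real
    assume *: "\<forall>u. \<bar>sqrt (2 * pi * real n) * (\<integral>x. ?lo (x - u) \<partial>P n)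
      - exp (- (u\<^sup>2) / (2 * real n)) * (\<integral>x. ?lo x \<partial>lborel)\<bar> \<le> \<epsilon> / 4"
    "\<forall>u. \<bar>sqrt (2 * pi * real n) * (\<integral>x. ?hi (x - u) \<partial>P n)
      - exp (- (u\<^sup>2) / (2 * real n)) * (\<integral>x. ?hi x \<partial>lborel)\<bar> \<le> \<epsilon> / 4"
    interpret P: real_distribution "P n" by (rule real_distribution)
    let ?s = "sqrt (2 * pi * real n)" and ?e = "exp (- (u\<^sup>2) / (2 * real n))"
    have int1: "integrable (P n) (\<lambda>x. trapezoid h a' b' (x - u))" for a' b'
      by (rule P.integrable_const_bound[of _ 1]) (auto simp: le1 trapezoid(3) h abs_of_nonneg intro!: AE_I2)
    have int2: "integrable (P n) (\<lambda>x. indicator I (x - u) :: real)"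
      by (rule P.integrable_const_bound[of _ 1]) (auto intro!: AE_I2)
    have up: "?s * (\<integral>x. indicator I (x - u) \<partial>P n) \<le> ?s * (\<integral>x. ?hi (x - u) \<partial>P n)"
      by (intro mult_left_mono integral_mono int1 int2 hi) simp
    have down: "?s * (\<integral>x. ?lo (x - u) \<partial>P n) \<le> ?s * (\<integral>x. indicator I (x - u) \<partial>P n)"
      by (intro mult_left_mono integral_mono int1 int2 lo) simp
    have scale: "?e * y \<le> ?e * z + c" if "y \<le> z + c" "c \<ge> 0" for y z c
    proof -
      have "?e * y \<le> ?e * (z + c)" using that by (intro mult_left_mono) auto
      also have "\<dots> \<le> ?e * z + c" using that by (simp add: distrib_left mult_left_le_one_le)
      finally show ?thesis .
    qed
    have gap: "(\<integral>x. ?hi x \<partial>lborel) \<le> (\<integral>x. indicator I x \<partial>lborel) + 4 * h"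
      "(\<integral>x. indicator I x \<partial>lborel) \<le> (\<integral>x. ?lo x \<partial>lborel) + 4 * h"
      using lo_int hi_int I_lo I_hi by linarith+
    show "\<bar>?s * (\<integral>x. indicator I (x - u) \<partial>P n) - ?e * (\<integral>x. indicator I x \<partial>lborel)\<bar> \<le> \<epsilon>"
      using *[rule_format, of u] up down scale[OF gap(1)] scale[OF gap(2)] h
      unfolding h_def abs_le_iff by linarith
  qed
qed

end

section \<open>Almost sure convergence and the Cauchy-Schwarz inequality\<close>

text \<open>The sum of the \<open>Z n\<close> has finite integral, so it is finite almost everywhere.\<close>

lemma AE_tendsto_0_if_summable_nn_integral:
  fixes Z :: "nat \<Rightarrow> 'a \<Rightarrow> ennreal"
  assumes [measurable]: "\<And>n. Z n \<in> borel_measurable M"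
    and le: "\<forall>\<^sub>F n in sequentially. (\<integral>\<^sup>+\<omega>. Z n \<omega> \<partial>M) \<le> ennreal (s n)"
    and s: "summable s" "\<And>n. 0 \<le> s n"
  shows "AE \<omega> in M. (\<lambda>n. Z n \<omega>) \<longlonglongrightarrow> 0"
proof -
  obtain N where N: "\<forall>n\<ge>N. (\<integral>\<^sup>+\<omega>. Z n \<omega> \<partial>M) \<le> ennreal (s n)"
    using le unfolding eventually_sequentially by (elim exE)
  have "(\<integral>\<^sup>+\<omega>. (\<Sum>n. Z (n + N) \<omega>) \<partial>M) = (\<Sum>n. \<integral>\<^sup>+\<omega>. Z (n + N) \<omega> \<partial>M)"
    by (rule nn_integral_suminf) simp
  also have "\<dots> \<le> (\<Sum>n. ennreal (s (n + N)))"
    by (intro suminf_le N[rule_format]) auto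
  also have "\<dots> = ennreal (\<Sum>n. s (n + N))"
    by (intro suminf_ennreal2 s(2) summable_ignore_initial_segment s(1))
  also have "\<dots> < top" by simp
  finally have "AE \<omega> in M. (\<Sum>n. Z (n + N) \<omega>) \<noteq> \<infinity>"
    by (intro nn_integral_noteq_infinite) (simp_all add: top.not_eq_extremum)
  then show ?thesis
  proof eventually_elim
    case (elim \<omega>)
    have fin: "Z (n + N) \<omega> < top" for n
      using ennreal_suminf_lessD[of "\<lambda>n. Z (n + N) \<omega>" top n] elim
      by (simp add: top.not_eq_extremum)
    have eq: "ennreal (enn2real (Z (n + N) \<omega>)) = Z (n + N) \<omega>" for n
      by (rule ennreal_enn2real[OF fin])
    have "summable (\<lambda>n. enn2real (Z (n + N) \<omega>))"
    proof (rule summable_suminf_not_top)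
      show "(\<Sum>n. ennreal (enn2real (Z (n + N) \<omega>))) \<noteq> top"
        using elim unfolding eq by simp
    qed simp
    from tendsto_ennrealI[OF summable_LIMSEQ_zero[OF this]]
    have "(\<lambda>n. Z (n + N) \<omega>) \<longlonglongrightarrow> 0"
      unfolding eq by simp
    then show ?case by (rule LIMSEQ_offset)
  qed
qed

lemma ennreal_tendsto_0_if_square:
  fixes x :: "'a \<Rightarrow> ennreal"
  assumes "((\<lambda>n. (x n)\<^sup>2) \<longlongrightarrow> 0) F"
  shows "(x \<longlongrightarrow> 0) F"
proof (rule order_tendstoI)
  fix a :: ennreal assume "0 < a"
  then have "0 < a\<^sup>2" by (simp add: zero_less_iff_neq_zero)
  with assms have "\<forall>\<^sub>F n in F. (x n)\<^sup>2 < a\<^sup>2" by (rule order_tendstoD(2))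
  then show "\<forall>\<^sub>F n in F. x n < a"
    by eventually_elim (meson linorder_not_le power_mono zero_le)
qed simp

lemma nn_integral_indicator_square_le:
  fixes h :: "'a \<Rightarrow> real"
  assumes [measurable]: "h \<in> borel_measurable M" "B \<in> sets M"
  shows "(\<integral>\<^sup>+x\<in>B. ennreal \<bar>h x\<bar> \<partial>M)\<^sup>2 \<le> (\<integral>\<^sup>+x\<in>B. ennreal ((h x)\<^sup>2) \<partial>M) * emeasure M B"
proof -
  have "(\<integral>\<^sup>+x\<in>B. ennreal \<bar>h x\<bar> \<partial>M)\<^sup>2 = (\<integral>\<^sup>+x. (ennreal \<bar>h x\<bar> * indicator B x) * indicator B x \<partial>M)\<^sup>2"
    by (intro arg_cong[where f = "\<lambda>x. x\<^sup>2"] nn_integral_cong) (auto simp: indicator_def)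
  also have "\<dots> \<le> (\<integral>\<^sup>+x. (ennreal \<bar>h x\<bar> * indicator B x)\<^sup>2 \<partial>M) * (\<integral>\<^sup>+x. (indicator B x)\<^sup>2 \<partial>M)"
    by (rule Cauchy_Schwarz_nn_integral) auto
  also have "(\<integral>\<^sup>+x. (ennreal \<bar>h x\<bar> * indicator B x)\<^sup>2 \<partial>M) = (\<integral>\<^sup>+x\<in>B. ennreal ((h x)\<^sup>2) \<partial>M)"
    by (intro nn_integral_cong) (auto simp: indicator_def ennreal_power)
  also have "(\<integral>\<^sup>+x. (indicator B x)\<^sup>2 \<partial>M) = (\<integral>\<^sup>+x. indicator B x \<partial>M)"
    by (intro nn_integral_cong) (auto simp: indicator_def)
  finally show ?thesis by simp
qed

section \<open>The sequence of rounded powers and its gaps\<close>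

text \<open>Bernoulli's inequality for real exponents.\<close>

lemma bernoulli_powr:
  fixes y c :: real
  assumes y: "0 \<le> y" "y \<le> 1" and c: "1 \<le> c"
  shows "1 - c * (1 - y) \<le> y powr c"
proof (cases "y = 0 \<or> y = 1")
  case True
  then show ?thesis using c by auto
next
  case False
  with y have y: "0 < y" "y < 1" by auto
  have "\<exists>z>y. z < 1 \<and> 1 powr c - y powr c = (1 - y) * (c * z powr (c - 1))"
    by (rule MVT2[OF y(2)]) (use y in \<open>auto intro!: derivative_eq_intros\<close>)
  then obtain z where z: "y < z" "z < 1" "1 - y powr c = (1 - y) * (c * z powr (c - 1))" by auto
  have "z powr (c - 1) \<le> 1"
    using z y c by (intro powr_le1) auto
  then have "c * z powr (c - 1) \<le> c * 1" using c by (intro mult_left_mono) auto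
  then have "(1 - y) * (c * z powr (c - 1)) \<le> (1 - y) * c" using y by (intro mult_left_mono) auto
  then show ?thesis using z(3) by (simp add: mult.commute)
qed

definition power_subseq :: "real \<Rightarrow> nat \<Rightarrow> nat" where
  "power_subseq \<alpha> k = nat \<lceil>real k powr \<alpha>\<rceil>"

text \<open>The index \<open>k\<close> for which \<open>\<lceil>k\<^sup>\<alpha>\<rceil>\<close> is used as an approximation to \<open>n\<close> from below.\<close>

definition root_index :: "real \<Rightarrow> nat \<Rightarrow> nat" where
  "root_index \<alpha> n = nat \<lfloor>real n powr (1 / \<alpha>)\<rfloor>"

lemma power_subseq_ge: "real k powr \<alpha> \<le> real (power_subseq \<alpha> k)"
  unfolding power_subseq_def by (simp add: of_nat_ceiling)

text \<open>With \<open>x = n powr (1/\<alpha>)\<close> and \<open>k = \<lfloor>x\<rfloor>\<close>, the ratio \<open>k\<^sup>\<alpha> / n = (k / x)\<^sup>\<alpha>\<close> is at least \<open>1 - max \<alpha> 1 / x\<close> by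
  Bernoulli's inequality. For \<open>\<alpha> < 1\<close> the exponent is first raised to 1, which only decreases
  \<open>(k / x)\<^sup>\<alpha>\<close>.\<close>

lemma power_subseq_root_index:
  assumes \<alpha>: "\<alpha> > 0" and n: "n > 0"
  shows "power_subseq \<alpha> (root_index \<alpha> n) \<le> n"
    and "real n - real (power_subseq \<alpha> (root_index \<alpha> n)) \<le> max \<alpha> 1 * real n powr (1 - 1 / \<alpha>)"
proof -
  define x where "x = real n powr (1 / \<alpha>)"
  define k where "k = real (root_index \<alpha> n)"
  have x: "x \<ge> 1" using n \<alpha> by (simp add: x_def ge_one_powr_ge_zero)
  have xa: "x powr \<alpha> = real n" using \<alpha> n by (simp add: x_def powr_powr)
  have "real (nat \<lfloor>x\<rfloor>) = of_int \<lfloor>x\<rfloor>" using x by simp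
  then have k: "k \<le> x" "x - 1 \<le> k" "0 \<le> k"
    unfolding k_def root_index_def x_def[symmetric] using x by linarith+
  have "k powr \<alpha> \<le> real n"
    using powr_mono2[OF _ k(3,1), of \<alpha>] \<alpha> xa by simp
  then show "power_subseq \<alpha> (root_index \<alpha> n) \<le> n"
    unfolding power_subseq_def k_def by (simp add: ceiling_le_iff nat_le_iff)
  let ?c = "max \<alpha> 1"
  have y: "0 \<le> k / x" "k / x \<le> 1" using k x by auto
  have "(x - k) / x \<le> 1 / x" using k x by (intro divide_right_mono) auto
  then have "1 - k / x \<le> 1 / x" using x by (simp add: diff_divide_distrib)
  then have "1 - ?c * (1 / x) \<le> 1 - ?c * (1 - k / x)" by (intro diff_left_mono mult_left_mono) auto
  also have "\<dots> \<le> (k / x) powr ?c" using y by (intro bernoulli_powr) auto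
  also have "\<dots> \<le> (k / x) powr \<alpha>" using y by (intro powr_mono') auto
  finally have "real n * (1 - ?c * (1 / x)) \<le> real n * (k / x) powr \<alpha>" by (rule mult_left_mono) simp
  also have "\<dots> = k powr \<alpha>"
  proof -
    have "(k / x) powr \<alpha> = k powr \<alpha> / real n"
      unfolding xa[symmetric] by (rule powr_divide)
    then show ?thesis using n by simp
  qed
  also have "\<dots> \<le> real (power_subseq \<alpha> (root_index \<alpha> n))"
    using power_subseq_ge unfolding k_def .
  finally have "real n - real (power_subseq \<alpha> (root_index \<alpha> n)) \<le> ?c * (real n / x)"
    unfolding right_diff_distrib by (simp add: mult_ac)
  also have "real n / x = real n powr (1 - 1 / \<alpha>)"
    using n by (simp add: x_def powr_diff)
  finally show "real n - real (power_subseq \<alpha> (root_index \<alpha> n)) \<le> ?c * real n powr (1 - 1 / \<alpha>)" .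
qed

lemma filterlim_power_subseq: "\<alpha> > 0 \<Longrightarrow> filterlim (power_subseq \<alpha>) sequentially sequentially"
proof -
  assume "\<alpha> > 0"
  then have "filterlim (\<lambda>k. real k powr \<alpha>) at_top sequentially" by real_asymp
  then have "filterlim (\<lambda>k. real (power_subseq \<alpha> k)) at_top sequentially"
    by (rule filterlim_at_top_mono) (simp add: power_subseq_ge)
  then show ?thesis by (rule filterlim_sequentially_iff_filterlim_real[THEN iffD2])
qed

lemma filterlim_root_index: 
  assumes "\<alpha> > 0"
  shows "filterlim (root_index \<alpha>) sequentially sequentially"
proof -
  have "filterlim (\<lambda>k. real k powr (1 / \<alpha>) - 1) at_top sequentially" using assms by real_asymp
  then have "filterlim (\<lambda>k. real (root_index \<alpha> k)) at_top sequentially"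
  proof (rule filterlim_at_top_mono, intro always_eventually allI)
    fix k
    have "real k powr (1 / \<alpha>) < of_int \<lfloor>real k powr (1 / \<alpha>)\<rfloor> + 1" by linarith
    moreover have "0 \<le> \<lfloor>real k powr (1 / \<alpha>)\<rfloor>" by simp
    ultimately show "real k powr (1 / \<alpha>) - 1 \<le> real (root_index \<alpha> k)"
      unfolding root_index_def by linarith
  qed
  then show ?thesis by (rule filterlim_sequentially_iff_filterlim_real[THEN iffD2])
qed

section \<open>Low and high frequencies\<close>

lemma (in prob_space) char_distr_diff_le:
  assumes [measurable]: "U \<in> borel_measurable M" "V \<in> borel_measurable M"
  shows "ennreal (cmod (char (distr M borel U) s - char (distr M borel V) t)) \<le> (\<integral>\<^sup>+x. ennreal \<bar>s * U x - t * V x\<bar> \<partial>M)"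
proof -
  have lip: "cmod (iexp a - iexp b) \<le> \<bar>a - b\<bar>" for a b
  proof -
    have "iexp a - iexp b = iexp b * (iexp (a - b) - 1)"
      by (simp add: algebra_simps flip: exp_add)
    then have "cmod (iexp a - iexp b) = cmod (iexp (a - b) - 1)" by (simp add: norm_mult)
    also have "\<dots> \<le> \<bar>a - b\<bar>" using iexp_approx1[of "a - b" 0] by simp
    finally show ?thesis .
  qed
  have int: "integrable M (\<lambda>x. iexp (a * W x))" if [measurable]: "W \<in> borel_measurable M" for W :: "'a \<Rightarrow> real" and a
    by (rule integrable_const_bound[of _ 1]) auto
  have "char (distr M borel U) s - char (distr M borel V) t = (\<integral>x. iexp (s * U x) - iexp (t * V x) \<partial>M)"
    using int assms by (simp add: char_def integral_distr)
  then have "ennreal (cmod (char (distr M borel U) s - char (distr M borel V) t)) \<le> (\<integral>\<^sup>+x. ennreal (cmod (iexp (s * U x) - iexp (t * V x))) \<partial>M)"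
    using integral_norm_bound_ennreal[of M "\<lambda>x. iexp (s * U x) - iexp (t * V x)"] int assms by simp
  also have "\<dots> \<le> (\<integral>\<^sup>+x. ennreal \<bar>s * U x - t * V x\<bar> \<partial>M)"
    by (intro nn_integral_mono ennreal_leI lip)
  finally show ?thesis .
qed


lemma abs_le_set: "{t::real. \<bar>t\<bar> \<le> a} = {-a..a}"
  by auto

text \<open>Separates the change of the sum from the change of its normalisation, the latter via
  \<open>\<surd>n - \<surd>m \<le> \<surd>(n - m)\<close>. Both terms are then governed by \<open>n - m\<close>.\<close>

lemma sqrt_normalized_diff_le:
  fixes x y m n :: real
  assumes "0 < m" "m \<le> n"
  shows "\<bar>x / sqrt n - y / sqrt m\<bar> \<le> (1 / sqrt n) * \<bar>x - y\<bar> + (sqrt (n - m) / (sqrt n * sqrt m)) * \<bar>y\<bar>"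
proof -
  have pos: "0 < sqrt m" "0 < sqrt n" using assms by auto
  have "sqrt n \<le> sqrt m + sqrt (n - m)"
    using sqrt_add_le_add_sqrt[of m "n - m"] assms by simp
  then have "(sqrt n - sqrt m) / (sqrt n * sqrt m) \<le> sqrt (n - m) / (sqrt n * sqrt m)"
    using pos by (intro divide_right_mono) auto
  moreover have "(sqrt n - sqrt m) / (sqrt n * sqrt m) = 1 / sqrt m - 1 / sqrt n"
    using pos by (simp add: diff_divide_distrib)
  moreover have "1 / sqrt m - 1 / sqrt n \<ge> 0"
    using assms pos by (simp add: frac_le)
  ultimately have 1: "\<bar>1 / sqrt n - 1 / sqrt m\<bar> \<le> sqrt (n - m) / (sqrt n * sqrt m)" by linarith
  have "x / sqrt n - y / sqrt m = (1 / sqrt n) * (x - y) + (1 / sqrt n - 1 / sqrt m) * y"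
    by (simp add: left_diff_distrib diff_divide_distrib)
  also have "\<bar>\<dots>\<bar> \<le> (1 / sqrt n) * \<bar>x - y\<bar> + \<bar>1 / sqrt n - 1 / sqrt m\<bar> * \<bar>y\<bar>"
    by (rule order_trans[OF abs_triangle_ineq]) (use pos in \<open>simp add: abs_mult\<close>)
  also have "\<dots> \<le> (1 / sqrt n) * \<bar>x - y\<bar> + (sqrt (n - m) / (sqrt n * sqrt m)) * \<bar>y\<bar>"
    using 1 by (intro add_left_mono mult_right_mono) auto
  finally show ?thesis .
qed

text \<open>Convergence along the sparse sequence \<open>\<lceil>k\<^sup>\<alpha>\<rceil>\<close> extends to all \<open>n\<close>. If \<open>m\<close> is the member of the sequence
  chosen for \<open>n\<close>, the increment bound for the pairs \<open>(n, m)\<close> and \<open>(m, 0)\<close> shows that \<open>S n / \<surd>n\<close> and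
  \<open>S m / \<surd>m\<close> differ in \<open>L\<^sup>1\<close> by a negative power of \<open>n\<close>, and the characteristic functions inherit this bound because
  \<open>t \<mapsto> iexp t\<close> is Lipschitz. The range of
  \<open>t\<close> shrinks from \<open>ln n\<close> to \<open>ln n / 2\<close> so that it stays below \<open>ln m\<close>.\<close>

lemma (in prob_space) char_close_low_frequencies:
  fixes S :: "nat \<Rightarrow> 'a \<Rightarrow> real"
  assumes [measurable]: "\<And>n. S n \<in> borel_measurable M" and S0: "\<And>x. S 0 x = 0"
    and \<alpha>: "\<alpha> > 0" and \<delta>: "\<delta> < 1 / \<alpha>"
    and incr: "\<forall>\<^sub>F n in sequentially. \<forall>k<n. (\<integral>\<^sup>+x. ennreal \<bar>S n x - S k x\<bar> \<partial>M)
        \<le> ennreal (K * (real n powr (\<delta> / 2) * (real n - real k) powr (1 / 2)))"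
    and sub: "(\<lambda>k. ennreal (ln (real (power_subseq \<alpha> k))) *
        (\<integral>\<^sup>+t\<in>{t. \<bar>t\<bar> \<le> ln (real (power_subseq \<alpha> k))}.
          ennreal ((cmod (char (distr M borel (S (power_subseq \<alpha> k))) (t / sqrt (real (power_subseq \<alpha> k))) - of_real (exp (- (t\<^sup>2) / 2))))\<^sup>2) \<partial>lborel))
      \<longlonglongrightarrow> 0"
  shows "(\<lambda>n. \<integral>\<^sup>+t\<in>{t. \<bar>t\<bar> \<le> ln (real n) / 2}.
      ennreal (cmod (char (distr M borel (S n)) (t / sqrt (real n)) - of_real (exp (- (t\<^sup>2) / 2)))) \<partial>lborel) \<longlonglongrightarrow> 0"
proof -
  define D where "D = (\<lambda>n t. cmod (char (distr M borel (S n)) (t / sqrt (real n)) - of_real (exp (- (t\<^sup>2) / 2))))"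
  have rd: "real_distribution (distr M borel (S n))" for n by simp
  have [measurable]: "char (distr M borel (S n)) \<in> borel_measurable borel" for n
    by (rule real_distribution.char_measurable[OF rd])
  have [measurable]: "D n \<in> borel_measurable borel" for n
    unfolding D_def by measurable
  have D0: "0 \<le> D n t" for n t by (simp add: D_def)
  let ?m = "power_subseq \<alpha>"
  define J where "J = (\<lambda>n. \<integral>\<^sup>+t\<in>{t. \<bar>t\<bar> \<le> ln (real n)}. ennreal (D n t) \<partial>lborel)"
  have "(\<lambda>k. J (?m k)) \<longlonglongrightarrow> 0"
  proof (rule ennreal_tendsto_0_if_square, rule tendsto_sandwich[OF _ _ tendsto_const])
    let ?A = "\<lambda>n. ennreal (ln (real n)) * (\<integral>\<^sup>+t\<in>{t. \<bar>t\<bar> \<le> ln (real n)}. ennreal ((D n t)\<^sup>2) \<partial>lborel)"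
    have "(J n)\<^sup>2 \<le> 2 * ?A n" for n
    proof -
      have ln: "0 \<le> ln (real n)" by (cases n) auto
      have "(J n)\<^sup>2 \<le> (\<integral>\<^sup>+t\<in>{t. \<bar>t\<bar> \<le> ln (real n)}. ennreal ((D n t)\<^sup>2) \<partial>lborel) * emeasure lborel {t. \<bar>t\<bar> \<le> ln (real n)}"
        using nn_integral_indicator_square_le[of "D n" lborel "{t. \<bar>t\<bar> \<le> ln (real n)}"]
        by (simp add: J_def D0)
      also have "emeasure lborel {t. \<bar>t\<bar> \<le> ln (real n)} = 2 * ennreal (ln (real n))"
        using ln by (simp add: abs_le_set ennreal_mult flip: ennreal_numeral)
      finally show ?thesis by (simp add: mult_ac)
    qed
    then show "\<forall>\<^sub>F k in sequentially. (J (?m k))\<^sup>2 \<le> 2 * ?A (?m k)" by simp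
    have "(\<lambda>k. ?A (?m k)) \<longlonglongrightarrow> 0" using sub unfolding D_def .
    then have "(\<lambda>k. 2 * ?A (?m k)) \<longlonglongrightarrow> 2 * 0" by (rule ennreal_tendsto_cmult[rotated]) simp
    then show "(\<lambda>k. 2 * ?A (?m k)) \<longlonglongrightarrow> 0" by simp
  qed simp_all
  from filterlim_compose[OF this filterlim_root_index[OF \<alpha>]]
  have J: "(\<lambda>n. J (?m (root_index \<alpha> n))) \<longlonglongrightarrow> 0" .
  define m where "m = (\<lambda>n. ?m (root_index \<alpha> n))"
  have m_lim: "filterlim m sequentially sequentially"
    unfolding m_def using filterlim_compose[OF filterlim_power_subseq[OF \<alpha>] filterlim_root_index[OF \<alpha>]] .
  define c where "c = max \<alpha> 1"
  \<comment> \<open>A nonnegative exponent makes \<open>m powr (\<delta>' / 2) \<le> n powr (\<delta>' / 2)\<close> for \<open>m \<le> n\<close>, while still \<open>\<delta>' < 1 / \<alpha>\<close>.\<close>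
  define \<delta>' where "\<delta>' = max \<delta> 0"
  define K' where "K' = max K 0"
  define p where "p = (\<delta>' - 1 / \<alpha>) / 2"
  have p: "p < 0" using \<delta> \<alpha> by (simp add: p_def \<delta>'_def)
  define R where "R = (\<lambda>n. 2 * K' * sqrt c * real n powr p)"
  have c: "c \<ge> 1" "c > 0" by (auto simp: c_def)
  have K': "K' \<ge> 0" "K \<le> K'" by (auto simp: K'_def)
  obtain N0 where N0: "\<forall>n\<ge>N0. \<forall>k<n. (\<integral>\<^sup>+x. ennreal \<bar>S n x - S k x\<bar> \<partial>M)
        \<le> ennreal (K * (real n powr (\<delta> / 2) * (real n - real k) powr (1 / 2)))"
    using incr unfolding eventually_sequentially by (elim exE)
  have incr': "(\<integral>\<^sup>+x. ennreal \<bar>S n x - S k x\<bar> \<partial>M) \<le> ennreal (K' * (real n powr (\<delta>' / 2) * sqrt (real n - real k)))"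
    if "n \<ge> N0" "n \<ge> 1" "k \<le> n" for n k
  proof (cases "k = n")
    case False
    then have "(\<integral>\<^sup>+x. ennreal \<bar>S n x - S k x\<bar> \<partial>M) \<le> ennreal (K * (real n powr (\<delta> / 2) * (real n - real k) powr (1 / 2)))"
      using that by (intro N0[rule_format]) auto
    also have "\<dots> \<le> ennreal (K' * (real n powr (\<delta>' / 2) * sqrt (real n - real k)))"
      using that K' by (intro ennreal_leI mult_mono) (auto simp: powr_half_sqrt \<delta>'_def intro!: powr_mono)
    finally show ?thesis .
  qed simp
  have bound: "\<forall>\<^sub>F n in sequentially. (\<integral>\<^sup>+x. ennreal \<bar>S n x / sqrt (real n) - S (m n) x / sqrt (real (m n))\<bar> \<partial>M) \<le> ennreal (R n)"
    using eventually_ge_at_top[of N0] eventually_ge_at_top[of 1]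
      filterlim_at_top[THEN iffD1, OF m_lim, rule_format, of "max N0 1"]
  proof eventually_elim
    case (elim n)
    have mn: "m n \<le> n" and d: "real n - real (m n) \<le> c * real n powr (1 - 1 / \<alpha>)"
      using power_subseq_root_index[OF \<alpha>, of n] elim by (auto simp: m_def c_def)
    have pos: "0 < sqrt (real n)" "0 < sqrt (real (m n))" using elim by auto
    let ?q = "real n powr (\<delta>' / 2)"
    let ?s = "sqrt (real n - real (m n))"
    have "(\<integral>\<^sup>+x. ennreal \<bar>S n x / sqrt (real n) - S (m n) x / sqrt (real (m n))\<bar> \<partial>M)
      \<le> (\<integral>\<^sup>+x. ennreal (1 / sqrt (real n)) * ennreal \<bar>S n x - S (m n) x\<bar>
           + ennreal (?s / (sqrt (real n) * sqrt (real (m n)))) * ennreal \<bar>S (m n) x - S 0 x\<bar> \<partial>M)"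
      using sqrt_normalized_diff_le[of "real (m n)" "real n"] elim mn
      by (intro nn_integral_mono) (simp add: S0 flip: ennreal_mult ennreal_plus)
    also have "\<dots> = ennreal (1 / sqrt (real n)) * (\<integral>\<^sup>+x. ennreal \<bar>S n x - S (m n) x\<bar> \<partial>M)
        + ennreal (?s / (sqrt (real n) * sqrt (real (m n)))) * (\<integral>\<^sup>+x. ennreal \<bar>S (m n) x - S 0 x\<bar> \<partial>M)"
      by (simp add: nn_integral_add nn_integral_cmult)
    also have "\<dots> \<le> ennreal (1 / sqrt (real n)) * ennreal (K' * (?q * ?s))
        + ennreal (?s / (sqrt (real n) * sqrt (real (m n)))) * ennreal (K' * (real (m n) powr (\<delta>' / 2) * sqrt (real (m n) - real 0)))"
      using elim mn by (intro add_mono mult_left_mono incr') auto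
    also have "\<dots> = ennreal ((1 / sqrt (real n)) * (K' * (?q * ?s)) +
        (?s / (sqrt (real n) * sqrt (real (m n)))) * (K' * (real (m n) powr (\<delta>' / 2) * sqrt (real (m n)))))"
      using K' mn by (simp flip: ennreal_mult ennreal_plus)
    also have "\<dots> \<le> ennreal (R n)"
    proof (rule ennreal_leI)
      have "real (m n) powr (\<delta>' / 2) \<le> ?q" using mn by (intro powr_mono2) (auto simp: \<delta>'_def)
      then have "(?s / (sqrt (real n) * sqrt (real (m n)))) * (K' * (real (m n) powr (\<delta>' / 2) * sqrt (real (m n))))
         \<le> (?s / (sqrt (real n) * sqrt (real (m n)))) * (K' * (?q * sqrt (real (m n))))"
        using K' mn by (intro mult_left_mono mult_right_mono) auto
      also have "\<dots> = (1 / sqrt (real n)) * (K' * (?q * ?s))" using pos by simp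
      finally have "(1 / sqrt (real n)) * (K' * (?q * ?s)) +
        (?s / (sqrt (real n) * sqrt (real (m n)))) * (K' * (real (m n) powr (\<delta>' / 2) * sqrt (real (m n))))
        \<le> 2 * K' * (?q * (?s / sqrt (real n)))" by simp
      also have "?s \<le> sqrt (c * real n powr (1 - 1 / \<alpha>))" using d by (rule real_sqrt_le_mono)
      then have "2 * K' * (?q * (?s / sqrt (real n))) \<le> 2 * K' * (?q * (sqrt (c * real n powr (1 - 1 / \<alpha>)) / sqrt (real n)))"
        using K' by (intro mult_left_mono divide_right_mono) auto
        also have "sqrt (c * real n powr (1 - 1 / \<alpha>)) / sqrt (real n) = sqrt c * real n powr (- (1 / \<alpha>) / 2)"
        proof -
          have "sqrt (real n powr (1 - 1 / \<alpha>)) = real n powr ((1 - 1 / \<alpha>) / 2)"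
            by (simp add: powr_half_sqrt[symmetric] powr_powr)
          moreover have "sqrt (real n) = real n powr (1 / 2)" by (simp add: powr_half_sqrt)
          moreover have "real n powr ((1 - 1 / \<alpha>) / 2) / real n powr (1 / 2) = real n powr ((1 - 1 / \<alpha>) / 2 - 1 / 2)"
            by (rule powr_diff[symmetric])
          moreover have "(1 - 1 / \<alpha>) / 2 - 1 / 2 = - (1 / \<alpha>) / 2" by (simp add: diff_divide_distrib)
          ultimately show ?thesis
            unfolding real_sqrt_mult times_divide_eq_right[symmetric] by (simp only:)
        qed
        also have "2 * K' * (?q * (sqrt c * real n powr (- (1 / \<alpha>) / 2))) = R n"
        proof -
          have "p = \<delta>' / 2 + - (1 / \<alpha>) / 2" by (simp add: p_def diff_divide_distrib)
          then show ?thesis unfolding R_def by (simp only: powr_add mult_ac)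
        qed
      finally show "(1 / sqrt (real n)) * (K' * (?q * ?s)) +
        (?s / (sqrt (real n) * sqrt (real (m n)))) * (K' * (real (m n) powr (\<delta>' / 2) * sqrt (real (m n)))) \<le> R n" .
    qed
    finally show ?case .
  qed
  \<comment> \<open>Eventually \<open>m n \<ge> n / 2 \<ge> \<surd>n\<close>.\<close>
  have log: "\<forall>\<^sub>F n in sequentially. ln (real n) / 2 \<le> ln (real (m n))"
  proof -
    have "(\<lambda>n. c * real n powr (- 1 / \<alpha>)) \<longlonglongrightarrow> 0" using \<alpha> by real_asymp
    then have "\<forall>\<^sub>F n in sequentially. c * real n powr (- 1 / \<alpha>) < 1 / 2" by (rule order_tendstoD(2)) simp
    then show ?thesis using eventually_ge_at_top[of 4]
    proof eventually_elim
      case (elim n)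
      have "real n - real (m n) \<le> c * real n powr (1 - 1 / \<alpha>)"
        using power_subseq_root_index[OF \<alpha>, of n] elim by (auto simp: m_def c_def)
      also have "\<dots> = (c * real n powr (- 1 / \<alpha>)) * real n"
        using elim by (simp add: powr_diff powr_minus field_simps)
      also have "\<dots> \<le> 1 / 2 * real n" using elim by (intro mult_right_mono) auto
      finally have "real n / 2 \<le> real (m n)" by simp
      moreover have "sqrt (real n) \<le> real n / 2"
      proof (rule real_le_lsqrt)
        have "4 * real n \<le> real n * real n" using elim by (intro mult_right_mono) auto
        then show "real n \<le> (real n / 2)\<^sup>2" by (simp add: power2_eq_square)
      qed auto
      ultimately have "ln (sqrt (real n)) \<le> ln (real (m n))" using elim by (intro ln_mono) auto
      then show ?case using elim by (simp add: ln_sqrt)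
    qed
  qed
  have "(\<lambda>n. \<integral>\<^sup>+t\<in>{t. \<bar>t\<bar> \<le> ln (real n) / 2}. ennreal (D n t) \<partial>lborel) \<longlonglongrightarrow> 0"
  proof (rule tendsto_sandwich[OF _ _ tendsto_const])
    show "\<forall>\<^sub>F n in sequentially. (\<integral>\<^sup>+t\<in>{t. \<bar>t\<bar> \<le> ln (real n) / 2}. ennreal (D n t) \<partial>lborel)
       \<le> ennreal ((ln (real n))\<^sup>2 * R n) + J (m n)"
      using bound log eventually_ge_at_top[of 1]
    proof eventually_elim
      case (elim n)
      let ?a = "ln (real n) / 2"
      have a0: "?a \<ge> 0" using elim by simp
      have R0: "R n \<ge> 0" using K' c by (simp add: R_def)
      have le: "ennreal (D n t) \<le> ennreal (?a * R n) + ennreal (D (m n) t)" if t: "\<bar>t\<bar> \<le> ?a" for t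
      proof -
        let ?d = "cmod (char (distr M borel (S n)) (t / sqrt (real n)) - char (distr M borel (S (m n))) (t / sqrt (real (m n))))"
        have "D n t \<le> ?d + D (m n) t"
          unfolding D_def by (rule order_trans[OF _ norm_triangle_ineq]) simp
        then have "ennreal (D n t) \<le> ennreal ?d + ennreal (D (m n) t)"
          by (simp add: D0 flip: ennreal_plus)
        also have "ennreal ?d \<le> (\<integral>\<^sup>+x. ennreal \<bar>(t / sqrt (real n)) * S n x - (t / sqrt (real (m n))) * S (m n) x\<bar> \<partial>M)"
          by (rule char_distr_diff_le) auto
        also have "\<dots> = (\<integral>\<^sup>+x. ennreal \<bar>t\<bar> * ennreal \<bar>S n x / sqrt (real n) - S (m n) x / sqrt (real (m n))\<bar> \<partial>M)"
          by (intro nn_integral_cong) (simp flip: ennreal_mult abs_mult add: right_diff_distrib)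
        also have "\<dots> = ennreal \<bar>t\<bar> * (\<integral>\<^sup>+x. ennreal \<bar>S n x / sqrt (real n) - S (m n) x / sqrt (real (m n))\<bar> \<partial>M)"
          by (rule nn_integral_cmult) simp
        also have "\<dots> \<le> ennreal ?a * ennreal (R n)"
          using t by (intro mult_mono ennreal_leI elim) auto
        also have "\<dots> = ennreal (?a * R n)" using a0 R0 by (simp flip: ennreal_mult)
        finally show ?thesis by (simp add: add_right_mono)
      qed
      have "(\<integral>\<^sup>+t\<in>{t. \<bar>t\<bar> \<le> ?a}. ennreal (D n t) \<partial>lborel)
        \<le> (\<integral>\<^sup>+t. ennreal (?a * R n) * indicator {t. \<bar>t\<bar> \<le> ?a} t + ennreal (D (m n) t) * indicator {t. \<bar>t\<bar> \<le> ln (real (m n))} t \<partial>lborel)"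
        using le elim(2) by (intro nn_integral_mono) (auto simp: indicator_def)
      also have "\<dots> = ennreal (?a * R n) * emeasure lborel {t. \<bar>t\<bar> \<le> ?a} + J (m n)"
        by (simp add: nn_integral_add nn_integral_cmult_indicator J_def)
      also have "ennreal (?a * R n) * emeasure lborel {t. \<bar>t\<bar> \<le> ?a} = ennreal (?a * R n * (2 * ?a))"
        unfolding abs_le_set using a0 R0 by (simp flip: ennreal_mult)
      also have "\<dots> \<le> ennreal ((ln (real n))\<^sup>2 * R n)"
        using a0 R0 by (intro ennreal_leI) (simp add: power2_eq_square mult_ac)
      finally show ?case by (simp add: add_right_mono)
    qed
    have "(\<lambda>n. (ln (real n))\<^sup>2 * R n) \<longlonglongrightarrow> 0"
    proof -
      have "(\<lambda>n. (ln (real n))\<^sup>2 * real n powr p) \<longlonglongrightarrow> 0" using p by real_asymp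
      from tendsto_mult_right_zero[OF this, of "2 * K' * sqrt c"] show ?thesis
        by (simp add: R_def mult_ac)
    qed
    from tendsto_ennrealI[OF this] J
    have "(\<lambda>n. ennreal ((ln (real n))\<^sup>2 * R n) + J (m n)) \<longlonglongrightarrow> ennreal 0 + 0"
      unfolding m_def by (rule tendsto_add)
    then show "(\<lambda>n. ennreal ((ln (real n))\<^sup>2 * R n) + J (m n)) \<longlonglongrightarrow> 0" by simp
  qed simp
  then show ?thesis unfolding D_def .
qed

text \<open>For \<open>\<bar>\<theta>\<bar> \<ge> ln n / (2 \<surd>n)\<close> the Gaussian \<open>exp (- n \<theta>\<^sup>2 / 2)\<close> is at most \<open>exp (- (ln n)\<^sup>2 / 8)\<close>, smaller than
  any power of \<open>n\<close>, so only the size of the characteristic function matters there. For smaller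
  \<open>\<theta>\<close> the substitution \<open>t = \<surd>n \<theta>\<close> absorbs the factor \<open>\<surd>n\<close>.\<close>

lemma gaussian_charI:
  fixes P :: "nat \<Rightarrow> real measure"
  assumes rd: "\<And>n. real_distribution (P n)"
    and low: "(\<lambda>n. \<integral>\<^sup>+t\<in>{t. \<bar>t\<bar> \<le> ln (real n) / 2}.
      ennreal (cmod (char (P n) (t / sqrt (real n)) - of_real (exp (- (t\<^sup>2) / 2)))) \<partial>lborel) \<longlonglongrightarrow> 0"
    and high: "\<And>N::nat. (\<lambda>n. ennreal (real n) * (\<integral>\<^sup>+\<theta>\<in>{\<theta>. ln (real n) / (2 * sqrt (real n)) \<le> \<bar>\<theta>\<bar> \<and> \<bar>\<theta>\<bar> \<le> real N}.
      ennreal ((cmod (char (P n) \<theta>))\<^sup>2) \<partial>lborel)) \<longlonglongrightarrow> 0"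
  shows "gaussian_char P"
proof (rule gaussian_char.intro)
  show "real_distribution (P n)" for n by (rule rd)
  fix L :: real assume L: "L > 0"
  obtain N :: nat where N: "L \<le> real N" using real_arch_simple by blast
  have [measurable]: "char (P n) \<in> borel_measurable borel" for n
    by (rule real_distribution.char_measurable[OF rd])
  define D where "D = (\<lambda>n \<theta>. cmod (char (P n) \<theta> - of_real (exp (- (real n * \<theta>\<^sup>2) / 2))))"
  have [measurable]: "D n \<in> borel_measurable borel" for n unfolding D_def by measurable
  have D0: "0 \<le> D n \<theta>" for n \<theta> by (simp add: D_def)
  define A where "A = (\<lambda>n::nat. {\<theta>::real. \<bar>\<theta>\<bar> \<le> ln (real n) / (2 * sqrt (real n))})"
  define B where "B = (\<lambda>n::nat. {\<theta>::real. ln (real n) / (2 * sqrt (real n)) \<le> \<bar>\<theta>\<bar> \<and> \<bar>\<theta>\<bar> \<le> real N})"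
  have [measurable]: "A n \<in> sets borel" "B n \<in> sets borel" for n unfolding A_def B_def by measurable
  define H where "H = (\<lambda>n. ennreal (sqrt (real n)) * (\<integral>\<^sup>+\<theta>\<in>B n. ennreal (cmod (char (P n) \<theta>)) \<partial>lborel))"
  define W where "W = (\<lambda>n::nat. \<integral>\<^sup>+t\<in>{t. \<bar>t\<bar> \<le> ln (real n) / 2}.
      ennreal (cmod (char (P n) (t / sqrt (real n)) - of_real (exp (- (t\<^sup>2) / 2)))) \<partial>lborel)"
  have emB: "emeasure lborel (B n) \<le> ennreal (2 * real N)" for n
  proof -
    have "emeasure lborel (B n) \<le> emeasure lborel {- real N..real N}"
      by (intro emeasure_mono) (auto simp: B_def)
    then show ?thesis by simp
  qed
  have "H \<longlonglongrightarrow> 0"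
  proof (rule ennreal_tendsto_0_if_square, rule tendsto_sandwich[OF _ _ tendsto_const])
    let ?q = "\<lambda>n. ennreal (real n) * (\<integral>\<^sup>+\<theta>\<in>B n. ennreal ((cmod (char (P n) \<theta>))\<^sup>2) \<partial>lborel)"
    have "(H n)\<^sup>2 \<le> ennreal (2 * real N) * ?q n" for n
    proof -
      have "(H n)\<^sup>2 = ennreal (real n) * (\<integral>\<^sup>+\<theta>\<in>B n. ennreal \<bar>cmod (char (P n) \<theta>)\<bar> \<partial>lborel)\<^sup>2"
        by (simp add: H_def power_mult_distrib ennreal_power)
      also have "\<dots> \<le> ennreal (real n) * ((\<integral>\<^sup>+\<theta>\<in>B n. ennreal ((cmod (char (P n) \<theta>))\<^sup>2) \<partial>lborel) * emeasure lborel (B n))"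
        by (intro mult_left_mono nn_integral_indicator_square_le) auto
      also have "\<dots> \<le> ennreal (real n) * ((\<integral>\<^sup>+\<theta>\<in>B n. ennreal ((cmod (char (P n) \<theta>))\<^sup>2) \<partial>lborel) * ennreal (2 * real N))"
        by (intro mult_left_mono emB) auto
      finally show ?thesis by (simp only: mult_ac)
    qed
    then show "\<forall>\<^sub>F n in sequentially. (H n)\<^sup>2 \<le> ennreal (2 * real N) * ?q n" by simp
    have "?q \<longlonglongrightarrow> 0" using high[of N] unfolding B_def .
    then have "(\<lambda>n. ennreal (2 * real N) * ?q n) \<longlonglongrightarrow> ennreal (2 * real N) * 0"
      by (rule ennreal_tendsto_cmult[rotated]) simp
    then show "(\<lambda>n. ennreal (2 * real N) * ?q n) \<longlonglongrightarrow> 0" by simp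
  qed simp
  moreover have "W \<longlonglongrightarrow> 0" using low unfolding W_def .
  moreover have "(\<lambda>n. ennreal (2 * real N * (sqrt (real n) * exp (- ((ln (real n))\<^sup>2) / 8)))) \<longlonglongrightarrow> 0"
  proof -
    have "(\<lambda>n. sqrt (real n) * exp (- ((ln (real n))\<^sup>2) / 8)) \<longlonglongrightarrow> 0" by real_asymp
    from tendsto_ennrealI[OF tendsto_mult_right_zero[OF this, of "2 * real N"]] show ?thesis by simp
  qed
  ultimately have "(\<lambda>n. W n + (H n + ennreal (2 * real N * (sqrt (real n) * exp (- ((ln (real n))\<^sup>2) / 8))))) \<longlonglongrightarrow> 0 + (0 + 0)"
    by (intro tendsto_add)
  then have lim: "(\<lambda>n. W n + (H n + ennreal (2 * real N * (sqrt (real n) * exp (- ((ln (real n))\<^sup>2) / 8))))) \<longlonglongrightarrow> 0" by simp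
  have "(\<lambda>n. ennreal (sqrt (real n) * (\<integral>\<theta>. indicator {-L..L} \<theta> * D n \<theta> \<partial>lborel))) \<longlonglongrightarrow> 0"
  proof (rule tendsto_sandwich[OF _ _ tendsto_const lim])
    show "\<forall>\<^sub>F n in sequentially. ennreal (sqrt (real n) * (\<integral>\<theta>. indicator {-L..L} \<theta> * D n \<theta> \<partial>lborel))
       \<le> W n + (H n + ennreal (2 * real N * (sqrt (real n) * exp (- ((ln (real n))\<^sup>2) / 8))))"
      using eventually_ge_at_top[of 1]
    proof eventually_elim
      case (elim n)
      have s: "sqrt (real n) > 0" using elim by simp
      have D2: "D n \<theta> \<le> 2" for \<theta>
      proof -
        have "D n \<theta> \<le> cmod (char (P n) \<theta>) + cmod (of_real (exp (- (real n * \<theta>\<^sup>2) / 2)))"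
          unfolding D_def by (rule norm_triangle_ineq4)
        also have "\<dots> \<le> 1 + 1"
          by (intro add_mono real_distribution.cmod_char_le_1[OF rd]) (simp add: norm_of_real)
        finally show ?thesis by simp
      qed
      have int: "integrable lborel (\<lambda>\<theta>. indicator {-L..L} \<theta> * D n \<theta>)"
        by (rule integrableI_bounded_set[where A = "{-L..L}" and B = 2])
           (use L D2 D0 in \<open>auto simp: abs_mult abs_of_nonneg intro!: AE_I2\<close>)
      let ?r = "ennreal (sqrt (real n))"
      have "ennreal (sqrt (real n) * (\<integral>\<theta>. indicator {-L..L} \<theta> * D n \<theta> \<partial>lborel))
        = ?r * ennreal (\<integral>\<theta>. indicator {-L..L} \<theta> * D n \<theta> \<partial>lborel)"
        by (rule ennreal_mult') simp
      also have "ennreal (\<integral>\<theta>. indicator {-L..L} \<theta> * D n \<theta> \<partial>lborel) = (\<integral>\<^sup>+\<theta>. ennreal (indicator {-L..L} \<theta> * D n \<theta>) \<partial>lborel)"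
        by (rule nn_integral_eq_integral[symmetric, OF int]) (simp add: D0)
      also have "\<dots> \<le> (\<integral>\<^sup>+\<theta>. ennreal (D n \<theta>) * indicator (A n) \<theta> +
          (ennreal (cmod (char (P n) \<theta>)) * indicator (B n) \<theta> + ennreal (exp (- ((ln (real n))\<^sup>2) / 8)) * indicator (B n) \<theta>) \<partial>lborel)"
      proof (intro nn_integral_mono)
        fix \<theta> :: real
        have "\<theta> \<in> B n" if "\<theta> \<in> {-L..L}" "\<theta> \<notin> A n"
        proof -
          have "\<bar>\<theta>\<bar> \<le> L" using that(1) by (simp add: abs_le_iff)
          then have "\<bar>\<theta>\<bar> \<le> real N" using N by (rule order_trans)
          moreover have "ln (real n) / (2 * sqrt (real n)) \<le> \<bar>\<theta>\<bar>"
            using that(2) unfolding A_def mem_Collect_eq not_le by (rule less_imp_le)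
          ultimately show ?thesis unfolding B_def by simp
        qed
        then consider "\<theta> \<notin> {-L..L}" | "\<theta> \<in> A n" | "\<theta> \<in> {-L..L}" "\<theta> \<notin> A n" "\<theta> \<in> B n"
          by blast
        then show "ennreal (indicator {-L..L} \<theta> * D n \<theta>) \<le> ennreal (D n \<theta>) * indicator (A n) \<theta> +
          (ennreal (cmod (char (P n) \<theta>)) * indicator (B n) \<theta> + ennreal (exp (- ((ln (real n))\<^sup>2) / 8)) * indicator (B n) \<theta>)"
        proof cases
          case 2
          have "indicator {-L..L} \<theta> * D n \<theta> \<le> D n \<theta>"
            using D0[of n \<theta>] by (simp add: indicator_def)
          then have "ennreal (indicator {-L..L} \<theta> * D n \<theta>) \<le> ennreal (D n \<theta>) * indicator (A n) \<theta>"
            using 2 by (simp add: ennreal_leI)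
          then show ?thesis by (rule order_trans) simp
        next
          case 3
          have "ln (real n) / (2 * sqrt (real n)) \<le> \<bar>\<theta>\<bar>" using 3 by (simp add: B_def)
          then have "ln (real n) / 2 \<le> sqrt (real n) * \<bar>\<theta>\<bar>" using s by (simp add: field_simps)
          then have "(ln (real n) / 2)\<^sup>2 \<le> (sqrt (real n) * \<bar>\<theta>\<bar>)\<^sup>2"
            using elim by (intro power_mono) auto
          then have "(ln (real n))\<^sup>2 / 4 \<le> real n * \<theta>\<^sup>2"
            by (simp add: power_mult_distrib power_divide)
          then have e: "exp (- (real n * \<theta>\<^sup>2) / 2) \<le> exp (- ((ln (real n))\<^sup>2) / 8)" by simp
          have "D n \<theta> \<le> cmod (char (P n) \<theta>) + cmod (of_real (exp (- (real n * \<theta>\<^sup>2) / 2)))"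
            unfolding D_def by (rule norm_triangle_ineq4)
          also have "\<dots> \<le> cmod (char (P n) \<theta>) + exp (- ((ln (real n))\<^sup>2) / 8)"
            using e by (simp add: norm_of_real)
          finally have "ennreal (D n \<theta>) \<le> ennreal (cmod (char (P n) \<theta>)) + ennreal (exp (- ((ln (real n))\<^sup>2) / 8))"
            by (simp flip: ennreal_plus)
          then show ?thesis using 3 by simp
        qed simp
      qed
      also have "\<dots> = (\<integral>\<^sup>+\<theta>\<in>A n. ennreal (D n \<theta>) \<partial>lborel) + ((\<integral>\<^sup>+\<theta>\<in>B n. ennreal (cmod (char (P n) \<theta>)) \<partial>lborel)
          + ennreal (exp (- ((ln (real n))\<^sup>2) / 8)) * emeasure lborel (B n))"
        by (simp add: nn_integral_add nn_integral_cmult_indicator)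
      finally have "ennreal (sqrt (real n) * (\<integral>\<theta>. indicator {-L..L} \<theta> * D n \<theta> \<partial>lborel))
        \<le> ?r * ((\<integral>\<^sup>+\<theta>\<in>A n. ennreal (D n \<theta>) \<partial>lborel) + ((\<integral>\<^sup>+\<theta>\<in>B n. ennreal (cmod (char (P n) \<theta>)) \<partial>lborel)
          + ennreal (exp (- ((ln (real n))\<^sup>2) / 8)) * emeasure lborel (B n)))"
        by (simp add: mult_left_mono)
      also have "\<dots> = ?r * (\<integral>\<^sup>+\<theta>\<in>A n. ennreal (D n \<theta>) \<partial>lborel) + (H n
          + ?r * (ennreal (exp (- ((ln (real n))\<^sup>2) / 8)) * emeasure lborel (B n)))"
        by (simp add: H_def distrib_left)
      also have "\<dots> \<le> W n + (H n + ennreal (2 * real N * (sqrt (real n) * exp (- ((ln (real n))\<^sup>2) / 8))))"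
      proof (intro add_mono order_refl)
        have "?r * (ennreal (exp (- ((ln (real n))\<^sup>2) / 8)) * emeasure lborel (B n))
          \<le> ?r * (ennreal (exp (- ((ln (real n))\<^sup>2) / 8)) * ennreal (2 * real N))"
          by (intro mult_left_mono emB) auto
        also have "\<dots> = ennreal (2 * real N * (sqrt (real n) * exp (- ((ln (real n))\<^sup>2) / 8)))"
          by (simp flip: ennreal_mult add: mult_ac)
        finally show "?r * (ennreal (exp (- ((ln (real n))\<^sup>2) / 8)) * emeasure lborel (B n)) \<le> \<dots>" .
        have "?r * (\<integral>\<^sup>+\<theta>\<in>A n. ennreal (D n \<theta>) \<partial>lborel)
          = ?r * (ennreal \<bar>1 / sqrt (real n)\<bar> * (\<integral>\<^sup>+t. ennreal (D n (0 + 1 / sqrt (real n) * t)) * indicator (A n) (0 + 1 / sqrt (real n) * t) \<partial>lborel))"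
          using s by (subst nn_integral_real_affine[where c = "1 / sqrt (real n)" and t = 0]) auto
        also have "\<dots> = (\<integral>\<^sup>+t. ennreal (D n (0 + 1 / sqrt (real n) * t)) * indicator (A n) (0 + 1 / sqrt (real n) * t) \<partial>lborel)"
          unfolding mult.assoc[symmetric] using s by (simp flip: ennreal_mult)
        also have "\<dots> = W n"
        proof -
          have "indicator (A n) (t / sqrt (real n)) = (indicator {t. \<bar>t\<bar> \<le> ln (real n) / 2} t :: ennreal)" for t
            using s by (simp add: A_def indicator_def field_simps)
          moreover have "real n * (t / sqrt (real n))\<^sup>2 = t\<^sup>2" for t
            using elim by (simp add: power_divide)
          ultimately show ?thesis unfolding W_def D_def by simp
        qed
        finally show "?r * (\<integral>\<^sup>+\<theta>\<in>A n. ennreal (D n \<theta>) \<partial>lborel) \<le> W n" by simp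
      qed
      finally show ?case .
    qed
  qed simp
  then show "(\<lambda>n. sqrt (real n) * (\<integral>\<theta>. indicator {-L..L} \<theta> * cmod (char (P n) \<theta> - of_real (exp (- (real n * \<theta>\<^sup>2) / 2))) \<partial>lborel)) \<longlonglongrightarrow> 0"
    unfolding D_def[symmetric]
    by (subst (asm) ennreal_tendsto_0_iff) (auto simp: D0 integral_nonneg_AE D_def)
qed

section \<open>Kernels and mixtures\<close>

lemma (in sigma_finite_measure) nn_integral_swap:
  assumes [measurable]: "(\<lambda>(\<omega>, t). h \<omega> t) \<in> borel_measurable (M \<Otimes>\<^sub>M lborel)" "B \<in> sets borel"
  shows "(\<integral>\<^sup>+\<omega>. (\<integral>\<^sup>+t\<in>B. h \<omega> t \<partial>lborel) \<partial>M) = (\<integral>\<^sup>+(t::real)\<in>B. (\<integral>\<^sup>+\<omega>. h \<omega> t \<partial>M) \<partial>lborel)"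
proof -
  interpret PL: pair_sigma_finite M lborel ..
  have "(\<integral>\<^sup>+\<omega>. (\<integral>\<^sup>+t\<in>B. h \<omega> t \<partial>lborel) \<partial>M) = (\<integral>\<^sup>+t. (\<integral>\<^sup>+\<omega>. h \<omega> t * indicator B t \<partial>M) \<partial>lborel)"
    by (rule PL.Fubini'[symmetric]) measurable
  also have "\<dots> = (\<integral>\<^sup>+t\<in>B. (\<integral>\<^sup>+\<omega>. h \<omega> t \<partial>M) \<partial>lborel)"
    by (intro nn_integral_cong nn_integral_multc) measurable
  finally show ?thesis .
qed

lemma measurable_integral_kernel:
  fixes g :: "'a \<times> 'b \<Rightarrow> 'c::{banach, second_countable_topology}"
  assumes K [measurable]: "K \<in> M \<rightarrow>\<^sub>M subprob_algebra N"
    and g [measurable]: "g \<in> borel_measurable (M \<Otimes>\<^sub>M N)"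
  shows "(\<lambda>x. \<integral>y. g (x, y) \<partial>K x) \<in> borel_measurable M"
proof -
  have "(\<lambda>x. distr (K x) (M \<Otimes>\<^sub>M N) (Pair x)) \<in> M \<rightarrow>\<^sub>M subprob_algebra (M \<Otimes>\<^sub>M N)"
    by (rule measurable_distr2[OF _ K]) simp
  from measurable_compose[OF this integral_measurable_subprob_algebra[OF g]]
  have "(\<lambda>x. \<integral>z. g z \<partial>distr (K x) (M \<Otimes>\<^sub>M N) (Pair x)) \<in> borel_measurable M" .
  moreover have "(\<integral>z. g z \<partial>distr (K x) (M \<Otimes>\<^sub>M N) (Pair x)) = (\<integral>y. g (x, y) \<partial>K x)" if x: "x \<in> space M" for x
  proof -
    have "sets (K x) = sets N" using measurable_space[OF K x] by (simp add: sets_kernel space_subprob_algebra)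
    then have "Pair x \<in> K x \<rightarrow>\<^sub>M M \<Otimes>\<^sub>M N" using x by (simp cong: measurable_cong_sets)
    then show ?thesis by (rule integral_distr) (rule g)
  qed
  ultimately show ?thesis by (simp cong: measurable_cong)
qed

text \<open>Stated for complex functions because it is applied to \<open>exp (i \<theta> S\<^sub>n)\<close>.\<close>

lemma integral_bind_bounded:
  fixes g :: "'b \<Rightarrow> complex"
  assumes M: "prob_space M" and K [measurable]: "K \<in> M \<rightarrow>\<^sub>M subprob_algebra N"
    and g [measurable]: "g \<in> borel_measurable N" and B: "\<And>y. norm (g y) \<le> B"
  shows "(\<integral>y. g y \<partial>(M \<bind> K)) = (\<integral>x. (\<integral>y. g y \<partial>K x) \<partial>M)"
    and "integrable M (\<lambda>x. \<integral>y. g y \<partial>K x)"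
proof -
  interpret prob_space M by fact
  have B0: "0 \<le> B" using B[of undefined] norm_ge_zero order_trans by blast
  have sub: "subprob_space (K x)" and sets_K: "sets (K x) = sets N" if "x \<in> space M" for x
    using measurable_space[OF K that] by (auto simp: space_subprob_algebra)
  have gK: "integrable (K x) g" if "x \<in> space M" for x
  proof -
    interpret subprob_space "K x" by (rule sub[OF that])
    show ?thesis using g B sets_K[OF that]
      by (intro integrable_const_bound[of _ B]) (auto cong: measurable_cong_sets)
  qed
  have g_le: "norm (\<integral>y. g y \<partial>K x) \<le> B" if "x \<in> space M" for x
  proof -
    interpret subprob_space "K x" by (rule sub[OF that])
    have "norm (\<integral>y. g y \<partial>K x) \<le> (\<integral>y. norm (g y) \<partial>K x)" by (rule integral_norm_bound)
    also have "\<dots> \<le> (\<integral>y. B \<partial>K x)"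
      by (intro integral_mono integrable_norm gK that B) simp
    also have "\<dots> \<le> B" using B0 by (simp add: mult_left_le_one_le subprob_measure_le_1)
    finally show ?thesis .
  qed
  have [measurable]: "(\<lambda>x. \<integral>y. g y \<partial>K x) \<in> borel_measurable M"
    by (rule measurable_compose[OF K integral_measurable_subprob_algebra[OF g]])
  show int: "integrable M (\<lambda>x. \<integral>y. g y \<partial>K x)"
    by (rule integrable_const_bound[of _ B]) (auto intro!: AE_I2 g_le)
  have real: "(\<integral>y. h y \<partial>(M \<bind> K)) = (\<integral>x. (\<integral>y. h y \<partial>K x) \<partial>M) \<and> integrable (M \<bind> K) h"
    if [measurable]: "h \<in> borel_measurable N" and h: "\<And>y. \<bar>h y\<bar> \<le> B" for h :: "'b \<Rightarrow> real"
  proof -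
    let ?D = "distr M (subprob_algebra N) K"
    have fin: "finite_measure ?D"
      by (rule finite_measure_distr) measurable
    have ae: "AE M' in ?D. emeasure M' (space M') \<le> ennreal 1"
      by (subst AE_distr_iff) (use sub in \<open>auto simp: subprob_space.subprob_emeasure_le_1 intro!: AE_I2\<close>)
    have "(\<integral>y. h y \<partial>join ?D) = (\<integral>M'. (\<integral>y. h y \<partial>M') \<partial>?D) \<and> integrable (join ?D) h"
      using integral_join[of h N B ?D 1] integrable_join[of h N B ?D 1] fin ae h that by simp
    then show ?thesis
      using integral_distr[OF K integral_measurable_subprob_algebra[OF that(1)]]
      by (simp add: bind_nonempty''[OF K not_empty])
  qed
  have Re: "\<bar>Re (g y)\<bar> \<le> B" "\<bar>Im (g y)\<bar> \<le> B" for y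
    using abs_Re_le_cmod[of "g y"] abs_Im_le_cmod[of "g y"] B[of y] by linarith+
  have r: "(\<integral>y. Re (g y) \<partial>(M \<bind> K)) = (\<integral>x. (\<integral>y. Re (g y) \<partial>K x) \<partial>M)" "integrable (M \<bind> K) (\<lambda>y. Re (g y))"
    and i: "(\<integral>y. Im (g y) \<partial>(M \<bind> K)) = (\<integral>x. (\<integral>y. Im (g y) \<partial>K x) \<partial>M)" "integrable (M \<bind> K) (\<lambda>y. Im (g y))"
    using real[of "\<lambda>y. Re (g y)"] real[of "\<lambda>y. Im (g y)"] Re by auto
  have gint: "integrable (M \<bind> K) g"
  proof -
    have "integrable (M \<bind> K) (\<lambda>y. complex_of_real (Re (g y)) + \<i> * complex_of_real (Im (g y)))"
      using r(2) i(2) by (intro Bochner_Integration.integrable_add integrable_mult_right integrable_of_real)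
    then show ?thesis by (simp flip: complex_eq)
  qed
  have "Re (\<integral>y. g y \<partial>(M \<bind> K)) = Re (\<integral>x. (\<integral>y. g y \<partial>K x) \<partial>M)"
    unfolding integral_Re[OF gint, symmetric] integral_Re[OF int, symmetric] r(1)
    by (intro Bochner_Integration.integral_cong refl integral_Re gK)
  moreover have "Im (\<integral>y. g y \<partial>(M \<bind> K)) = Im (\<integral>x. (\<integral>y. g y \<partial>K x) \<partial>M)"
    unfolding integral_Im[OF gint, symmetric] integral_Im[OF int, symmetric] i(1)
    by (intro Bochner_Integration.integral_cong refl integral_Im gK)
  ultimately show "(\<integral>y. g y \<partial>(M \<bind> K)) = (\<integral>x. (\<integral>y. g y \<partial>K x) \<partial>M)"
    by (rule complex_eqI)
qed

section \<open>The measures on the fibred sets\<close>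

context random_dynamics
begin

abbreviation "E \<equiv> fibre_space M X Xs"
abbreviation "E2 \<equiv> fibre_space M (X \<Otimes>\<^sub>M X) (\<lambda>\<omega>. Xs \<omega> \<times> Xs \<omega>)"

lemma space_E: "space E = fibre_set M Xs"
  unfolding fibre_space_def using E_sets by simp

lemma sets_E: "B \<in> sets E \<longleftrightarrow> B \<subseteq> fibre_set M Xs \<and> B \<in> sets (M \<Otimes>\<^sub>M X)"
  unfolding fibre_space_def using E_sets by (simp add: sets_restrict_space_iff)

lemma measurable_projections:
  "(\<lambda>z. (fst (fst z), (snd (fst z), snd (snd z)))) \<in> (M \<Otimes>\<^sub>M X) \<Otimes>\<^sub>M (M \<Otimes>\<^sub>M X) \<rightarrow>\<^sub>M M \<Otimes>\<^sub>M (X \<Otimes>\<^sub>M X)"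
  by measurable

lemma E2_sets: "fibre_set M (\<lambda>\<omega>. Xs \<omega> \<times> Xs \<omega>) \<in> sets (M \<Otimes>\<^sub>M (X \<Otimes>\<^sub>M X))"
proof -
  let ?p = "\<lambda>(\<omega>, x, y). (\<omega>, x)" and ?q = "\<lambda>(\<omega>, x, y). (\<omega>, y)"
  have p: "?p \<in> M \<Otimes>\<^sub>M (X \<Otimes>\<^sub>M X) \<rightarrow>\<^sub>M M \<Otimes>\<^sub>M X" "?q \<in> M \<Otimes>\<^sub>M (X \<Otimes>\<^sub>M X) \<rightarrow>\<^sub>M M \<Otimes>\<^sub>M X"
    by measurable
  have "fibre_set M (\<lambda>\<omega>. Xs \<omega> \<times> Xs \<omega>) = (?p -` fibre_set M Xs \<inter> space (M \<Otimes>\<^sub>M (X \<Otimes>\<^sub>M X)))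
      \<inter> (?q -` fibre_set M Xs \<inter> space (M \<Otimes>\<^sub>M (X \<Otimes>\<^sub>M X)))"
    using Xs_subset by (auto simp: fibre_set_def space_pair_measure)
  also have "\<dots> \<in> sets (M \<Otimes>\<^sub>M (X \<Otimes>\<^sub>M X))"
    by (intro sets.Int measurable_sets[OF p(1)] measurable_sets[OF p(2)] E_sets)
  finally show ?thesis .
qed

lemma sets_E2: "B \<in> sets E2 \<longleftrightarrow> B \<subseteq> fibre_set M (\<lambda>\<omega>. Xs \<omega> \<times> Xs \<omega>) \<and> B \<in> sets (M \<Otimes>\<^sub>M (X \<Otimes>\<^sub>M X))"
  unfolding fibre_space_def using E2_sets by (simp add: sets_restrict_space_iff)

lemma measurable_E2_E:
  "(\<lambda>(\<omega>, x, y). (\<omega>, x)) \<in> E2 \<rightarrow>\<^sub>M E" "(\<lambda>(\<omega>, x, y). (\<omega>, y)) \<in> E2 \<rightarrow>\<^sub>M E"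
  unfolding fibre_space_def
  by (rule measurable_restrict_space3, measurable, auto simp: fibre_set_def)+

lemma space_\<nu>: "\<omega> \<in> space M \<Longrightarrow> space (\<nu> \<omega>) = Xs \<omega>"
  using sets_eq_imp_space_eq[OF \<nu>_sets] Xs_subset by (auto simp: space_restrict_space)

lemma measurable_Pair_E:
  assumes \<omega>: "\<omega> \<in> space M"
  shows "Pair \<omega> \<in> \<nu> \<omega> \<rightarrow>\<^sub>M E"
proof -
  have "Pair \<omega> \<in> restrict_space X (Xs \<omega>) \<rightarrow>\<^sub>M E"
    unfolding fibre_space_def using \<omega>
    by (intro measurable_restrict_space3) (auto simp: fibre_set_def)
  then show ?thesis
    using \<nu>_sets[OF \<omega>] by (simp cong: measurable_cong_sets)
qed

text \<open>The fibre measure at \<open>\<omega>\<close>, placed on \<open>{\<omega>} \<times> X\<^sub>\<omega>\<close>. All these measures live on the common space \<open>E\<close>, so that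
  they can be mixed over \<open>\<omega>\<close>.\<close>

definition fibre_kernel :: "'s \<Rightarrow> ('s \<times> 'x) measure" where
  "fibre_kernel \<omega> = distr (\<nu> \<omega>) E (Pair \<omega>)"

lemma sets_fibre_kernel [simp]: "sets (fibre_kernel \<omega>) = sets E"
  by (simp add: fibre_kernel_def)

lemma prob_space_fibre_kernel: "\<omega> \<in> space M \<Longrightarrow> prob_space (fibre_kernel \<omega>)"
  unfolding fibre_kernel_def by (intro prob_space.prob_space_distr \<nu>_prob measurable_Pair_E)

lemma fibre_kernel_measurable [measurable]: "fibre_kernel \<in> M \<rightarrow>\<^sub>M subprob_algebra E"
proof (rule measurable_subprob_algebra)
  fix B assume B: "B \<in> sets E"
  have "emeasure (fibre_kernel \<omega>) B = emeasure (\<nu> \<omega>) {x. (\<omega>, x) \<in> B}" if \<omega>: "\<omega> \<in> space M" for \<omega>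
  proof -
    have "Pair \<omega> -` B \<inter> space (\<nu> \<omega>) = {x. (\<omega>, x) \<in> B}"
      using B \<omega> by (auto simp: sets_E space_\<nu> fibre_set_def)
    then show ?thesis
      unfolding fibre_kernel_def by (simp add: emeasure_distr[OF measurable_Pair_E[OF \<omega>] B])
  qed
  then show "(\<lambda>\<omega>. emeasure (fibre_kernel \<omega>) B) \<in> borel_measurable M"
    using kernel[OF B] by (simp cong: measurable_cong)
qed (auto simp: prob_space_fibre_kernel prob_space_imp_subprob_space)

lemma mu_hat_eq: "mu_hat M X Xs \<nu> = M \<bind> fibre_kernel"
  by (simp add: mu_hat_def fibre_integral_def fibre_kernel_def[abs_def])

lemma measurable_Pair_E2:
  assumes \<omega>: "\<omega> \<in> space M"
  shows "Pair \<omega> \<in> \<nu> \<omega> \<Otimes>\<^sub>M \<nu> \<omega> \<rightarrow>\<^sub>M E2"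
proof -
  have [measurable]: "(\<lambda>x. x) \<in> \<nu> \<omega> \<rightarrow>\<^sub>M X"
  proof -
    have "(\<lambda>x. x) \<in> restrict_space X (Xs \<omega>) \<rightarrow>\<^sub>M X" by (rule measurable_restrict_space1) simp
    then show ?thesis using \<nu>_sets[OF \<omega>] by (simp cong: measurable_cong_sets)
  qed
  have "(\<lambda>z. (fst z, snd z)) \<in> \<nu> \<omega> \<Otimes>\<^sub>M \<nu> \<omega> \<rightarrow>\<^sub>M X \<Otimes>\<^sub>M X"
    by (intro measurable_Pair measurable_compose[OF measurable_fst] measurable_compose[OF measurable_snd]) simp_all
  then have "Pair \<omega> \<in> \<nu> \<omega> \<Otimes>\<^sub>M \<nu> \<omega> \<rightarrow>\<^sub>M M \<Otimes>\<^sub>M (X \<Otimes>\<^sub>M X)"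
    using \<omega> by (intro measurable_Pair) simp_all
  then show ?thesis
    unfolding fibre_space_def using \<omega>
    by (intro measurable_restrict_space2) (auto simp: fibre_set_def space_\<nu> space_pair_measure)
qed

definition fibre_kernel2 :: "'s \<Rightarrow> ('s \<times> 'x \<times> 'x) measure" where
  "fibre_kernel2 \<omega> = distr (\<nu> \<omega> \<Otimes>\<^sub>M \<nu> \<omega>) E2 (Pair \<omega>)"

lemma sets_fibre_kernel2 [simp]: "sets (fibre_kernel2 \<omega>) = sets E2"
  by (simp add: fibre_kernel2_def)

lemma prob_space_fibre_kernel2: "\<omega> \<in> space M \<Longrightarrow> prob_space (fibre_kernel2 \<omega>)"
  unfolding fibre_kernel2_def
  by (intro prob_space.prob_space_distr prob_space_pair \<nu>_prob measurable_Pair_E2)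

text \<open>Measurability in \<open>\<omega>\<close> of \<open>\<nu> \<omega> \<times> \<nu> \<omega>\<close> is inherited from the product of two copies of \<open>fibre_kernel \<omega>\<close>.
  That product lives on \<open>E \<times> E\<close>, where the two base points may differ; the set \<open>C\<close> below forgets the
  second base point, which equals the first almost surely.\<close>

lemma fibre_kernel2_measurable [measurable]: "fibre_kernel2 \<in> M \<rightarrow>\<^sub>M subprob_algebra E2"
proof (rule measurable_subprob_algebra)
  fix B assume B: "B \<in> sets E2"
  define C where "C = (\<lambda>z. (fst (fst z), (snd (fst z), snd (snd z)))) -` B \<inter> space (E \<Otimes>\<^sub>M E)"
  have C: "C \<in> sets (E \<Otimes>\<^sub>M E)"
  proof -
    have id: "(\<lambda>z. z) \<in> E \<rightarrow>\<^sub>M M \<Otimes>\<^sub>M X"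
      unfolding fibre_space_def by (rule measurable_restrict_space1) simp
    have "(\<lambda>z. (fst z, snd z)) \<in> E \<Otimes>\<^sub>M E \<rightarrow>\<^sub>M (M \<Otimes>\<^sub>M X) \<Otimes>\<^sub>M (M \<Otimes>\<^sub>M X)"
      by (intro measurable_Pair measurable_compose[OF measurable_fst id] measurable_compose[OF measurable_snd id])
    from measurable_compose[OF this measurable_projections]
    have "(\<lambda>z. (fst (fst z), (snd (fst z), snd (snd z)))) \<in> E \<Otimes>\<^sub>M E \<rightarrow>\<^sub>M M \<Otimes>\<^sub>M (X \<Otimes>\<^sub>M X)"
      by simp
    then show ?thesis unfolding C_def using B by (intro measurable_sets) (auto simp: sets_E2)
  qed
  have "emeasure (fibre_kernel2 \<omega>) B = emeasure (fibre_kernel \<omega> \<Otimes>\<^sub>M fibre_kernel \<omega>) C" if \<omega>: "\<omega> \<in> space M" for \<omega>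
  proof -
    interpret K: prob_space "fibre_kernel \<omega>" by (rule prob_space_fibre_kernel[OF \<omega>])
    note Pair = measurable_Pair_E[OF \<omega>]
    have "fibre_kernel \<omega> \<Otimes>\<^sub>M fibre_kernel \<omega> = distr (\<nu> \<omega> \<Otimes>\<^sub>M \<nu> \<omega>) (E \<Otimes>\<^sub>M E) (\<lambda>(x, y). ((\<omega>, x), (\<omega>, y)))"
      using K.sigma_finite_measure_axioms unfolding fibre_kernel_def by (rule pair_measure_distr[OF Pair Pair])
    moreover have "(\<lambda>(x, y). ((\<omega>, x), (\<omega>, y))) \<in> \<nu> \<omega> \<Otimes>\<^sub>M \<nu> \<omega> \<rightarrow>\<^sub>M E \<Otimes>\<^sub>M E"
      unfolding split_beta'
      by (intro measurable_Pair measurable_compose[OF measurable_fst Pair] measurable_compose[OF measurable_snd Pair])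
    moreover have "(\<lambda>(x, y). ((\<omega>, x), (\<omega>, y))) -` C \<inter> space (\<nu> \<omega> \<Otimes>\<^sub>M \<nu> \<omega>)
        = Pair \<omega> -` B \<inter> space (\<nu> \<omega> \<Otimes>\<^sub>M \<nu> \<omega>)"
      using \<omega> by (auto simp: C_def space_pair_measure space_E space_\<nu> fibre_set_def)
    ultimately show ?thesis
      unfolding fibre_kernel2_def by (simp add: emeasure_distr[OF measurable_Pair_E2[OF \<omega>] B] emeasure_distr C)
  qed
  moreover have "(\<lambda>\<omega>. emeasure (fibre_kernel \<omega> \<Otimes>\<^sub>M fibre_kernel \<omega>) C) \<in> borel_measurable M"
    by (rule measurable_compose[OF measurable_pair_measure[OF fibre_kernel_measurable fibre_kernel_measurable]
          measurable_emeasure_subprob_algebra[OF C]])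
  ultimately show "(\<lambda>\<omega>. emeasure (fibre_kernel2 \<omega>) B) \<in> borel_measurable M"
    by (simp cong: measurable_cong)
qed (auto simp: prob_space_fibre_kernel2 prob_space_imp_subprob_space)

lemma mu_hat2_eq: "mu_hat2 M X Xs \<nu> = M \<bind> fibre_kernel2"
  by (simp add: mu_hat2_def fibre_integral_def fibre_kernel2_def[abs_def])


lemma fibre_iter_measurable:
  "(\<lambda>(\<omega>, x). ((T ^^ j) \<omega>, fibre_iter T f j \<omega> x)) \<in> E \<rightarrow>\<^sub>M E"
proof (induction j)
  case 0
  then show ?case by (simp add: case_prod_unfold)
next
  case (Suc j)
  from measurable_compose[OF Suc F1_measurable] show ?case
    by (simp add: case_prod_unfold)
qed

end

section \<open>Averages of the fibrewise characteristic functions\<close>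

locale random_dynamics_observable = random_dynamics +
  fixes A :: "'b \<Rightarrow> real"
  assumes A_measurable: "A \<in> borel_measurable X"
begin

abbreviation "S \<equiv> birkhoff T f A"

lemma birkhoff_measurable [measurable]: "(\<lambda>(\<omega>, x). S n \<omega> x) \<in> borel_measurable E"
proof -
  have snd: "snd \<in> E \<rightarrow>\<^sub>M X"
    unfolding fibre_space_def by (rule measurable_restrict_space1) simp
  have "(\<lambda>(\<omega>, x). A (fibre_iter T f j \<omega> x)) \<in> borel_measurable E" for j
    using measurable_compose[OF measurable_compose[OF fibre_iter_measurable[of j] snd] A_measurable]
    by (simp add: case_prod_unfold)
  then show ?thesis
    unfolding birkhoff_def case_prod_unfold by (intro borel_measurable_sum) simp
qed

lemma birkhoff_measurable_fibre:
  "\<omega> \<in> space M \<Longrightarrow> S n \<omega> \<in> borel_measurable (\<nu> \<omega>)"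
  using measurable_compose[OF measurable_Pair_E birkhoff_measurable[of n]] by simp

lemma birkhoff2_measurable [measurable]: "birkhoff2 T f A n \<in> borel_measurable E2"
proof -
  have "(\<lambda>z. (case (case z of (\<omega>, x, y) \<Rightarrow> (\<omega>, x)) of (\<omega>, x) \<Rightarrow> S n \<omega> x) -
     (case (case z of (\<omega>, x, y) \<Rightarrow> (\<omega>, y)) of (\<omega>, x) \<Rightarrow> S n \<omega> x)) \<in> borel_measurable E2"
    by (intro borel_measurable_diff measurable_compose[OF measurable_E2_E(1) birkhoff_measurable]
        measurable_compose[OF measurable_E2_E(2) birkhoff_measurable])
  then show ?thesis
    by (simp add: birkhoff2_def case_prod_unfold)
qed

definition law :: "nat \<Rightarrow> 'a \<Rightarrow> real measure" where
  "law n \<omega> = distr (\<nu> \<omega>) borel (S n \<omega>)"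

lemma real_distribution_law:
  assumes \<omega>: "\<omega> \<in> space M"
  shows "real_distribution (law n \<omega>)"
  unfolding law_def
  by (intro prob_space.real_distribution_distr \<nu>_prob birkhoff_measurable_fibre \<omega>)

lemma char_law: "\<omega> \<in> space M \<Longrightarrow> char (law n \<omega>) \<theta> = (\<integral>x. iexp (\<theta> * S n \<omega> x) \<partial>\<nu> \<omega>)"
  unfolding char_def law_def by (rule integral_distr) (auto intro: birkhoff_measurable_fibre)

text \<open>Rewritten with the kernel into the fixed space \<open>E\<close>, the characteristic function is visibly
  measurable in \<open>\<omega>\<close>.\<close>

lemma char_law_fibre_kernel:
  assumes \<omega>: "\<omega> \<in> space M"
  shows "char (law n \<omega>) \<theta> = (\<integral>z. iexp (\<theta> * (case z of (\<omega>, x) \<Rightarrow> S n \<omega> x)) \<partial>fibre_kernel \<omega>)"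
  unfolding char_law[OF \<omega>] fibre_kernel_def
  by (subst integral_distr[OF measurable_Pair_E[OF \<omega>]]) (simp_all, measurable)

lemma char_law_measurable [measurable]:
  "(\<lambda>z. char (law n (fst z)) (snd z)) \<in> borel_measurable (M \<Otimes>\<^sub>M borel)"
proof -
  have "(\<lambda>z. \<integral>y. iexp (snd (fst (z, y)) * (case snd (z, y) of (\<omega>, x) \<Rightarrow> S n \<omega> x)) \<partial>fibre_kernel (fst z))
     \<in> borel_measurable (M \<Otimes>\<^sub>M (borel :: real measure))"
    by (rule measurable_integral_kernel[where g = "\<lambda>p. iexp (snd (fst p) * (case snd p of (\<omega>, x) \<Rightarrow> S n \<omega> x))"])
       measurable
  then show ?thesis
    by (rule measurable_cong[THEN iffD1, rotated])
       (auto simp: space_pair_measure char_law_fibre_kernel)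
qed

lemma integral_mu_hat:
  "(\<integral>(\<omega>, x). iexp (\<theta> * S n \<omega> x) \<partial>mu_hat M X Xs \<nu>) = (\<integral>\<omega>. char (law n \<omega>) \<theta> \<partial>M)"
  "integrable M (\<lambda>\<omega>. char (law n \<omega>) \<theta>)"
proof -
  let ?g = "\<lambda>z. iexp (\<theta> * (case z of (\<omega>, x) \<Rightarrow> S n \<omega> x))"
  have g: "?g \<in> borel_measurable E" by measurable
  note bind = integral_bind_bounded[OF prob_space_axioms fibre_kernel_measurable g, of 1]
  have "(\<integral>(\<omega>, x). iexp (\<theta> * S n \<omega> x) \<partial>mu_hat M X Xs \<nu>) = (\<integral>z. ?g z \<partial>(M \<bind> fibre_kernel))"
    by (simp add: mu_hat_eq case_prod_unfold)
  also have "\<dots> = (\<integral>\<omega>. (\<integral>z. ?g z \<partial>fibre_kernel \<omega>) \<partial>M)"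
    by (rule bind) simp
  also have "\<dots> = (\<integral>\<omega>. char (law n \<omega>) \<theta> \<partial>M)"
    by (intro Bochner_Integration.integral_cong refl) (simp add: char_law_fibre_kernel)
  finally show "(\<integral>(\<omega>, x). iexp (\<theta> * S n \<omega> x) \<partial>mu_hat M X Xs \<nu>) = \<dots>" .
  show "integrable M (\<lambda>\<omega>. char (law n \<omega>) \<theta>)"
    using bind(2) by (simp add: char_law_fibre_kernel cong: Bochner_Integration.integrable_cong)
qed

text \<open>The squared modulus of a characteristic function is the characteristic function of the
  difference of two independent copies.\<close>

lemma integral_mu_hat2:
  "(\<integral>z. iexp (\<theta> * birkhoff2 T f A n z) \<partial>mu_hat2 M X Xs \<nu>) = of_real (\<integral>\<omega>. (cmod (char (law n \<omega>) \<theta>))\<^sup>2 \<partial>M)"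
  "integrable M (\<lambda>\<omega>. (cmod (char (law n \<omega>) \<theta>))\<^sup>2)"
proof -
  let ?g = "\<lambda>z. iexp (\<theta> * birkhoff2 T f A n z)"
  have g: "?g \<in> borel_measurable E2" by measurable
  note bind = integral_bind_bounded[OF prob_space_axioms fibre_kernel2_measurable g, of 1]
  have inner: "(\<integral>z. ?g z \<partial>fibre_kernel2 \<omega>) = of_real ((cmod (char (law n \<omega>) \<theta>))\<^sup>2)" if \<omega>: "\<omega> \<in> space M" for \<omega>
  proof -
    interpret \<nu>: prob_space "\<nu> \<omega>" by (rule \<nu>_prob[OF \<omega>])
    interpret P: pair_prob_space "\<nu> \<omega>" "\<nu> \<omega>" ..
    let ?h = "\<lambda>p. iexp (\<theta> * birkhoff2 T f A n (\<omega>, p))"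
    have h: "?h \<in> borel_measurable (\<nu> \<omega> \<Otimes>\<^sub>M \<nu> \<omega>)"
      using measurable_compose[OF measurable_Pair_E2[OF \<omega>] g] by simp
    have "(\<integral>z. ?g z \<partial>fibre_kernel2 \<omega>) = (\<integral>p. ?h p \<partial>(\<nu> \<omega> \<Otimes>\<^sub>M \<nu> \<omega>))"
      unfolding fibre_kernel2_def by (rule integral_distr[OF measurable_Pair_E2[OF \<omega>] g])
    also have "\<dots> = (\<integral>x. (\<integral>y. ?h (x, y) \<partial>\<nu> \<omega>) \<partial>\<nu> \<omega>)"
      by (rule P.integral_fst'[symmetric], rule P.integrable_const_bound[of _ 1]) (use h in auto)
    also have "\<dots> = (\<integral>x. (\<integral>y. iexp (\<theta> * S n \<omega> x) * cnj (iexp (\<theta> * S n \<omega> y)) \<partial>\<nu> \<omega>) \<partial>\<nu> \<omega>)"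
      by (intro Bochner_Integration.integral_cong refl)
         (simp add: birkhoff2_def exp_cnj algebra_simps flip: exp_add)
    also have "\<dots> = char (law n \<omega>) \<theta> * cnj (char (law n \<omega>) \<theta>)"
      by (simp add: char_law[OF \<omega>] del: of_real_mult)
    also have "\<dots> = of_real ((cmod (char (law n \<omega>) \<theta>))\<^sup>2)"
      by (rule complex_norm_square[symmetric])
    finally show ?thesis .
  qed
  have "(\<integral>z. ?g z \<partial>mu_hat2 M X Xs \<nu>) = (\<integral>\<omega>. (\<integral>z. ?g z \<partial>fibre_kernel2 \<omega>) \<partial>M)"
    unfolding mu_hat2_eq by (rule bind) simp
  also have "\<dots> = (\<integral>\<omega>. complex_of_real ((cmod (char (law n \<omega>) \<theta>))\<^sup>2) \<partial>M)"
    by (intro Bochner_Integration.integral_cong refl inner)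
  finally show "(\<integral>z. ?g z \<partial>mu_hat2 M X Xs \<nu>) = of_real (\<integral>\<omega>. (cmod (char (law n \<omega>) \<theta>))\<^sup>2 \<partial>M)"
    by (simp del: of_real_power)
  have "integrable M (\<lambda>\<omega>. complex_of_real ((cmod (char (law n \<omega>) \<theta>))\<^sup>2))"
    by (rule Bochner_Integration.integrable_cong[THEN iffD1, OF refl inner bind(2)]) simp_all
  then show "integrable M (\<lambda>\<omega>. (cmod (char (law n \<omega>) \<theta>))\<^sup>2)"
    by (drule_tac integrable_Re) simp
qed

lemma nn_second_moment:
  "(\<integral>\<^sup>+\<omega>. ennreal ((cmod (char (law n \<omega>) \<theta>))\<^sup>2) \<partial>M)
    = ennreal (cmod (\<integral>z. iexp (\<theta> * birkhoff2 T f A n z) \<partial>mu_hat2 M X Xs \<nu>))"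
  unfolding integral_mu_hat2(1) norm_of_real
  by (subst nn_integral_eq_integral[OF integral_mu_hat2(2)]) (auto simp: integral_nonneg_AE)

text \<open>Expand \<open>\<bar>\<psi> - g\<bar>\<^sup>2 = \<bar>\<psi>\<bar>\<^sup>2 - 2 g Re \<psi> + g\<^sup>2\<close> with \<open>g = exp (- t\<^sup>2 / 2)\<close>. After averaging over \<open>\<omega>\<close> this is
  \<open>Re (char2 - g\<^sup>2) - 2 g Re (char1 - g)\<close>, and \<open>g \<le> 1\<close>.\<close>

lemma nn_second_moment_diff:
  "(\<integral>\<^sup>+\<omega>. ennreal ((cmod (char (law n \<omega>) (t / sqrt n) - of_real (exp (- (t\<^sup>2) / 2))))\<^sup>2) \<partial>M)
    \<le> ennreal (cmod (char2 M T X Xs f \<nu> A n t - of_real (exp (- (t\<^sup>2)))))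
      + 2 * ennreal (cmod (char1 M T X Xs f \<nu> A n t - of_real (exp (- (t\<^sup>2) / 2))))"
proof -
  let ?\<psi> = "\<lambda>\<omega>. char (law n \<omega>) (t / sqrt n)"
  define g where "g = exp (- (t\<^sup>2) / 2)"
  have g: "0 < g" "g \<le> 1" "exp (- (t\<^sup>2)) = g\<^sup>2" by (auto simp: g_def simp flip: exp_double)
  have c2: "char2 M T X Xs f \<nu> A n t = of_real (\<integral>\<omega>. (cmod (?\<psi> \<omega>))\<^sup>2 \<partial>M)"
    unfolding char2_def integral_mu_hat2(1)[symmetric] by simp
  have c1: "char1 M T X Xs f \<nu> A n t = (\<integral>\<omega>. ?\<psi> \<omega> \<partial>M)"
    unfolding char1_def integral_mu_hat(1)[symmetric] by simp
  have sq: "(cmod (z - of_real g))\<^sup>2 = (cmod z)\<^sup>2 - 2 * g * Re z + g\<^sup>2" for z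
    by (simp add: cmod_power2 power2_diff algebra_simps)
  have int: "integrable M (\<lambda>\<omega>. (cmod (?\<psi> \<omega> - of_real g))\<^sup>2)"
    unfolding sq using integral_mu_hat2(2) integrable_Re[OF integral_mu_hat(2)]
    by (intro Bochner_Integration.integrable_add Bochner_Integration.integrable_diff integrable_mult_right) auto
  have "(\<integral>\<omega>. (cmod (?\<psi> \<omega> - of_real g))\<^sup>2 \<partial>M)
      = (\<integral>\<omega>. (cmod (?\<psi> \<omega>))\<^sup>2 \<partial>M) - 2 * g * (\<integral>\<omega>. Re (?\<psi> \<omega>) \<partial>M) + g\<^sup>2"
    unfolding sq using integral_mu_hat2(2) integrable_Re[OF integral_mu_hat(2)]
    by (simp add: prob_space)
  also have "\<dots> = Re (char2 M T X Xs f \<nu> A n t - of_real (g\<^sup>2)) - 2 * g * Re (char1 M T X Xs f \<nu> A n t - of_real g)"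
    by (simp add: c2 c1 integral_mu_hat(2) algebra_simps power2_eq_square)
  also have "\<dots> \<le> cmod (char2 M T X Xs f \<nu> A n t - of_real (g\<^sup>2)) + 2 * cmod (char1 M T X Xs f \<nu> A n t - of_real g)"
  proof -
    let ?w = "char1 M T X Xs f \<nu> A n t - of_real g"
    have "- (g * Re ?w) \<le> g * cmod ?w"
      using g abs_Re_le_cmod[of ?w] by (simp flip: mult_minus_right)
    also have "\<dots> \<le> cmod ?w" using g by (simp add: mult_left_le_one_le)
    finally show ?thesis
      using complex_Re_le_cmod[of "char2 M T X Xs f \<nu> A n t - of_real (g\<^sup>2)"] by linarith
  qed
  finally have le: "(\<integral>\<omega>. (cmod (?\<psi> \<omega> - of_real g))\<^sup>2 \<partial>M) \<le> \<dots>" .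
  have "(\<integral>\<^sup>+\<omega>. ennreal ((cmod (?\<psi> \<omega> - of_real g))\<^sup>2) \<partial>M) = ennreal (\<integral>\<omega>. (cmod (?\<psi> \<omega> - of_real g))\<^sup>2 \<partial>M)"
    by (rule nn_integral_eq_integral[OF int]) simp
  also have "\<dots> \<le> ennreal (cmod (char2 M T X Xs f \<nu> A n t - of_real (g\<^sup>2)) + 2 * cmod (char1 M T X Xs f \<nu> A n t - of_real g))"
    by (rule ennreal_leI[OF le])
  also have "\<dots> = ennreal (cmod (char2 M T X Xs f \<nu> A n t - of_real (g\<^sup>2))) + 2 * ennreal (cmod (char1 M T X Xs f \<nu> A n t - of_real g))"
    by (simp add: ennreal_mult)
  finally show ?thesis unfolding g(3) unfolding g_def by simp
qed

lemma char_law_measurable' [measurable (raw)]: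
  assumes [measurable]: "g \<in> N \<rightarrow>\<^sub>M M" "h \<in> borel_measurable N"
  shows "(\<lambda>x. char (law n (g x)) (h x)) \<in> borel_measurable N"
proof -
  have "(\<lambda>x. (g x, h x)) \<in> N \<rightarrow>\<^sub>M M \<Otimes>\<^sub>M borel" by measurable
  from measurable_compose[OF this char_law_measurable[of n]] show ?thesis by simp
qed

section \<open>Almost every fibre\<close>

text \<open>The factor \<open>ln n\<close>, needed later for the Cauchy-Schwarz inequality on an interval of that length, is
  at most \<open>n\<^sup>\<zeta> / \<zeta>\<close>. Hence the expectations are \<open>O(n powr - (\<eta> - \<zeta>))\<close>, which is summable along \<open>\<lceil>k\<^sup>\<alpha>\<rceil>\<close>
  because \<open>\<alpha> (\<eta> - \<zeta>) > 1\<close>.\<close>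

lemma AE_low_frequencies:
  assumes \<eta>: "\<eta> > \<zeta>" "\<zeta> > 0" and \<alpha>: "\<alpha> > 1 / (\<eta> - \<zeta>)"
    and c2: "ennreal_bigo (\<lambda>n. \<integral>\<^sup>+t\<in>{t. \<bar>t\<bar> \<le> ln (real n)}.
          ennreal (cmod (char2 M T X Xs f \<nu> A n t - of_real (exp (- (t\<^sup>2))))) \<partial>lborel)
        (\<lambda>n. real n powr (- \<eta>))"
    and c1: "ennreal_bigo (\<lambda>n. \<integral>\<^sup>+t\<in>{t. \<bar>t\<bar> \<le> ln (real n)}.
          ennreal (cmod (char1 M T X Xs f \<nu> A n t - of_real (exp (- (t\<^sup>2) / 2)))) \<partial>lborel)
        (\<lambda>n. real n powr (- \<eta>))"
  shows "AE \<omega> in M. (\<lambda>k. ennreal (ln (real (power_subseq \<alpha> k))) *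
        (\<integral>\<^sup>+t\<in>{t. \<bar>t\<bar> \<le> ln (real (power_subseq \<alpha> k))}.
          ennreal ((cmod (char (law (power_subseq \<alpha> k) \<omega>) (t / sqrt (real (power_subseq \<alpha> k))) - of_real (exp (- (t\<^sup>2) / 2))))\<^sup>2) \<partial>lborel))
      \<longlonglongrightarrow> 0"
proof -
  let ?m = "power_subseq \<alpha>"
  define I2 where "I2 = (\<lambda>n. \<integral>\<^sup>+t\<in>{t. \<bar>t\<bar> \<le> ln (real n)}. ennreal (cmod (char2 M T X Xs f \<nu> A n t - of_real (exp (- (t\<^sup>2))))) \<partial>lborel)"
  define I1 where "I1 = (\<lambda>n. \<integral>\<^sup>+t\<in>{t. \<bar>t\<bar> \<le> ln (real n)}. ennreal (cmod (char1 M T X Xs f \<nu> A n t - of_real (exp (- (t\<^sup>2) / 2)))) \<partial>lborel)"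
  let ?q = "\<lambda>n \<omega> t. ennreal ((cmod (char (law n \<omega>) (t / sqrt (real n)) - of_real (exp (- (t\<^sup>2) / 2))))\<^sup>2)"
  let ?Z = "\<lambda>n \<omega>. ennreal (ln (real n)) * (\<integral>\<^sup>+t\<in>{t. \<bar>t\<bar> \<le> ln (real n)}. ?q n \<omega> t \<partial>lborel)"
  have "0 < 1 / (\<eta> - \<zeta>)" using \<eta> by simp
  then have \<alpha>0: "\<alpha> > 0" using \<alpha> by linarith
  have \<alpha>1: "\<alpha> * (\<eta> - \<zeta>) > 1" using \<alpha> \<eta> by (simp add: divide_less_eq)
  obtain K2 where K2: "\<forall>\<^sub>F n in sequentially. I2 n \<le> ennreal (K2 * real n powr (- \<eta>))"
    using c2 unfolding ennreal_bigo_def I2_def by (elim exE)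
  obtain K1 where K1: "\<forall>\<^sub>F n in sequentially. I1 n \<le> ennreal (K1 * real n powr (- \<eta>))"
    using c1 unfolding ennreal_bigo_def I1_def by (elim exE)
  define C where "C = \<bar>K2\<bar> + 2 * \<bar>K1\<bar>"
  have C: "C \<ge> 0" by (simp add: C_def)
  have [measurable]: "{t::real. \<bar>t\<bar> \<le> a} \<in> sets borel" for a by measurable
  have I_measurable: "(\<lambda>t. char2 M T X Xs f \<nu> A n t) \<in> borel_measurable borel"
    "(\<lambda>t. char1 M T X Xs f \<nu> A n t) \<in> borel_measurable borel" for n
  proof -
    have "char2 M T X Xs f \<nu> A n t = of_real (\<integral>\<omega>. (cmod (char (law n \<omega>) (t / sqrt n)))\<^sup>2 \<partial>M)" for t
      unfolding char2_def integral_mu_hat2(1)[symmetric] by simp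
    then show "(\<lambda>t. char2 M T X Xs f \<nu> A n t) \<in> borel_measurable borel" by simp
    have "char1 M T X Xs f \<nu> A n t = (\<integral>\<omega>. char (law n \<omega>) (t / sqrt n) \<partial>M)" for t
      unfolding char1_def integral_mu_hat(1)[symmetric] by simp
    then show "(\<lambda>t. char1 M T X Xs f \<nu> A n t) \<in> borel_measurable borel" by simp
  qed
  note [measurable] = I_measurable
  have q: "\<forall>\<^sub>F n in sequentially. (\<integral>\<^sup>+\<omega>. ?Z n \<omega> \<partial>M) \<le> ennreal (C / \<zeta> * real n powr (- (\<eta> - \<zeta>)))"
    using K1 K2 eventually_ge_at_top[of 1]
  proof eventually_elim
    case (elim n)
    have ln: "0 \<le> ln (real n)" "ln (real n) \<le> real n powr \<zeta> / \<zeta>"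
      using elim \<eta> by (auto intro: ln_powr_bound)
    have "(\<integral>\<^sup>+\<omega>. (\<integral>\<^sup>+t\<in>{t. \<bar>t\<bar> \<le> ln (real n)}. ?q n \<omega> t \<partial>lborel) \<partial>M)
      = (\<integral>\<^sup>+t\<in>{t. \<bar>t\<bar> \<le> ln (real n)}. (\<integral>\<^sup>+\<omega>. ?q n \<omega> t \<partial>M) \<partial>lborel)"
    proof (rule nn_integral_swap[where h = "?q n"])
      show "(\<lambda>(\<omega>, t). ?q n \<omega> t) \<in> borel_measurable (M \<Otimes>\<^sub>M lborel)"
        unfolding case_prod_unfold by measurable
    qed measurable
    also have "\<dots> \<le> (\<integral>\<^sup>+t. ennreal (cmod (char2 M T X Xs f \<nu> A n t - of_real (exp (- (t\<^sup>2))))) * indicator {t. \<bar>t\<bar> \<le> ln (real n)} t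
        + 2 * (ennreal (cmod (char1 M T X Xs f \<nu> A n t - of_real (exp (- (t\<^sup>2) / 2)))) * indicator {t. \<bar>t\<bar> \<le> ln (real n)} t) \<partial>lborel)"
    proof (intro nn_integral_mono)
      fix t
      show "(\<integral>\<^sup>+\<omega>. ?q n \<omega> t \<partial>M) * indicator {t. \<bar>t\<bar> \<le> ln (real n)} t
        \<le> ennreal (cmod (char2 M T X Xs f \<nu> A n t - of_real (exp (- (t\<^sup>2))))) * indicator {t. \<bar>t\<bar> \<le> ln (real n)} t
        + 2 * (ennreal (cmod (char1 M T X Xs f \<nu> A n t - of_real (exp (- (t\<^sup>2) / 2)))) * indicator {t. \<bar>t\<bar> \<le> ln (real n)} t)"
        using nn_second_moment_diff[of n t] by (cases "t \<in> {t. \<bar>t\<bar> \<le> ln (real n)}") simp_all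
    qed
    also have "\<dots> = I2 n + 2 * I1 n"
    proof -
      define g2 where "g2 = (\<lambda>t. ennreal (cmod (char2 M T X Xs f \<nu> A n t - of_real (exp (- (t\<^sup>2))))) * indicator {t. \<bar>t\<bar> \<le> ln (real n)} t)"
      define g1 where "g1 = (\<lambda>t. ennreal (cmod (char1 M T X Xs f \<nu> A n t - of_real (exp (- (t\<^sup>2) / 2)))) * indicator {t. \<bar>t\<bar> \<le> ln (real n)} t)"
      have g: "g2 \<in> borel_measurable lborel" "g1 \<in> borel_measurable lborel"
        unfolding g2_def g1_def by measurable
      have "(\<integral>\<^sup>+t. g2 t + 2 * g1 t \<partial>lborel) = (\<integral>\<^sup>+t. g2 t \<partial>lborel) + (\<integral>\<^sup>+t. 2 * g1 t \<partial>lborel)"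
        using g by (intro nn_integral_add) simp_all
      also have "(\<integral>\<^sup>+t. 2 * g1 t \<partial>lborel) = 2 * (\<integral>\<^sup>+t. g1 t \<partial>lborel)"
        using g by (intro nn_integral_cmult) simp_all
      finally show ?thesis unfolding g2_def g1_def I2_def I1_def .
    qed
    also have "\<dots> \<le> ennreal (\<bar>K2\<bar> * real n powr (- \<eta>)) + 2 * ennreal (\<bar>K1\<bar> * real n powr (- \<eta>))"
    proof (intro add_mono mult_left_mono)
      have "K2 * real n powr (- \<eta>) \<le> \<bar>K2\<bar> * real n powr (- \<eta>)" by (intro mult_right_mono) auto
      from order_trans[OF elim(2) ennreal_leI[OF this]]
      show "I2 n \<le> ennreal (\<bar>K2\<bar> * real n powr (- \<eta>))" .
      have "K1 * real n powr (- \<eta>) \<le> \<bar>K1\<bar> * real n powr (- \<eta>)" by (intro mult_right_mono) auto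
      from order_trans[OF elim(1) ennreal_leI[OF this]]
      show "I1 n \<le> ennreal (\<bar>K1\<bar> * real n powr (- \<eta>))" .
    qed simp
    also have "\<dots> = ennreal (C * real n powr (- \<eta>))"
    proof -
      let ?x = "\<bar>K2\<bar> * real n powr (- \<eta>)" and ?y = "\<bar>K1\<bar> * real n powr (- \<eta>)"
      have "2 * ennreal ?y = ennreal (2 * ?y)" using ennreal_mult'[of 2 ?y] by (simp only: ennreal_numeral zero_le_numeral)
      moreover have "ennreal ?x + ennreal (2 * ?y) = ennreal (?x + 2 * ?y)"
        by (intro ennreal_plus[symmetric]) simp_all
      moreover have "?x + 2 * ?y = C * real n powr (- \<eta>)" by (simp only: C_def distrib_right mult.assoc)
      ultimately show ?thesis by (simp only:)
    qed
    finally have inner: "(\<integral>\<^sup>+\<omega>. (\<integral>\<^sup>+t\<in>{t. \<bar>t\<bar> \<le> ln (real n)}. ?q n \<omega> t \<partial>lborel) \<partial>M) \<le> ennreal (C * real n powr (- \<eta>))" .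
    have "(\<integral>\<^sup>+\<omega>. ?Z n \<omega> \<partial>M) = ennreal (ln (real n)) * (\<integral>\<^sup>+\<omega>. (\<integral>\<^sup>+t\<in>{t. \<bar>t\<bar> \<le> ln (real n)}. ?q n \<omega> t \<partial>lborel) \<partial>M)"
      by (rule nn_integral_cmult) measurable
    also have "\<dots> \<le> ennreal (ln (real n)) * ennreal (C * real n powr (- \<eta>))"
      by (rule mult_left_mono[OF inner]) simp
    also have "\<dots> = ennreal (ln (real n) * (C * real n powr (- \<eta>)))"
      using ln C by (simp add: ennreal_mult)
    also have "\<dots> \<le> ennreal ((real n powr \<zeta> / \<zeta>) * (C * real n powr (- \<eta>)))"
      using ln C by (intro ennreal_leI mult_right_mono) auto
    also have "(real n powr \<zeta> / \<zeta>) * (C * real n powr (- \<eta>)) = C / \<zeta> * real n powr (- (\<eta> - \<zeta>))"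
      by (simp flip: powr_add)
    finally show ?case .
  qed
  have "AE \<omega> in M. (\<lambda>k. ?Z (?m k) \<omega>) \<longlonglongrightarrow> 0"
  proof (rule AE_tendsto_0_if_summable_nn_integral)
    show "\<And>k. ?Z (?m k) \<in> borel_measurable M" by measurable
    show "summable (\<lambda>k. C / \<zeta> * real k powr (- (\<alpha> * (\<eta> - \<zeta>))))"
      using \<alpha>1 by (intro summable_mult) (simp add: summable_real_powr_iff)
    show "0 \<le> C / \<zeta> * real k powr (- (\<alpha> * (\<eta> - \<zeta>)))" for k using C \<eta> by simp
    from filterlim_iff[THEN iffD1, OF filterlim_power_subseq[OF \<alpha>0], rule_format, OF q]
    show "\<forall>\<^sub>F k in sequentially. (\<integral>\<^sup>+\<omega>. ?Z (?m k) \<omega> \<partial>M) \<le> ennreal (C / \<zeta> * real k powr (- (\<alpha> * (\<eta> - \<zeta>))))"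
      using eventually_ge_at_top[of 1]
    proof eventually_elim
      case (elim k)
      have "real (?m k) powr (- (\<eta> - \<zeta>)) \<le> (real k powr \<alpha>) powr (- (\<eta> - \<zeta>))"
        using power_subseq_ge[of k \<alpha>] elim \<eta> by (intro powr_mono2') auto
      also have "\<dots> = real k powr (- (\<alpha> * (\<eta> - \<zeta>)))"
        unfolding powr_powr by (simp only: mult_minus_right)
      finally have "C / \<zeta> * real (?m k) powr (- (\<eta> - \<zeta>)) \<le> C / \<zeta> * real k powr (- (\<alpha> * (\<eta> - \<zeta>)))"
        using C \<eta> by (intro mult_left_mono) auto
      from order_trans[OF elim(1) ennreal_leI[OF this]] show ?case .
    qed
  qed
  then show ?thesis .
qed

text \<open>Up to \<open>\<delta>\<close> the averaged characteristic function is at most \<open>C exp (- c (ln n)\<^sup>2 / 4)\<close>, beyond \<open>\<delta>\<close> its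
  integral is \<open>O(n powr - b)\<close>. Multiplied by \<open>n\<close>, both are summable as \<open>b > 2\<close>.\<close>

lemma AE_high_frequencies:
  assumes \<delta>: "0 < \<delta>" "\<delta> < 1" and C: "C > 0" and c: "c > 0" and b: "b > 2"
    and mid: "\<And>\<theta> n. \<theta> \<in> {-\<delta>..\<delta>} \<Longrightarrow> cmod (\<integral>z. iexp (\<theta> * birkhoff2 T f A n z) \<partial>mu_hat2 M X Xs \<nu>) \<le> C * exp (- c * \<theta>\<^sup>2 * real n)"
    and high: "ennreal_bigo
        (\<lambda>n. \<integral>\<^sup>+\<theta>\<in>{\<theta>. \<delta> \<le> \<bar>\<theta>\<bar> \<and> \<bar>\<theta>\<bar> \<le> real N}.
            ennreal (cmod (\<integral>z. iexp (\<theta> * birkhoff2 T f A n z) \<partial>mu_hat2 M X Xs \<nu>)) \<partial>lborel)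
        (\<lambda>n. real n powr (- b))"
  shows "AE \<omega> in M. (\<lambda>n. ennreal (real n) * (\<integral>\<^sup>+\<theta>\<in>{\<theta>. ln (real n) / (2 * sqrt (real n)) \<le> \<bar>\<theta>\<bar> \<and> \<bar>\<theta>\<bar> \<le> real N}.
      ennreal ((cmod (char (law n \<omega>) \<theta>))\<^sup>2) \<partial>lborel)) \<longlonglongrightarrow> 0"
proof -
  define \<phi> where "\<phi> = (\<lambda>n \<theta>. ennreal (cmod (\<integral>z. iexp (\<theta> * birkhoff2 T f A n z) \<partial>mu_hat2 M X Xs \<nu>)))"
  have \<phi>_eq: "(\<integral>\<^sup>+\<omega>. ennreal ((cmod (char (law n \<omega>) \<theta>))\<^sup>2) \<partial>M) = \<phi> n \<theta>" for n \<theta>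
    unfolding \<phi>_def by (rule nn_second_moment)
  have [measurable]: "\<phi> n \<in> borel_measurable borel" for n
    unfolding \<phi>_eq[symmetric, abs_def] by measurable
  let ?B = "\<lambda>n. {\<theta>. ln (real n) / (2 * sqrt (real n)) \<le> \<bar>\<theta>\<bar> \<and> \<bar>\<theta>\<bar> \<le> real N}"
  let ?H = "{\<theta>. \<delta> \<le> \<bar>\<theta>\<bar> \<and> \<bar>\<theta>\<bar> \<le> real N}"
  obtain K where K: "\<forall>\<^sub>F n in sequentially. (\<integral>\<^sup>+\<theta>\<in>?H. \<phi> n \<theta> \<partial>lborel) \<le> ennreal (K * real n powr (- b))"
    using high unfolding ennreal_bigo_def \<phi>_def by (elim exE)
  define s where "s = (\<lambda>n. real n * (2 * C * exp (- c * (ln (real n))\<^sup>2 / 4) + \<bar>K\<bar> * real n powr (- b)))"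
  show ?thesis
  proof (rule AE_tendsto_0_if_summable_nn_integral)
    show "(\<lambda>\<omega>. ennreal (real n) * (\<integral>\<^sup>+\<theta>\<in>?B n. ennreal ((cmod (char (law n \<omega>) \<theta>))\<^sup>2) \<partial>lborel)) \<in> borel_measurable M" for n
      by measurable
    show "0 \<le> s n" for n using C by (simp add: s_def)
    show "summable s"
    proof -
      have "(\<lambda>n. real n * exp (- c * (ln (real n))\<^sup>2 / 4)) \<in> O(\<lambda>n. real n powr (-2))" using c by real_asymp
      then have 1: "summable (\<lambda>n. real n * exp (- c * (ln (real n))\<^sup>2 / 4))"
        by (rule summable_comparison_test_bigo[rotated]) (simp add: summable_real_powr_iff)
      have "(\<lambda>n. real n * real n powr (- b)) \<in> O(\<lambda>n. real n powr (1 - b))" by real_asymp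
      then have 2: "summable (\<lambda>n. real n * real n powr (- b))"
        by (rule summable_comparison_test_bigo[rotated]) (use b in \<open>simp add: summable_real_powr_iff\<close>)
      have "s = (\<lambda>n. 2 * C * (real n * exp (- c * (ln (real n))\<^sup>2 / 4)) + \<bar>K\<bar> * (real n * real n powr (- b)))"
        unfolding s_def by (simp add: algebra_simps)
      then show ?thesis using summable_add[OF summable_mult[OF 1] summable_mult[OF 2]] by simp
    qed
    show "\<forall>\<^sub>F n in sequentially. (\<integral>\<^sup>+\<omega>. ennreal (real n) * (\<integral>\<^sup>+\<theta>\<in>?B n. ennreal ((cmod (char (law n \<omega>) \<theta>))\<^sup>2) \<partial>lborel) \<partial>M) \<le> ennreal (s n)"
      using K eventually_ge_at_top[of 1]
    proof eventually_elim
      case (elim n)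
      let ?e = "exp (- c * (ln (real n))\<^sup>2 / 4)"
      have "(\<integral>\<^sup>+\<omega>. (\<integral>\<^sup>+\<theta>\<in>?B n. ennreal ((cmod (char (law n \<omega>) \<theta>))\<^sup>2) \<partial>lborel) \<partial>M)
        = (\<integral>\<^sup>+\<theta>\<in>?B n. \<phi> n \<theta> \<partial>lborel)"
        unfolding \<phi>_eq[symmetric]
      proof (rule nn_integral_swap[where h = "\<lambda>\<omega> \<theta>. ennreal ((cmod (char (law n \<omega>) \<theta>))\<^sup>2)"])
        show "(\<lambda>(\<omega>, \<theta>). ennreal ((cmod (char (law n \<omega>) \<theta>))\<^sup>2)) \<in> borel_measurable (M \<Otimes>\<^sub>M lborel)"
          unfolding case_prod_unfold by measurable
        show "?B n \<in> sets borel" by measurable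
      qed
      also have "\<dots> \<le> (\<integral>\<^sup>+\<theta>. ennreal (C * ?e) * indicator {-\<delta>..\<delta>} \<theta> + \<phi> n \<theta> * indicator ?H \<theta> \<partial>lborel)"
      proof (intro nn_integral_mono)
        fix \<theta> :: real
        consider "\<theta> \<notin> ?B n" | "\<theta> \<in> ?B n" "\<theta> \<in> {-\<delta>..\<delta>}" | "\<theta> \<in> ?B n" "\<theta> \<in> ?H"
        proof (cases "\<bar>\<theta>\<bar> \<le> \<delta>")
          case True
          then have "\<theta> \<in> {-\<delta>..\<delta>}" by (simp add: abs_le_iff)
          then show ?thesis using that by blast
        next
          case False
          then have "\<theta> \<in> ?B n \<Longrightarrow> \<theta> \<in> ?H" by simp
          then show ?thesis using that by blast
        qed
        then show "\<phi> n \<theta> * indicator (?B n) \<theta> \<le> ennreal (C * ?e) * indicator {-\<delta>..\<delta>} \<theta> + \<phi> n \<theta> * indicator ?H \<theta>"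
        proof cases
          case 2
          have "ln (real n) / 2 \<le> sqrt (real n) * \<bar>\<theta>\<bar>" using 2(1) elim(2) by (simp add: field_simps)
          then have "(ln (real n) / 2)\<^sup>2 \<le> (sqrt (real n) * \<bar>\<theta>\<bar>)\<^sup>2"
            using elim(2) by (intro power_mono) auto
          then have "(ln (real n))\<^sup>2 / 4 \<le> \<theta>\<^sup>2 * real n"
            by (simp add: power_mult_distrib power_divide mult.commute)
          then have "c * ((ln (real n))\<^sup>2 / 4) \<le> c * (\<theta>\<^sup>2 * real n)" using c by (intro mult_left_mono) auto
          then have "exp (- c * \<theta>\<^sup>2 * real n) \<le> ?e" by (simp add: mult.assoc)
          then have "C * exp (- c * \<theta>\<^sup>2 * real n) \<le> C * ?e" using C by (intro mult_left_mono) auto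
          with mid[OF 2(2), of n] have "\<phi> n \<theta> \<le> ennreal (C * ?e)" unfolding \<phi>_def by (intro ennreal_leI) linarith
          then have "\<phi> n \<theta> * indicator (?B n) \<theta> \<le> ennreal (C * ?e) * indicator {-\<delta>..\<delta>} \<theta>"
            by (simp only: indicator_simps(1)[OF 2(1)] indicator_simps(1)[OF 2(2)] mult_1_right)
          then show ?thesis by (rule order_trans) simp
        next
          case 1
          then show ?thesis by (simp only: indicator_simps(2)[OF 1] mult_zero_right zero_le)
        next
          case 3
          then show ?thesis
            by (simp only: indicator_simps(1)[OF 3(1)] indicator_simps(1)[OF 3(2)] mult_1_right
                add_increasing[OF zero_le order_refl])
        qed
      qed
      also have "\<dots> = ennreal (C * ?e) * emeasure lborel {-\<delta>..\<delta>} + (\<integral>\<^sup>+\<theta>\<in>?H. \<phi> n \<theta> \<partial>lborel)"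
      proof -
        have "(\<integral>\<^sup>+\<theta>. ennreal (C * ?e) * indicator {-\<delta>..\<delta>} \<theta> + \<phi> n \<theta> * indicator ?H \<theta> \<partial>lborel)
          = (\<integral>\<^sup>+\<theta>. ennreal (C * ?e) * indicator {-\<delta>..\<delta>} \<theta> \<partial>lborel) + (\<integral>\<^sup>+\<theta>\<in>?H. \<phi> n \<theta> \<partial>lborel)"
          by (rule nn_integral_add) measurable
        then show ?thesis by (simp only: nn_integral_cmult_indicator sets_lborel borel_closed closed_atLeastAtMost)
      qed
      also have "\<dots> \<le> ennreal (C * ?e) * ennreal 2 + ennreal (\<bar>K\<bar> * real n powr (- b))"
      proof (intro add_mono mult_left_mono)
        have "K * real n powr (- b) \<le> \<bar>K\<bar> * real n powr (- b)" by (intro mult_right_mono) auto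
        from order_trans[OF elim(1) ennreal_leI[OF this]]
        show "(\<integral>\<^sup>+\<theta>\<in>?H. \<phi> n \<theta> \<partial>lborel) \<le> ennreal (\<bar>K\<bar> * real n powr (- b))" .
        have "emeasure lborel {-\<delta>..\<delta>} = ennreal (2 * \<delta>)" using \<delta> by simp
        also have "\<dots> \<le> ennreal 2" using \<delta> by (intro ennreal_leI) simp
        finally show "emeasure lborel {-\<delta>..\<delta>} \<le> ennreal 2" .
      qed simp
      also have "\<dots> = ennreal (C * ?e * 2 + \<bar>K\<bar> * real n powr (- b))"
      proof -
        have "ennreal (C * ?e) * ennreal 2 = ennreal (C * ?e * 2)"
          using C by (intro ennreal_mult'[symmetric]) simp
        moreover have "ennreal (C * ?e * 2) + ennreal (\<bar>K\<bar> * real n powr (- b)) = ennreal (C * ?e * 2 + \<bar>K\<bar> * real n powr (- b))"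
          using C by (intro ennreal_plus[symmetric]) simp_all
        ultimately show ?thesis by (simp only:)
      qed
      finally have inner: "(\<integral>\<^sup>+\<omega>. (\<integral>\<^sup>+\<theta>\<in>?B n. ennreal ((cmod (char (law n \<omega>) \<theta>))\<^sup>2) \<partial>lborel) \<partial>M)
        \<le> ennreal (C * ?e * 2 + \<bar>K\<bar> * real n powr (- b))" .
      have "(\<integral>\<^sup>+\<omega>. ennreal (real n) * (\<integral>\<^sup>+\<theta>\<in>?B n. ennreal ((cmod (char (law n \<omega>) \<theta>))\<^sup>2) \<partial>lborel) \<partial>M)
        = ennreal (real n) * (\<integral>\<^sup>+\<omega>. (\<integral>\<^sup>+\<theta>\<in>?B n. ennreal ((cmod (char (law n \<omega>) \<theta>))\<^sup>2) \<partial>lborel) \<partial>M)"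
        by (rule nn_integral_cmult) measurable
      also have "\<dots> \<le> ennreal (real n) * ennreal (C * ?e * 2 + \<bar>K\<bar> * real n powr (- b))"
        by (rule mult_left_mono[OF inner]) simp
      also have "\<dots> = ennreal (real n * (C * ?e * 2 + \<bar>K\<bar> * real n powr (- b)))"
        by (intro ennreal_mult'[symmetric]) simp
      also have "real n * (C * ?e * 2 + \<bar>K\<bar> * real n powr (- b)) = s n"
        by (simp add: s_def)
      finally show ?case .
    qed
  qed
qed

lemma gaussian_char_law:
  assumes \<omega>: "\<omega> \<in> space M" and \<alpha>: "\<alpha> > 0" and \<delta>: "\<delta> < 1 / \<alpha>"
    and incr: "\<forall>\<^sub>F n in sequentially. \<forall>k<n. (\<integral>\<^sup>+x. ennreal \<bar>S n \<omega> x - S k \<omega> x\<bar> \<partial>\<nu> \<omega>)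
        \<le> ennreal (K * (real n powr (\<delta> / 2) * (real n - real k) powr (1 / 2)))"
    and low: "(\<lambda>k. ennreal (ln (real (power_subseq \<alpha> k))) *
        (\<integral>\<^sup>+t\<in>{t. \<bar>t\<bar> \<le> ln (real (power_subseq \<alpha> k))}.
          ennreal ((cmod (char (law (power_subseq \<alpha> k) \<omega>) (t / sqrt (real (power_subseq \<alpha> k))) - of_real (exp (- (t\<^sup>2) / 2))))\<^sup>2) \<partial>lborel))
      \<longlonglongrightarrow> 0"
    and high: "\<And>N::nat. (\<lambda>n. ennreal (real n) * (\<integral>\<^sup>+\<theta>\<in>{\<theta>. ln (real n) / (2 * sqrt (real n)) \<le> \<bar>\<theta>\<bar> \<and> \<bar>\<theta>\<bar> \<le> real N}.
      ennreal ((cmod (char (law n \<omega>) \<theta>))\<^sup>2) \<partial>lborel)) \<longlonglongrightarrow> 0"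
  shows "gaussian_char (\<lambda>n. law n \<omega>)"
proof (rule gaussian_charI)
  show "real_distribution (law n \<omega>)" for n by (rule real_distribution_law[OF \<omega>])
  show "(\<lambda>n. \<integral>\<^sup>+t\<in>{t. \<bar>t\<bar> \<le> ln (real n) / 2}.
      ennreal (cmod (char (law n \<omega>) (t / sqrt (real n)) - of_real (exp (- (t\<^sup>2) / 2)))) \<partial>lborel) \<longlonglongrightarrow> 0"
    unfolding law_def
  proof (rule prob_space.char_close_low_frequencies[OF \<nu>_prob[OF \<omega>]])
    show "S n \<omega> \<in> borel_measurable (\<nu> \<omega>)" for n by (rule birkhoff_measurable_fibre[OF \<omega>])
    show "S 0 \<omega> x = 0" for x by (simp add: birkhoff_def)
  qed (fact \<alpha> \<delta> incr low[unfolded law_def])+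
qed (fact high)

end

text \<open>The uniform bound also shows that the supremum is taken over a set bounded above, without which
  \<open>SUP\<close> on the reals carries no information.\<close>

lemma uniform_llt_SUP:
  assumes "uniform_llt P G"
  shows "(\<lambda>n. SUP u. \<bar>sqrt (2 * pi * real n) * (\<integral>x. G (x - u) \<partial>P n) - exp (- (u\<^sup>2) / (2 * real n)) * (\<integral>x. G x \<partial>lborel)\<bar>) \<longlonglongrightarrow> 0"
proof (rule tendstoI)
  fix \<epsilon> :: real assume "\<epsilon> > 0"
  let ?d = "\<lambda>n u. \<bar>sqrt (2 * pi * real n) * (\<integral>x. G (x - u) \<partial>P n) - exp (- (u\<^sup>2) / (2 * real n)) * (\<integral>x. G x \<partial>lborel)\<bar>"
  have "\<epsilon> / 2 > 0" using \<open>\<epsilon> > 0\<close> by simp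
  with assms have "\<forall>\<^sub>F n in sequentially. \<forall>u. ?d n u \<le> \<epsilon> / 2"
    unfolding uniform_llt_def by blast
  then show "\<forall>\<^sub>F n in sequentially. dist (SUP u. ?d n u) 0 < \<epsilon>"
  proof eventually_elim
    case (elim n)
    have le: "(SUP u. ?d n u) \<le> \<epsilon> / 2" by (rule cSUP_least) (use elim in auto)
    have "bdd_above (range (?d n))" using elim by (intro bdd_aboveI[of _ "\<epsilon> / 2"]) auto
    then have "?d n 0 \<le> (SUP u. ?d n u)" by (intro cSUP_upper) simp_all
    then have "0 \<le> (SUP u. ?d n u)" by (rule order_trans[rotated]) simp
    with le \<open>\<epsilon> > 0\<close> show ?case by (simp add: dist_real_def)
  qed
qed

lemma bounded_interval_between:
  fixes I :: "real set"
  assumes "is_interval I" "bounded I"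
  shows "\<exists>a b. a \<le> b \<and> {a<..<b} \<subseteq> I \<and> I \<subseteq> {a..b}"
proof (cases "I = {}")
  case True
  then show ?thesis by (intro exI[of _ 0]) simp
next
  case False
  have bdd: "bdd_above I" "bdd_below I"
    using \<open>bounded I\<close> by (rule bounded_imp_bdd_above, rule bounded_imp_bdd_below)
  have "{Inf I<..<Sup I} \<subseteq> I"
  proof
    fix x assume "x \<in> {Inf I<..<Sup I}"
    then have "Inf I < x" "x < Sup I" by auto
    from cInf_lessD[OF False this(1)] less_cSupD[OF False this(2)]
    obtain y z where "y \<in> I" "y < x" "z \<in> I" "x < z" by blast
    then show "x \<in> I"
      using \<open>is_interval I\<close> unfolding is_interval_1 by (meson less_imp_le)
  qed
  moreover have "I \<subseteq> {Inf I..Sup I}" using cInf_lower cSup_upper bdd by auto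
  moreover have "Inf I \<le> Sup I" using cInf_le_cSup[OF False bdd] .
  ultimately show ?thesis by blast
qed

lemma (in gaussian_char) uniform_llt_test_functions:
  assumes "(continuous_on UNIV G \<and> compact (closure {x. G x \<noteq> 0}))
      \<or> (\<exists>I. is_interval I \<and> bounded I \<and> G = indicator I)"
  shows "uniform_llt P G" "G \<in> borel_measurable borel"
proof -
  have "uniform_llt P G \<and> G \<in> borel_measurable borel"
    using assms
  proof (elim disjE exE conjE)
    assume G: "continuous_on UNIV G" and c: "compact (closure {x. G x \<noteq> 0})"
    have "bounded (closure {x. G x \<noteq> 0})" using c by (rule compact_imp_bounded)
    then have "\<exists>R>0. \<forall>x\<in>closure {x. G x \<noteq> 0}. norm x \<le> R" by (rule bounded_pos[THEN iffD1])
    then obtain R where R: "R > 0" "\<forall>x\<in>closure {x. G x \<noteq> 0}. norm x \<le> R" by (elim exE conjE) (rule that)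
    have R': "G x = 0" if "\<bar>x\<bar> > R" for x
    proof (rule ccontr)
      assume "G x \<noteq> 0"
      then have "x \<in> closure {x. G x \<noteq> 0}" by (intro subsetD[OF closure_subset]) simp
      with R(2) have "norm x \<le> R" by (rule bspec)
      then show False using that by simp
    qed
    have "compact (G ` {-R..R})"
      by (intro compact_continuous_image continuous_on_subset[OF G]) auto
    then have "\<exists>B>0. \<forall>y\<in>G ` {-R..R}. norm y \<le> B"
      by (intro bounded_pos[THEN iffD1] compact_imp_bounded)
    then obtain B where B: "B > 0" "\<forall>y\<in>G ` {-R..R}. norm y \<le> B" by (elim exE conjE) (rule that)
    have "\<bar>G x\<bar> \<le> B" for x
    proof (cases "\<bar>x\<bar> \<le> R")
      case True
      then have "x \<in> {-R..R}" by (simp add: abs_le_iff)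
      then show ?thesis using B(2)[rule_format, OF imageI] by simp
    next
      case False
      then show ?thesis using R'[of x] B(1) by simp
    qed
    then have "uniform_llt P G"
      using R' R(1) by (intro uniform_llt_continuous[OF G, of B R]) simp_all
    then show ?thesis using borel_measurable_continuous_onI[OF G] by (rule conjI)
  next
    fix I assume I: "is_interval I" "bounded I" and G: "G = indicator I"
    obtain a b where ab: "a \<le> b" "{a<..<b} \<subseteq> I" "I \<subseteq> {a..b}"
      using bounded_interval_between[OF I] by blast
    have "I - {a<..<b} \<subseteq> {a, b}" using ab by auto
    then have "finite (I - {a<..<b})" by (rule finite_subset) simp
    then have "I - {a<..<b} \<in> sets borel" by (rule borel_closed[OF finite_imp_closed])
    then have "(I - {a<..<b}) \<union> {a<..<b} \<in> sets borel" by (intro sets.Un) auto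
    then have "I \<in> sets borel" using ab(2) by (simp add: Un_absorb2)
    then show ?thesis unfolding G using uniform_llt_interval[OF ab] by simp
  qed
  then show "uniform_llt P G" "G \<in> borel_measurable borel" by blast+
qed

theorem theorem2p6:
  fixes M :: "'s measure" and T :: "'s \<Rightarrow> 's"
    and X :: "'x measure" and Xs :: "'s \<Rightarrow> 'x set"
    and f :: "'s \<Rightarrow> 'x \<Rightarrow> 'x" and \<nu> :: "'s \<Rightarrow> 'x measure"
    and A :: "'x \<Rightarrow> real"
  assumes dyn: "random_dynamics M T X Xs f \<nu>"
    and A: "A \<in> borel_measurable X"
    and clt: "\<forall>a\<in>{0, 1::nat}. \<exists>\<eta> \<zeta> \<alpha> r \<delta>\<^sub>0 :: real.
      \<eta> > \<zeta> \<and> \<zeta> > 0 \<and> \<alpha> > 1 / (\<eta> - \<zeta>) \<and> \<alpha> * (\<eta> - \<zeta>) > 1 + r \<and> \<delta>\<^sub>0 < 1 / \<alpha> \<and>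
      ennreal_bigo (\<lambda>n. \<integral>\<^sup>+t\<in>{t. 0 \<le> \<bar>t\<bar> \<and> \<bar>t\<bar> \<le> ln (real n)}.
          ennreal (cmod (char2 M T X Xs f \<nu> A n t - of_real (exp (- (t\<^sup>2)))) / \<bar>t\<bar> ^ a) \<partial>lborel)
        (\<lambda>n. real n powr (- \<eta>)) \<and>
      ennreal_bigo (\<lambda>n. \<integral>\<^sup>+t\<in>{t. 0 \<le> \<bar>t\<bar> \<and> \<bar>t\<bar> \<le> ln (real n)}.
          ennreal (cmod (char1 M T X Xs f \<nu> A n t - of_real (exp (- (t\<^sup>2) / 2))) / \<bar>t\<bar> ^ a) \<partial>lborel)
        (\<lambda>n. real n powr (- \<eta>)) \<and>
      (AE \<omega> in M. \<exists>K::real. \<forall>\<^sub>F n in sequentially. \<forall>k<n.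
        (\<integral>\<^sup>+x. ennreal \<bar>birkhoff T f A n \<omega> x - birkhoff T f A k \<omega> x\<bar> \<partial>\<nu> \<omega>)
          \<le> ennreal (K * (real n powr (\<delta>\<^sub>0 / 2) * (real n - real k) powr (1 / 2))))"
    and llt: "\<exists>\<delta> C c b :: real. 0 < \<delta> \<and> \<delta> < 1 \<and> C > 0 \<and> c > 0 \<and> b > 2 \<and>
      (\<forall>\<theta>\<in>{-\<delta>..\<delta>}. \<forall>n::nat.
        cmod (\<integral>z. iexp (\<theta> * birkhoff2 T f A n z) \<partial>mu_hat2 M X Xs \<nu>)
          \<le> C * exp (- c * \<theta>\<^sup>2 * real n)) \<and>
      (\<forall>N::nat. ennreal_bigo
        (\<lambda>n. \<integral>\<^sup>+\<theta>\<in>{\<theta>. \<delta> \<le> \<bar>\<theta>\<bar> \<and> \<bar>\<theta>\<bar> \<le> real N}.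
            ennreal (cmod (\<integral>z. iexp (\<theta> * birkhoff2 T f A n z) \<partial>mu_hat2 M X Xs \<nu>)) \<partial>lborel)
        (\<lambda>n. real n powr (- b)))"
  shows "\<forall>G :: real \<Rightarrow> real.
    (continuous_on UNIV G \<and> compact (closure {x. G x \<noteq> 0}))
      \<or> (\<exists>I. is_interval I \<and> bounded I \<and> G = indicator I) \<longrightarrow>
    (AE \<omega> in M.
      (\<lambda>n. SUP u. \<bar>sqrt (2 * pi * real n) * (\<integral>x. G (birkhoff T f A n \<omega> x - u) \<partial>\<nu> \<omega>)
                  - exp (- (u\<^sup>2) / (2 * real n)) * (\<integral>x. G x \<partial>lborel)\<bar>)
        \<longlonglongrightarrow> 0)"
proof (intro allI impI)
  fix G :: "real \<Rightarrow> real"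
  assume G: "(continuous_on UNIV G \<and> compact (closure {x. G x \<noteq> 0}))
      \<or> (\<exists>I. is_interval I \<and> bounded I \<and> G = indicator I)"
  interpret random_dynamics_observable M T X Xs f \<nu> A
    using dyn A by (intro random_dynamics_observable.intro random_dynamics_observable_axioms.intro)
  have set_eq: "{t::real. 0 \<le> \<bar>t\<bar> \<and> \<bar>t\<bar> \<le> a} = {t. \<bar>t\<bar> \<le> a}" for a
    by simp
  have "0 \<in> {0, 1::nat}" by simp
  from bspec[OF clt this] obtain \<eta> \<zeta> \<alpha> r \<delta>\<^sub>0 where
    \<eta>: "\<eta> > \<zeta>" "\<zeta> > 0" and \<alpha>: "\<alpha> > 1 / (\<eta> - \<zeta>)" and \<delta>\<^sub>0: "\<delta>\<^sub>0 < 1 / \<alpha>"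
    and c2: "ennreal_bigo (\<lambda>n. \<integral>\<^sup>+t\<in>{t. \<bar>t\<bar> \<le> ln (real n)}.
          ennreal (cmod (char2 M T X Xs f \<nu> A n t - of_real (exp (- (t\<^sup>2))))) \<partial>lborel)
        (\<lambda>n. real n powr (- \<eta>))"
    and c1: "ennreal_bigo (\<lambda>n. \<integral>\<^sup>+t\<in>{t. \<bar>t\<bar> \<le> ln (real n)}.
          ennreal (cmod (char1 M T X Xs f \<nu> A n t - of_real (exp (- (t\<^sup>2) / 2)))) \<partial>lborel)
        (\<lambda>n. real n powr (- \<eta>))"
    and incr: "AE \<omega> in M. \<exists>K::real. \<forall>\<^sub>F n in sequentially. \<forall>k<n.
        (\<integral>\<^sup>+x. ennreal \<bar>birkhoff T f A n \<omega> x - birkhoff T f A k \<omega> x\<bar> \<partial>\<nu> \<omega>)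
          \<le> ennreal (K * (real n powr (\<delta>\<^sub>0 / 2) * (real n - real k) powr (1 / 2)))"
    unfolding set_eq power_0 div_by_1 by (elim exE conjE) (rule that)
  have "0 < 1 / (\<eta> - \<zeta>)" using \<eta> by simp
  then have \<alpha>0: "\<alpha> > 0" using \<alpha> by linarith
  from llt obtain \<delta> C c b where \<delta>: "0 < \<delta>" "\<delta> < 1" and C: "C > 0" "c > 0" "b > 2"
    and mid: "\<forall>\<theta>\<in>{-\<delta>..\<delta>}. \<forall>n::nat. cmod (\<integral>z. iexp (\<theta> * birkhoff2 T f A n z) \<partial>mu_hat2 M X Xs \<nu>)
          \<le> C * exp (- c * \<theta>\<^sup>2 * real n)"
    and high: "\<forall>N::nat. ennreal_bigo
        (\<lambda>n. \<integral>\<^sup>+\<theta>\<in>{\<theta>. \<delta> \<le> \<bar>\<theta>\<bar> \<and> \<bar>\<theta>\<bar> \<le> real N}.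
            ennreal (cmod (\<integral>z. iexp (\<theta> * birkhoff2 T f A n z) \<partial>mu_hat2 M X Xs \<nu>)) \<partial>lborel)
        (\<lambda>n. real n powr (- b))"
    by (elim exE conjE) (rule that)
  have "AE \<omega> in M. \<forall>N::nat. (\<lambda>n. ennreal (real n) *
      (\<integral>\<^sup>+\<theta>\<in>{\<theta>. ln (real n) / (2 * sqrt (real n)) \<le> \<bar>\<theta>\<bar> \<and> \<bar>\<theta>\<bar> \<le> real N}.
        ennreal ((cmod (char (law n \<omega>) \<theta>))\<^sup>2) \<partial>lborel)) \<longlonglongrightarrow> 0"
    unfolding AE_all_countable
    by (intro allI AE_high_frequencies[OF \<delta> C mid[rule_format] high[rule_format]])
  with AE_low_frequencies[OF \<eta> \<alpha> c2 c1] incr AE_space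
  show "AE \<omega> in M.
      (\<lambda>n. SUP u. \<bar>sqrt (2 * pi * real n) * (\<integral>x. G (birkhoff T f A n \<omega> x - u) \<partial>\<nu> \<omega>)
                  - exp (- (u\<^sup>2) / (2 * real n)) * (\<integral>x. G x \<partial>lborel)\<bar>)
        \<longlonglongrightarrow> 0"
  proof eventually_elim
    case (elim \<omega>)
    note \<omega> = elim(3)
    from elim(2) obtain K where K: "\<forall>\<^sub>F n in sequentially. \<forall>k<n.
        (\<integral>\<^sup>+x. ennreal \<bar>birkhoff T f A n \<omega> x - birkhoff T f A k \<omega> x\<bar> \<partial>\<nu> \<omega>)
          \<le> ennreal (K * (real n powr (\<delta>\<^sub>0 / 2) * (real n - real k) powr (1 / 2)))"
      by (elim exE)
    interpret L: gaussian_char "\<lambda>n. law n \<omega>"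
      by (rule gaussian_char_law[OF \<omega> \<alpha>0 \<delta>\<^sub>0 K elim(1) elim(4)[rule_format]])
    note G_measurable = L.uniform_llt_test_functions(2)[OF G]
    have "(\<integral>x. G (birkhoff T f A n \<omega> x - u) \<partial>\<nu> \<omega>) = (\<integral>x. G (x - u) \<partial>law n \<omega>)" for n u
      unfolding law_def
      by (rule integral_distr[symmetric, OF birkhoff_measurable_fibre[OF \<omega>]]) (use G_measurable in measurable)
    then show ?case
      using uniform_llt_SUP[OF L.uniform_llt_test_functions(1)[OF G]] by (simp only:)
  qed
qed

end
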